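(* If $\Omega=(0,a)$, with $a>0$, then $\{H^s(\Omega):0\le s\le2\}$ is not an exact interpolation scale. In particular, where $\overline H_\theta:=(L^2(\Omega),H^2(\Omega))_\theta$, it holds that $\overline H_\theta=H^{2\theta}(\Omega)$ for $0<\theta<1$, but $\|1\|_{\overline H_{1/2}}\ne\|1\|_{H^1(\Omega)}$ (where $1$ denotes the constant function). Precisely, $$\frac{\|1\|_{\overline H_{1/2}}}{\|1\|_{H^1(\Omega)}}\le\left(\frac{a^2+4a}{a^2+4a+4}\right)^{1/4}<\min(a^{1/4},1).$$
   Context: For $s\in\mathbb{R}$, $H^s(\mathbb{R}^n):=\{u\in\mathscr{S}^*(\mathbb{R}^n):\|u\|_{H^s(\mathbb{R}^n)}:=(\int_{\mathbb{R}^n}(1+|\xi|^2)^s|\hat u(\xi)|^2\,d\xi)^{1/2}<\infty\}$, where $\mathscr{S}^*(\mathbb{R}^n)$ is the space of tempered distributions and $\hat u(\xi)=(2\pi)^{-n/2}\int_{\mathbb{R}^n}e^{-i\xi\cdot x}u(x)\,dx$. For open $\Omega\subset\mathbb{R}^n$, $H^s(\Omega):=\{u\in\mathscr{D}^*(\Omega):u=U|_\Omega\text{ for some }U\in H^s(\mathbb{R}^n)\}$ with norm $\|u\|_{H^s(\Omega)}:=\inf\{\|U\|_{H^s(\mathbb{R}^n)}:U|_\Omega=u\}$; $H^0(\Omega)=L^2(\Omega)$ with equal norms. For Hilbert spaces $H_0,H_1$ contained in a common vector space and compatible (here $H_0\cap H_1$ and $H_0+H_1$ are Banach spaces with their natural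 norms), and $0<\theta<1$, $\overline H_\theta=(H_0,H_1)_\theta$ is the real interpolation space of all $\phi\in H_0+H_1$ with finite norm $\|\phi\|_{\overline H_\theta}:=N_{\theta,2}\left(\int_0^\infty|t^{-\theta}K(t,\phi)|^2\frac{dt}{t}\right)^{1/2}$, where $K(t,\phi):=\inf\{(\|\phi_0\|_{H_0}^2+t^2\|\phi_1\|_{H_1}^2)^{1/2}:\phi_j\in H_j,\ \phi_0+\phi_1=\phi\}$ and $N_{\theta,2}:=((2/\pi)\sin(\pi\theta))^{1/2}$. For a closed interval $\mathcal I\subset\mathbb{R}$, a collection of Hilbert spaces $\{H_s:s\in\mathcal I\}$ is an interpolation scale if, for all $s,t\in\mathcal I$ and $0<\eta<1$, $(H_s,H_t)_\eta=H_\theta$ for $\theta=(1-\eta)s+\eta t$; it is an exact interpolation scale if, moreover, the norms of $(H_s,H_t)_\eta$ and $H_\theta$ are equal for all such $s,t,\eta$. *)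

theory Defs
  imports "HOL-Analysis.Analysis" "HOL-Library.Function_Algebras"
begin

section \<open>Real interpolation\<close>

text \<open>
  A linear subspace of an ambient additive group together with a norm on it.  Only the values
  of \<open>nrm\<close> on \<open>carr\<close> are meaningful.
\<close>

record 'v normed_subspace =
  carr :: "'v set"
  nrm :: "'v \<Rightarrow> real"

definition K_fun ::
  "'v::ab_group_add normed_subspace \<Rightarrow> 'v normed_subspace \<Rightarrow> real \<Rightarrow> 'v \<Rightarrow> real" where
  "K_fun H0 H1 t \<phi> =
     Inf {sqrt ((nrm H0 \<phi>0)\<^sup>2 + t\<^sup>2 * (nrm H1 \<phi>1)\<^sup>2) | \<phi>0 \<phi>1.
            \<phi>0 \<in> carr H0 \<and> \<phi>1 \<in> carr H1 \<and> \<phi>0 + \<phi>1 = \<phi>}"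

definition interp_integral ::
  "'v::ab_group_add normed_subspace \<Rightarrow> 'v normed_subspace \<Rightarrow> real \<Rightarrow> 'v \<Rightarrow> ennreal" where
  "interp_integral H0 H1 \<theta> \<phi> =
     (\<integral>\<^sup>+ t\<in>{0<..}. ennreal (\<bar>t powr (-\<theta>) * K_fun H0 H1 t \<phi>\<bar>\<^sup>2 / t) \<partial>lborel)"

definition interp_const :: "real \<Rightarrow> real" where
  "interp_const \<theta> = sqrt ((2 / pi) * sin (pi * \<theta>))"

definition interp ::
  "'v::ab_group_add normed_subspace \<Rightarrow> 'v normed_subspace \<Rightarrow> real \<Rightarrow> 'v normed_subspace" where
  "interp H0 H1 \<theta> = \<lparr>
     carr = {\<phi>. (\<exists>\<phi>0\<in>carr H0. \<exists>\<phi>1\<in>carr H1. \<phi>0 + \<phi>1 = \<phi>) \<and> interp_integral H0 H1 \<theta> \<phi> < \<infinity>},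
     nrm = (\<lambda>\<phi>. interp_const \<theta> * sqrt (enn2real (interp_integral H0 H1 \<theta> \<phi>)))\<rparr>"

text \<open>
  Equality of Banach spaces is, as usual, equality of the underlying sets with equivalent norms
  (for Banach spaces embedded continuously in a common Hausdorff space the second part is
  automatic by the closed graph theorem); \<open>eq_space_isometric\<close> is equality with equal norms.
\<close>

definition eq_space :: "'v normed_subspace \<Rightarrow> 'v normed_subspace \<Rightarrow> bool" where
  "eq_space X Y \<longleftrightarrow> carr X = carr Y \<and>
     (\<exists>c>0. \<exists>C>0. \<forall>u\<in>carr X. c * nrm X u \<le> nrm Y u \<and> nrm Y u \<le> C * nrm X u)"

definition eq_space_isometric :: "'v normed_subspace \<Rightarrow> 'v normed_subspace \<Rightarrow> bool" where
  "eq_space_isometric X Y \<longleftrightarrow> eq_space X Y \<and> (\<forall>u\<in>carr X. nrm X u = nrm Y u)"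

text \<open>
  These two notions are meant for families of Hilbert spaces indexed by a closed interval; the
  Hilbert space property is a standing assumption and not part of the predicates.
\<close>

definition interpolation_scale :: "real set \<Rightarrow> (real \<Rightarrow> 'v::ab_group_add normed_subspace) \<Rightarrow> bool" where
  "interpolation_scale I H \<longleftrightarrow>
     (\<forall>s\<in>I. \<forall>t\<in>I. \<forall>\<eta>. 0 < \<eta> \<and> \<eta> < 1 \<longrightarrow>
        eq_space (interp (H s) (H t) \<eta>) (H ((1 - \<eta>) * s + \<eta> * t)))"

definition exact_interpolation_scale ::
  "real set \<Rightarrow> (real \<Rightarrow> 'v::ab_group_add normed_subspace) \<Rightarrow> bool" where
  "exact_interpolation_scale I H \<longleftrightarrow>
     interpolation_scale I H \<and>
     (\<forall>s\<in>I. \<forall>t\<in>I. \<forall>\<eta>. 0 < \<eta> \<and> \<eta> < 1 \<longrightarrow>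
        eq_space_isometric (interp (H s) (H t) \<eta>) (H ((1 - \<eta>) * s + \<eta> * t)))"


section \<open>Test functions and distributions on the real line\<close>

definition nth_vderiv :: "nat \<Rightarrow> (real \<Rightarrow> complex) \<Rightarrow> real \<Rightarrow> complex" where
  "nth_vderiv m f = ((\<lambda>g x. vector_derivative g (at x)) ^^ m) f"

definition smooth :: "(real \<Rightarrow> complex) \<Rightarrow> bool" where
  "smooth f \<longleftrightarrow> (\<forall>m x. nth_vderiv m f differentiable (at x))"

definition schwartz :: "(real \<Rightarrow> complex) set" where
  "schwartz = {\<phi>. smooth \<phi> \<and>
     (\<forall>k m. bounded (range (\<lambda>x. of_real (x ^ k) * nth_vderiv m \<phi> x)))}"

definition test_functions :: "real set \<Rightarrow> (real \<Rightarrow> complex) set" where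
  "test_functions \<Omega> = {\<phi>. smooth \<phi> \<and>
     compact (closure {x. \<phi> x \<noteq> 0}) \<and> closure {x. \<phi> x \<noteq> 0} \<subseteq> \<Omega>}"

text \<open>
  A functional on a space \<open>D\<close> of test functions is represented by a total function vanishing
  off \<open>D\<close>.  Thus equal functionals are equal objects, and pointwise addition of functions is
  addition of functionals.
\<close>

type_synonym functional = "(real \<Rightarrow> complex) \<Rightarrow> complex"

definition linear_functional_on :: "(real \<Rightarrow> complex) set \<Rightarrow> functional \<Rightarrow> bool" where
  "linear_functional_on D u \<longleftrightarrow>
     (\<forall>\<phi>\<in>D. \<forall>\<psi>\<in>D. u (\<lambda>x. \<phi> x + \<psi> x) = u \<phi> + u \<psi>) \<and>
     (\<forall>c. \<forall>\<phi>\<in>D. u (\<lambda>x. c * \<phi> x) = c * u \<phi>) \<and>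
     (\<forall>\<phi>. \<phi> \<notin> D \<longrightarrow> u \<phi> = 0)"

text \<open>Continuity is expressed through the seminorms defining the topologies.\<close>

definition tempered_distributions :: "functional set" where
  "tempered_distributions = {u. linear_functional_on schwartz u \<and>
     (\<exists>N C. \<forall>\<phi>\<in>schwartz.
        cmod (u \<phi>) \<le> C * (\<Sum>k\<le>N. \<Sum>m\<le>N. SUP x. cmod (of_real (x ^ k) * nth_vderiv m \<phi> x)))}"

definition distributions :: "real set \<Rightarrow> functional set" where
  "distributions \<Omega> = {u. linear_functional_on (test_functions \<Omega>) u \<and>
     (\<forall>S. compact S \<and> S \<subseteq> \<Omega> \<longrightarrow>
        (\<exists>N C. \<forall>\<phi>\<in>test_functions \<Omega>. closure {x. \<phi> x \<noteq> 0} \<subseteq> S \<longrightarrow>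
           cmod (u \<phi>) \<le> C * (\<Sum>m\<le>N. SUP x. cmod (nth_vderiv m \<phi> x))))}"

definition restrict_distr :: "real set \<Rightarrow> functional \<Rightarrow> functional" where
  "restrict_distr \<Omega> U = (\<lambda>\<phi>. if \<phi> \<in> test_functions \<Omega> then U \<phi> else 0)"

text \<open>The identification of a function on \<open>\<Omega>\<close> with a distribution on \<open>\<Omega>\<close>.\<close>

definition fun_distr :: "real set \<Rightarrow> (real \<Rightarrow> complex) \<Rightarrow> functional" where
  "fun_distr \<Omega> f =
     (\<lambda>\<phi>. if \<phi> \<in> test_functions \<Omega> then (LINT x:\<Omega>|lborel. f x * \<phi> x) else 0)"


section \<open>Sobolev spaces\<close>

definition fourier :: "(real \<Rightarrow> complex) \<Rightarrow> real \<Rightarrow> complex" where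
  "fourier \<phi> \<xi> = of_real ((2 * pi) powr (-1/2)) *
     (LINT x|lborel. exp (- \<i> * of_real (\<xi> * x)) * \<phi> x)"

text \<open>
  The distributional Fourier transform of \<open>u\<close>, that is \<open>\<phi> \<mapsto> u (fourier \<phi>)\<close>, is given by
  the function \<open>g\<close>.  Such a \<open>g\<close> is unique up to a null set, so that the choice in
  \<open>fourier_density\<close> does not matter below.
\<close>

definition has_fourier_density :: "functional \<Rightarrow> (real \<Rightarrow> complex) \<Rightarrow> bool" where
  "has_fourier_density u g \<longleftrightarrow> g \<in> borel_measurable lborel \<and>
     (\<forall>\<phi>\<in>schwartz. integrable lborel (\<lambda>\<xi>. g \<xi> * \<phi> \<xi>) \<and>
        u (fourier \<phi>) = (LINT \<xi>|lborel. g \<xi> * \<phi> \<xi>))"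

definition fourier_density :: "functional \<Rightarrow> real \<Rightarrow> complex" where
  "fourier_density u = (SOME g. has_fourier_density u g)"

definition Sobolev_line :: "real \<Rightarrow> functional normed_subspace" where
  "Sobolev_line s = \<lparr>
     carr = {u \<in> tempered_distributions. \<exists>g. has_fourier_density u g \<and>
               integrable lborel (\<lambda>\<xi>. (1 + \<xi>\<^sup>2) powr s * (cmod (g \<xi>))\<^sup>2)},
     nrm = (\<lambda>u. sqrt (LINT \<xi>|lborel. (1 + \<xi>\<^sup>2) powr s * (cmod (fourier_density u \<xi>))\<^sup>2))\<rparr>"

definition Sobolev :: "real set \<Rightarrow> real \<Rightarrow> functional normed_subspace" where
  "Sobolev \<Omega> s = \<lparr>
     carr = {u \<in> distributions \<Omega>. \<exists>U\<in>carr (Sobolev_line s). restrict_distr \<Omega> U = u},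
     nrm = (\<lambda>u. Inf {nrm (Sobolev_line s) U | U.
                       U \<in> carr (Sobolev_line s) \<and> restrict_distr \<Omega> U = u})\<rparr>"

definition L2_functions :: "real set \<Rightarrow> (real \<Rightarrow> complex) set" where
  "L2_functions \<Omega> = {f. set_borel_measurable lborel \<Omega> f \<and>
     set_integrable lborel \<Omega> (\<lambda>x. (cmod (f x))\<^sup>2)}"

text \<open>
  \<open>L\<^sup>2(\<Omega>)\<close> as a space of distributions on \<open>\<Omega>\<close>, so that it shares an ambient space with
  the \<open>H\<^sup>s(\<Omega>)\<close>; two functions yield the same distribution iff they agree almost everywhere
  on \<open>\<Omega>\<close>.
\<close>

definition L2_space :: "real set \<Rightarrow> functional normed_subspace" where
  "L2_space \<Omega> = \<lparr>
     carr = fun_distr \<Omega> ` L2_functions \<Omega>,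
     nrm = (\<lambda>u. let f = (SOME f. f \<in> L2_functions \<Omega> \<and> fun_distr \<Omega> f = u)
                 in sqrt (LINT x:\<Omega>|lborel. (cmod (f x))\<^sup>2))\<rparr>"

end

theory Submission
  imports Defs "HOL-Probability.Probability" "HOL-Real_Asymp.Real_Asymp"
begin

text \<open>
  On the Fourier side the line is diagonal: splitting a density pointwise by the weight
  $t^2 w^2/(1+t^2 w^2)$ with $w = 1+\<xi>^2$ computes the K-functional of $(L^2, H^2)$, and integrating
  in $t$ returns $w^{2\<theta>}$.  For the interval, restriction is a contraction and a Hestenes
  reflection is an extension bounded on both $L^2$ and $H^2$, so the interpolation space is $H^{2\<theta>}$
  with equivalent norms.

  For the constant 1, splitting along the line spanned by 1 gives
  $K(t,1)^2 \<le> t^2AB/(A+t^2B)$ with $A = \<parallel>1\<parallel>^2_{L^2} = a$ and $B = \<parallel>1\<parallel>^2_{H^2} \<le> a+4$ (extend by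
  $(1+d)e^{-d}$, where $d$ is the distance to the interval), hence interpolation norm at most $(AB)^{1/4}$.
  In $H^1$ the functional $U \<mapsto> \<integral>_0^a U + U(0) + U(a)$ is represented by $e^{-d}$, which has squared norm
  $a+2$, so every extension of 1 has squared norm at least $a+2 > (a(a+4))^{1/2}$.
\<close>


section \<open>Smooth, Schwartz and test functions\<close>

text \<open>For s >= 0 every element of H^s on the line is \<open>fourier_distr g\<close> with
  \<open>g\<close> in \<open>weighted_L2 s\<close>, so distributions are handled through their
  densities. Norms on the interval are infima over such densities: an upper bound exhibits one of
  them, a lower bound has to treat all. The obstacle on the interval is that K is an infimum over
  splittings of a restricted distribution. A linear extension turns each of them into a splitting on
  the line, provided that one and the same operator is bounded on both end spaces. Order 2 asks that
  value and slope match at an endpoint, hence two reflected terms and a cutoff with a double zero at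
  the far end. The extension constants spoil equality of norms, so the identification with H^(2
  theta) is an equivalence. For the constant function the constants must be sharp: at theta = 1/2
  the normalisation 2/pi cancels an arctangent integral pi/2, and a(a+4) < (a+2)^2 yields the strict
  inequality. The quotient of these two numbers is the fraction in the claim. Plancherel enters as
  an inequality; by reflection it holds for the inverse transform as well, and together they give
  the contractions in both directions.\<close>

lemma nth_vderiv_Suc: "nth_vderiv (Suc m) f x = vector_derivative (nth_vderiv m f) (at x)"
  by (simp add: nth_vderiv_def)

lemma nth_vderiv_0 [simp]: "nth_vderiv 0 f = f"
  by (simp add: nth_vderiv_def)

lemma smooth_nth_vderiv:
  assumes "smooth f"
  shows "(nth_vderiv m f has_vector_derivative nth_vderiv (Suc m) f x) (at x)"
  using assms unfolding smooth_def nth_vderiv_Suc by (auto simp: vector_derivative_works)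

lemma smooth_has_vderiv:
  assumes "smooth f"
  shows "(f has_vector_derivative nth_vderiv (Suc 0) f x) (at x)"
  using smooth_nth_vderiv[OF assms, of 0] by simp

lemma smooth_nth: assumes "smooth f" shows "smooth (nth_vderiv m f)"
proof -
  have "nth_vderiv k (nth_vderiv m f) = nth_vderiv (k + m) f" for k
    by (simp add: nth_vderiv_def funpow_add)
  then show ?thesis using assms unfolding smooth_def by auto
qed

text \<open>By uniqueness of derivatives the iterates of \<open>nth_vderiv\<close> never leave
  \<open>S\<close>. Smoothness is thus shown by naming a class that is closed under one
  differentiation, without formulas for higher derivatives.\<close>

lemma smooth_coinduct:
  assumes "f \<in> S" and S: "\<And>h. h \<in> S \<Longrightarrow> \<exists>h'\<in>S. \<forall>x. (h has_vector_derivative h' x) (at x)"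
  shows "smooth f" "nth_vderiv m f \<in> S"
proof -
  have *: "nth_vderiv m f \<in> S" for m
  proof (induction m)
    case (Suc m)
    from S[OF this] obtain h' where h': "h' \<in> S"
      "\<And>x. (nth_vderiv m f has_vector_derivative h' x) (at x)" by auto
    have "nth_vderiv (Suc m) f = h'"
      unfolding nth_vderiv_Suc fun_eq_iff using h'(2) vector_derivative_at by blast
    then show ?case using h' by simp
  qed (simp add: assms)
  then show "nth_vderiv m f \<in> S" .
  show "smooth f" unfolding smooth_def
    using S[OF *] differentiableI_vector by blast
qed

lemma smooth_continuous: "smooth f \<Longrightarrow> continuous_on A f"
  by (rule continuous_at_imp_continuous_on) (use smooth_has_vderiv has_vector_derivative_continuous in fast)

lemma smooth_add: assumes "smooth f" "smooth g" shows "smooth (\<lambda>x. f x + g x)"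
proof (rule smooth_coinduct(1)[where S="{\<lambda>x. f x + g x |f g. smooth f \<and> smooth g}"])
  fix h assume "h \<in> {\<lambda>x. f x + g x |f g. smooth f \<and> smooth g}"
  then obtain f g where fg: "smooth f" "smooth g" and h: "h = (\<lambda>x. f x + g x)" by auto
  show "\<exists>h'\<in>{\<lambda>x. f x + g x |f g. smooth f \<and> smooth g}. \<forall>x. (h has_vector_derivative h' x) (at x)"
    unfolding h
  proof (rule bexI[of _ "\<lambda>x. nth_vderiv (Suc 0) f x + nth_vderiv (Suc 0) g x"])
    show "\<forall>x. ((\<lambda>x. f x + g x) has_vector_derivative nth_vderiv (Suc 0) f x + nth_vderiv (Suc 0) g x) (at x)"
      using has_vector_derivative_add[OF smooth_has_vderiv[OF fg(1)] smooth_has_vderiv[OF fg(2)]] by simp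
  qed (use fg smooth_nth in blast)
qed (use assms in auto)

text \<open>Sums of products of smooth functions: the product rule maps this class to itself, which
  replaces the Leibniz formula in \<open>smooth_mult\<close>.\<close>

inductive_set smooth_alg :: "(real \<Rightarrow> complex) set" where
  prod: "smooth f \<Longrightarrow> smooth g \<Longrightarrow> (\<lambda>x. f x * g x) \<in> smooth_alg"
| add: "f \<in> smooth_alg \<Longrightarrow> g \<in> smooth_alg \<Longrightarrow> (\<lambda>x. f x + g x) \<in> smooth_alg"

lemma smooth_mult: assumes "smooth f" "smooth g" shows "smooth (\<lambda>x. f x * g x)"
proof (rule smooth_coinduct(1)[where S=smooth_alg])
  show "\<exists>h'\<in>smooth_alg. \<forall>x. (h has_vector_derivative h' x) (at x)" if "h \<in> smooth_alg" for h
    using that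
  proof induction
    case (prod f g)
    show ?case
    proof (rule bexI[of _ "\<lambda>x. f x * nth_vderiv (Suc 0) g x + nth_vderiv (Suc 0) f x * g x"])
      show "\<forall>x. ((\<lambda>x. f x * g x) has_vector_derivative f x * nth_vderiv (Suc 0) g x + nth_vderiv (Suc 0) f x * g x) (at x)"
        using has_vector_derivative_mult[OF smooth_has_vderiv[OF prod(1)] smooth_has_vderiv[OF prod(2)]] by simp
    qed (rule smooth_alg.add[OF smooth_alg.prod[OF prod(1) smooth_nth[OF prod(2)]] smooth_alg.prod[OF smooth_nth[OF prod(1)] prod(2)]])
  next
    case (add f g)
    then obtain f' g' where "f' \<in> smooth_alg" "g' \<in> smooth_alg"
      "\<And>x. (f has_vector_derivative f' x) (at x)" "\<And>x. (g has_vector_derivative g' x) (at x)"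
      by auto
    then show ?case
      by (intro bexI[of _ "\<lambda>x. f' x + g' x"] allI has_vector_derivative_add smooth_alg.add)
  qed
qed (rule smooth_alg.prod[OF assms])

lemma smooth_const: "smooth (\<lambda>x. c)"
  by (rule smooth_coinduct(1)[where S="range (\<lambda>c x. c)"]) (auto intro!: exI[of _ 0] has_vector_derivative_const)

lemma smooth_of_real: "smooth of_real"
proof (rule smooth_coinduct(1)[where S="insert of_real (range (\<lambda>c x. c))"])
  fix h :: "real \<Rightarrow> complex" assume "h \<in> insert of_real (range (\<lambda>c x. c))"
  moreover have "((of_real :: real \<Rightarrow> complex) has_vector_derivative 1) (at x)" for x
    using has_vector_derivative_of_real[OF DERIV_ident] by simp
  ultimately show "\<exists>h'\<in>insert of_real (range (\<lambda>c x. c)). \<forall>x. (h has_vector_derivative h' x) (at x)"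
    by (auto intro!: bexI[of _ "\<lambda>x. 0"] bexI[of _ "\<lambda>x. 1"] has_vector_derivative_const)
qed auto

text \<open>The free factor \<open>c\<close> absorbs the inner derivative \<open>a\<close>, so that
  functions of this shape form a class closed under differentiation.\<close>

lemma smooth_affine: assumes "smooth f" shows "smooth (\<lambda>x. c * f (a * x + b))"
proof (rule smooth_coinduct(1)[where S="{\<lambda>x. c * f (a * x + b) |c f. smooth f}"])
  fix h assume "h \<in> {\<lambda>x. c * f (a * x + b) |c f. smooth f}"
  then obtain c f where f: "smooth f" and h: "h = (\<lambda>x. c * f (a * x + b))" by auto
  have d: "((\<lambda>x. c * f (a * x + b)) has_vector_derivative c * of_real a * nth_vderiv (Suc 0) f (a * x + b)) (at x)" for x
  proof -
    have "((\<lambda>x. f (a * x + b)) has_vector_derivative a *\<^sub>R nth_vderiv (Suc 0) f (a * x + b)) (at x)"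
    proof -
      have "((\<lambda>x. a * x + b) has_vector_derivative a) (at x)"
        by (auto intro!: derivative_eq_intros)
      from vector_diff_chain_at[OF this smooth_has_vderiv[OF f]] show ?thesis by (simp add: o_def)
    qed
    from has_vector_derivative_mult_right[OF this, of c] show ?thesis
      by (simp add: scaleR_conv_of_real mult_ac)
  qed
  show "\<exists>h'\<in>{\<lambda>x. c * f (a * x + b) |c f. smooth f}. \<forall>x. (h has_vector_derivative h' x) (at x)"
    unfolding h using d smooth_nth[OF f]
    by (intro bexI[of _ "\<lambda>x. c * of_real a * nth_vderiv (Suc 0) f (a * x + b)"]) auto
qed (use assms in auto)

section \<open>Smooth bumps and test functions\<close>

lemma poly_inverse_exp_tendsto_0:
  "((\<lambda>x::real. poly p (1 / x) * exp (- (1 / x))) \<longlongrightarrow> 0) (at_right 0)"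
proof -
  have "((\<lambda>y::real. poly p y * exp (- y)) \<longlongrightarrow> 0) at_top"
  proof -
    have "((\<lambda>y::real. \<Sum>i\<le>degree p. coeff p i * (y ^ i / exp y)) \<longlongrightarrow> (\<Sum>i\<le>degree p. coeff p i * 0)) at_top"
      by (intro tendsto_intros tendsto_power_div_exp_0)
    then show ?thesis
      by (simp add: poly_altdef sum_distrib_left exp_minus divide_inverse mult_ac)
  qed
  from filterlim_compose[OF this filterlim_inverse_at_top_right] show ?thesis
    by (simp add: divide_inverse)
qed

text \<open>Derivatives of $e^{-1/x}$ are of this form, which makes the class closed under differentiation.\<close>

definition flat_exp :: "real poly \<Rightarrow> real \<Rightarrow> real" where
  "flat_exp p x = (if x > 0 then poly p (1 / x) * exp (- (1 / x)) else 0)"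

text \<open>With y = 1/x the chain rule gives y^2 (p(y) - p'(y)) e^(-y), and
  \<open>[:0, 0, 1:]\<close> is y^2. Only the point 0 requires a limit.\<close>

lemma flat_exp_has_real_derivative:
  "(flat_exp p has_real_derivative flat_exp ([:0, 0, 1:] * (p - pderiv p)) x) (at x)"
proof -
  let ?q = "[:0, 0, 1:] * (p - pderiv p)"
  consider "x > 0" | "x < 0" | "x = 0" by linarith
  then show ?thesis
  proof cases
    case 1
    have "((\<lambda>x. poly p (1 / x) * exp (- (1 / x))) has_real_derivative flat_exp ?q x) (at x)"
    proof -
      have i: "((\<lambda>x. 1 / x) has_real_derivative - (1 / x\<^sup>2)) (at x)"
        using 1 by (auto intro!: derivative_eq_intros simp: power2_eq_square)
      show ?thesis
        using DERIV_mult[OF DERIV_chain2[OF poly_DERIV[of p] i] DERIV_fun_exp[OF DERIV_minus[OF i]]] 1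
        by (simp add: flat_exp_def power2_eq_square field_simps)
    qed
    moreover have "\<forall>\<^sub>F y in nhds x. flat_exp p y = poly p (1 / y) * exp (- (1 / y))"
      using eventually_nhds_in_open[of "{0<..}" x] 1
      by (auto elim!: eventually_mono simp: flat_exp_def)
    ultimately show ?thesis by (subst DERIV_cong_ev) auto
  next
    case 2
    have "\<forall>\<^sub>F y in nhds x. flat_exp p y = 0"
      using eventually_nhds_in_open[of "{..<0}" x] 2
      by (auto elim!: eventually_mono simp: flat_exp_def)
    then have "(flat_exp p has_real_derivative 0) (at x)"
      by (subst DERIV_cong_ev[of x x _ "\<lambda>_. 0" 0 0]) auto
    then show ?thesis using 2 by (simp add: flat_exp_def)
  next
    case 3
    have "((\<lambda>y. (flat_exp p y - flat_exp p 0) / (y - 0)) \<longlongrightarrow> 0) (at_left 0)"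
      by (rule tendsto_eventually) (auto simp: flat_exp_def eventually_at_filter)
    \<comment> \<open>Dividing by x multiplies the polynomial in 1/x by its variable, so the
      difference quotient is again a polynomial in 1/x times e^(-1/x).\<close>
    moreover have "((\<lambda>y. (flat_exp p y - flat_exp p 0) / (y - 0)) \<longlongrightarrow> 0) (at_right 0)"
      by (rule Lim_transform_eventually[OF poly_inverse_exp_tendsto_0[of "[:0, 1:] * p"]])
         (auto simp: flat_exp_def eventually_at_filter)
    ultimately have "((\<lambda>y. (flat_exp p y - flat_exp p 0) / (y - 0)) \<longlongrightarrow> 0) (at 0)"
      by (simp add: filterlim_split_at)
    then show ?thesis
      using 3 by (simp add: has_field_derivative_iff flat_exp_def)
  qed
qed

lemma smooth_flat_exp: "smooth (\<lambda>x. of_real (flat_exp p x))"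
proof (rule smooth_coinduct(1)[where S="range (\<lambda>p x. of_real (flat_exp p x))"])
  fix h :: "real \<Rightarrow> complex" assume "h \<in> range (\<lambda>p x. of_real (flat_exp p x))"
  then obtain p where h: "h = (\<lambda>x. of_real (flat_exp p x))" by auto
  have "(h has_vector_derivative of_real (flat_exp ([:0, 0, 1:] * (p - pderiv p)) x)) (at x)" for x
    unfolding h
    by (rule has_vector_derivative_of_real[OF flat_exp_has_real_derivative])
  then show "\<exists>h'\<in>range (\<lambda>p x. of_real (flat_exp p x)). \<forall>x. (h has_vector_derivative h' x) (at x)"
    by (intro bexI[OF _ rangeI]) auto
qed auto

text \<open>The factor \<open>n\<close> rescales e^(-1/x) so that both factors tend to 1 at every
  interior point. For n -> infinity the bumps approximate the indicator of (c, d) under the bound 1;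
  with n = 1 they serve as one test function without zeros in (c, d).\<close>

definition bump :: "real \<Rightarrow> real \<Rightarrow> nat \<Rightarrow> real \<Rightarrow> complex" where
  "bump c d n x = of_real (flat_exp 1 (real n * (x - c))) * of_real (flat_exp 1 (real n * (d - x)))"

lemma smooth_bump: "smooth (bump c d n)"
  using smooth_mult[OF smooth_affine[OF smooth_flat_exp, of 1 1 "real n" "- (real n * c)"]
        smooth_affine[OF smooth_flat_exp, of 1 1 "- real n" "real n * d"]]
  by (simp add: bump_def[abs_def] algebra_simps)

lemma bump_eq_0: "x \<notin> {c<..<d} \<Longrightarrow> bump c d n x = 0"
proof -
  assume "x \<notin> {c<..<d}"
  then have "real n * (x - c) \<le> 0 \<or> real n * (d - x) \<le> 0"
    by (auto simp: mult_le_0_iff)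
  then show ?thesis by (auto simp: bump_def flat_exp_def)
qed

lemma norm_bump_le: "cmod (bump c d n x) \<le> 1"
proof -
  have "\<bar>flat_exp 1 y\<bar> \<le> 1" for y by (simp add: flat_exp_def)
  then show ?thesis unfolding bump_def norm_mult by (simp add: mult_le_one)
qed

lemma bump_tendsto: "(\<lambda>n. bump c d n x) \<longlonglongrightarrow> indicator {c<..<d} x"
proof (cases "x \<in> {c<..<d}")
  case True
  have *: "(\<lambda>n. flat_exp 1 (real n * y)) \<longlonglongrightarrow> 1" if "y > 0" for y
  proof -
    have "(\<lambda>n. exp (- (1 / y) * (1 / real n))) \<longlonglongrightarrow> exp (- (1 / y) * 0)"
      by (intro tendsto_intros lim_1_over_n)
    moreover have "\<forall>\<^sub>F n in sequentially. exp (- (1 / y) * (1 / real n)) = flat_exp 1 (real n * y)"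
      using eventually_gt_at_top[of 0]
      by eventually_elim (use that in \<open>simp add: flat_exp_def mult.commute\<close>)
    ultimately show ?thesis using Lim_transform_eventually[of _ "exp (- (1 / y) * 0)"] by simp
  qed
  have "(\<lambda>n. bump c d n x) \<longlonglongrightarrow> of_real 1 * of_real 1"
    unfolding bump_def by (intro tendsto_mult tendsto_of_real *) (use True in auto)
  then show ?thesis using True by simp
next
  case False
  then show ?thesis using bump_eq_0[OF False] by simp
qed

lemma compact_closure_subset: "compact K \<Longrightarrow> closure A \<subseteq> K \<Longrightarrow> compact (closure A)"
  by (metis compact_Int_closed closed_closure Int_absorb1)

lemma bump_test_function: assumes "{c..d} \<subseteq> \<Omega>" shows "bump c d n \<in> test_functions \<Omega>"
proof -
  have "closure {x. bump c d n x \<noteq> 0} \<subseteq> {c..d}"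
  proof (rule closure_minimal)
    have "x \<in> {c..d}" if "bump c d n x \<noteq> 0" for x
      using that bump_eq_0[of x c d n] by (cases "x \<in> {c<..<d}") auto
    then show "{x. bump c d n x \<noteq> 0} \<subseteq> {c..d}" by blast
  qed simp
  moreover from this have "compact (closure {x. bump c d n x \<noteq> 0})"
    by (rule compact_closure_subset[OF compact_Icc])
  ultimately show ?thesis unfolding test_functions_def
    using assms smooth_bump by auto
qed

lemma test_functionsD:
  assumes "\<phi> \<in> test_functions \<Omega>"
  shows "smooth \<phi>" "x \<notin> \<Omega> \<Longrightarrow> \<phi> x = 0"
  using assms closure_subset[of "{x. \<phi> x \<noteq> 0}"] by (auto simp: test_functions_def)

lemma test_functions_add:
  assumes "\<phi> \<in> test_functions \<Omega>" "\<psi> \<in> test_functions \<Omega>"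
  shows "(\<lambda>x. \<phi> x + \<psi> x) \<in> test_functions \<Omega>"
proof -
  let ?K = "closure {x. \<phi> x \<noteq> 0} \<union> closure {x. \<psi> x \<noteq> 0}"
  have *: "closure {x. \<phi> x + \<psi> x \<noteq> 0} \<subseteq> ?K"
    unfolding closure_Un[symmetric] by (rule closure_mono) auto
  have "compact ?K" using assms by (auto simp: test_functions_def)
  with * have "compact (closure {x. \<phi> x + \<psi> x \<noteq> 0})"
    using compact_closure_subset by blast
  with * show ?thesis using assms smooth_add unfolding test_functions_def by blast
qed

lemma test_functions_cmult:
  assumes "\<phi> \<in> test_functions \<Omega>" shows "(\<lambda>x. c * \<phi> x) \<in> test_functions \<Omega>"
proof -
  have *: "closure {x. c * \<phi> x \<noteq> 0} \<subseteq> closure {x. \<phi> x \<noteq> 0}" by (rule closure_mono) auto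
  moreover from this have "compact (closure {x. c * \<phi> x \<noteq> 0})"
    using assms compact_closure_subset unfolding test_functions_def by blast
  ultimately show ?thesis using assms smooth_mult[OF smooth_const] unfolding test_functions_def by blast
qed

section \<open>Schwartz functions\<close>

lemma bounded_rangeE:
  fixes f :: "real \<Rightarrow> complex"
  assumes "bounded (range f)" obtains A where "A \<ge> 0" "\<And>x. cmod (f x) \<le> A"
proof -
  obtain A where A: "\<And>x. cmod (f x) \<le> A" using assms unfolding bounded_iff by auto
  with norm_ge_zero order.trans have "A \<ge> 0" by blast
  with A show ?thesis using that by blast
qed

lemma bounded_rangeI:
  fixes f :: "real \<Rightarrow> complex" shows "(\<And>x. cmod (f x) \<le> A) \<Longrightarrow> bounded (range f)"
  unfolding bounded_iff by blast

text \<open>Closure under differentiation and under multiplication by x puts every x^k f^(m) into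
  \<open>S\<close>; all Schwartz seminorms are then finite because members of \<open>S\<close> are
  bounded.\<close>

lemma schwartz_coinduct:
  assumes "f \<in> S"
    and deriv: "\<And>h. h \<in> S \<Longrightarrow> \<exists>h'\<in>S. \<forall>x. (h has_vector_derivative h' x) (at x)"
    and mult: "\<And>h. h \<in> S \<Longrightarrow> (\<lambda>x. of_real x * h x) \<in> S"
    and bdd: "\<And>h. h \<in> S \<Longrightarrow> bounded (range h)"
  shows "f \<in> schwartz"
proof -
  have "(\<lambda>x. of_real (x ^ k) * nth_vderiv m f x) \<in> S" for k m
  proof (induction k)
    case 0
    then show ?case using smooth_coinduct(2)[OF assms(1,2)] by simp
  next
    case (Suc k)
    from mult[OF this] show ?case by (simp add: mult.assoc)
  qed
  then show ?thesis using smooth_coinduct(1)[OF assms(1,2)] bdd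
    by (auto simp: schwartz_def)
qed

lemma schwartz_smooth: "f \<in> schwartz \<Longrightarrow> smooth f" by (simp add: schwartz_def)

lemma schwartz_bounded: "f \<in> schwartz \<Longrightarrow> bounded (range (\<lambda>x. of_real (x ^ k) * nth_vderiv m f x))"
  by (simp add: schwartz_def)

lemma schwartz_deriv: assumes "f \<in> schwartz" shows "nth_vderiv m f \<in> schwartz"
proof -
  have "nth_vderiv k (nth_vderiv m f) = nth_vderiv (k + m) f" for k
    by (simp add: nth_vderiv_def funpow_add)
  then show ?thesis using assms smooth_nth unfolding schwartz_def by auto
qed

text \<open>Leibniz rule for the factor x, whose second derivative vanishes. For m = 0 the truncated
  \<open>m - 1\<close> is harmless since its coefficient is 0.\<close>

lemma nth_vderiv_mult_of_real:
  assumes "smooth f"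
  shows "nth_vderiv m (\<lambda>x. of_real x * f x) = (\<lambda>x. of_real x * nth_vderiv m f x + of_nat m * nth_vderiv (m - 1) f x)"
proof (induction m)
  case (Suc m)
  have d: "((\<lambda>x. of_real x * nth_vderiv m f x + of_nat m * nth_vderiv (m - 1) f x) has_vector_derivative
        of_real x * nth_vderiv (Suc m) f x + of_nat (Suc m) * nth_vderiv m f x) (at x)" for x
  proof -
    have 0: "((of_real :: real \<Rightarrow> complex) has_vector_derivative 1) (at x)"
      using has_vector_derivative_of_real[OF DERIV_ident] by simp
    have 1: "((\<lambda>x. of_real x * nth_vderiv m f x) has_vector_derivative
         of_real x * nth_vderiv (Suc m) f x + 1 * nth_vderiv m f x) (at x)"
      by (rule has_vector_derivative_mult[OF 0 smooth_nth_vderiv[OF assms]])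
    have 2: "((\<lambda>x. of_nat m * nth_vderiv (m - 1) f x) has_vector_derivative of_nat m * nth_vderiv m f x) (at x)"
    proof (cases m)
      case (Suc k)
      show ?thesis unfolding Suc
        using has_vector_derivative_mult_right[OF smooth_nth_vderiv[OF assms, of k x], where a="of_nat (Suc k)"]
        by simp
    qed simp
    show ?thesis
      using has_vector_derivative_add[OF 1 2] by (simp add: distrib_right add.assoc)
  qed
  show ?case
  proof
    fix x
    show "nth_vderiv (Suc m) (\<lambda>x. of_real x * f x) x =
        of_real x * nth_vderiv (Suc m) f x + of_nat (Suc m) * nth_vderiv (Suc m - 1) f x"
      unfolding nth_vderiv_Suc[of m "\<lambda>x. of_real x * f x"] Suc.IH vector_derivative_at[OF d] by simp
  qed
qed simp

lemma schwartz_mult_of_real: assumes "f \<in> schwartz" shows "(\<lambda>x. of_real x * f x) \<in> schwartz"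
proof -
  have "bounded (range (\<lambda>x. of_real (x ^ k) * nth_vderiv m (\<lambda>x. of_real x * f x) x))" for k m
  proof -
    obtain A where A: "\<And>x. cmod (of_real (x ^ Suc k) * nth_vderiv m f x) \<le> A"
      using bounded_rangeE[OF schwartz_bounded[OF assms]] by blast
    obtain B where B: "\<And>x. cmod (of_real (x ^ k) * nth_vderiv (m - 1) f x) \<le> B"
      using bounded_rangeE[OF schwartz_bounded[OF assms]] by blast
    have "cmod (of_real (x ^ k) * nth_vderiv m (\<lambda>x. of_real x * f x) x) \<le> A + m * B" for x
    proof -
      have "of_real (x ^ k) * nth_vderiv m (\<lambda>x. of_real x * f x) x
          = of_real (x ^ Suc k) * nth_vderiv m f x + of_nat m * (of_real (x ^ k) * nth_vderiv (m - 1) f x)"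
        unfolding nth_vderiv_mult_of_real[OF schwartz_smooth[OF assms]] by (simp add: algebra_simps)
      also have "cmod \<dots> \<le> cmod (of_real (x ^ Suc k) * nth_vderiv m f x) + m * cmod (of_real (x ^ k) * nth_vderiv (m - 1) f x)"
        using norm_triangle_ineq[of "of_real (x ^ Suc k) * nth_vderiv m f x" "of_nat m * (of_real (x ^ k) * nth_vderiv (m - 1) f x)"]
        by (simp only: norm_mult[of "of_nat m"] norm_of_nat)
      also have "\<dots> \<le> A + m * B"
        by (intro add_mono A mult_left_mono[OF B]) simp
      finally show ?thesis .
    qed
    then show ?thesis by (rule bounded_rangeI)
  qed
  moreover have "smooth (\<lambda>x. of_real x * f x)"
    by (rule smooth_mult[OF smooth_of_real schwartz_smooth[OF assms]])
  ultimately show ?thesis unfolding schwartz_def by blast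
qed

lemma schwartz_bounded': "f \<in> schwartz \<Longrightarrow> bounded (range f)"
  using schwartz_bounded[of f 0 0] by simp

lemma schwartz_has_vderiv: "f \<in> schwartz \<Longrightarrow> (f has_vector_derivative nth_vderiv (Suc 0) f x) (at x)"
  using smooth_has_vderiv schwartz_smooth by blast

lemma schwartz_lincomb:
  assumes "f \<in> schwartz" "g \<in> schwartz" shows "(\<lambda>x. c * f x + d * g x) \<in> schwartz"
proof -
  let ?S = "(\<lambda>(f, g). \<lambda>x. c * f x + d * g x) ` (schwartz \<times> schwartz)"
  have mem: "(\<lambda>x. c * f x + d * g x) \<in> ?S" if "f \<in> schwartz" "g \<in> schwartz" for f g
    using that by (intro image_eqI[of _ _ "(f, g)"]) auto
  show ?thesis
  proof (rule schwartz_coinduct[where S="?S"])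
    fix h assume "h \<in> ?S"
    then obtain f g where fg: "f \<in> schwartz" "g \<in> schwartz" and h: "h = (\<lambda>x. c * f x + d * g x)"
      by auto
    have "\<forall>x. ((\<lambda>x. c * f x + d * g x) has_vector_derivative c * nth_vderiv (Suc 0) f x + d * nth_vderiv (Suc 0) g x) (at x)"
      using has_vector_derivative_add[OF
         has_vector_derivative_mult_right[OF schwartz_has_vderiv[OF fg(1)], of c]
         has_vector_derivative_mult_right[OF schwartz_has_vderiv[OF fg(2)], of d]] by blast
    then show "\<exists>h'\<in>?S. \<forall>x. (h has_vector_derivative h' x) (at x)"
      unfolding h by (rule bexI[OF _ mem[OF schwartz_deriv[OF fg(1)] schwartz_deriv[OF fg(2)]]])
    have "(\<lambda>x. of_real x * h x) = (\<lambda>x. c * (of_real x * f x) + d * (of_real x * g x))"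
      by (simp add: h algebra_simps)
    then show "(\<lambda>x. of_real x * h x) \<in> ?S"
      using mem[OF schwartz_mult_of_real[OF fg(1)] schwartz_mult_of_real[OF fg(2)]] by simp
    obtain A where "\<And>x. cmod (f x) \<le> A"
      using bounded_rangeE[OF schwartz_bounded'[OF fg(1)]] by blast
    moreover obtain B where "\<And>x. cmod (g x) \<le> B"
      using bounded_rangeE[OF schwartz_bounded'[OF fg(2)]] by blast
    ultimately have "cmod (h x) \<le> cmod c * A + cmod d * B" for x
      unfolding h by (intro order.trans[OF norm_triangle_ineq] add_mono) (auto simp: norm_mult mult_left_mono)
    then show "bounded (range h)" by (rule bounded_rangeI)
  qed (rule mem[OF assms])
qed

lemma schwartz_cmult: "f \<in> schwartz \<Longrightarrow> (\<lambda>x. c * f x) \<in> schwartz"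
  using schwartz_lincomb[of f f c 0] by simp

lemma schwartz_add: "f \<in> schwartz \<Longrightarrow> g \<in> schwartz \<Longrightarrow> (\<lambda>x. f x + g x) \<in> schwartz"
  using schwartz_lincomb[of f g 1 1] by simp

lemma schwartz_reflect: assumes "f \<in> schwartz" shows "(\<lambda>x. f (- x)) \<in> schwartz"
proof -
  let ?S = "(\<lambda>f x. f (- x)) ` schwartz"
  show ?thesis
  proof (rule schwartz_coinduct[where S="?S"])
    fix h :: "real \<Rightarrow> complex" assume "h \<in> ?S"
    then obtain f where f: "f \<in> schwartz" and h: "h = (\<lambda>x. f (- x))" by auto
    have "(h has_vector_derivative (- 1 * nth_vderiv (Suc 0) f (- x))) (at x)" for x
    proof -
      have "(uminus has_vector_derivative (- 1)) (at x)"
        by (auto intro!: derivative_eq_intros)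
      from vector_diff_chain_at[OF this schwartz_has_vderiv[OF f]] show ?thesis by (simp add: o_def h)
    qed
    moreover have "(\<lambda>x. - 1 * nth_vderiv (Suc 0) f (- x)) \<in> ?S"
      by (rule image_eqI[OF _ schwartz_cmult[OF schwartz_deriv[OF f, of "Suc 0"], of "-1"]]) simp
    ultimately show "\<exists>h'\<in>?S. \<forall>x. (h has_vector_derivative h' x) (at x)"
      by (intro bexI[of _ "\<lambda>x. - 1 * nth_vderiv (Suc 0) f (- x)"] allI)
    show "(\<lambda>x. of_real x * h x) \<in> ?S"
      by (rule image_eqI[OF _ schwartz_cmult[OF schwartz_mult_of_real[OF f], of "-1"]]) (simp add: h)
    obtain A where "\<And>x. cmod (f x) \<le> A"
      using bounded_rangeE[OF schwartz_bounded'[OF f]] by blast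
    then show "bounded (range h)" unfolding h by (intro bounded_rangeI)
  qed (use assms in auto)
qed

text \<open>The coinduction class fixes one compact set \<open>K\<close> and lets the functions
  vary: derivatives vanish on the open complement again, and continuity on \<open>K\<close> gives
  boundedness.\<close>

lemma test_functions_schwartz: "test_functions \<Omega> \<subseteq> schwartz"
proof
  fix \<phi> assume \<phi>: "\<phi> \<in> test_functions \<Omega>"
  define K where "K = closure {x. \<phi> x \<noteq> 0}"
  have K: "compact K" "closed K" using \<phi> by (auto simp: K_def test_functions_def)
  show "\<phi> \<in> schwartz"
  proof (rule schwartz_coinduct[where S="{h. smooth h \<and> (\<forall>x. x \<notin> K \<longrightarrow> h x = 0)}"])
    show "\<phi> \<in> {h. smooth h \<and> (\<forall>x. x \<notin> K \<longrightarrow> h x = 0)}"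
      using test_functionsD(1)[OF \<phi>] closure_subset[of "{x. \<phi> x \<noteq> 0}"] by (auto simp: K_def)
  next
    fix h assume h: "h \<in> {h. smooth h \<and> (\<forall>x. x \<notin> K \<longrightarrow> h x = 0)}"
    have "nth_vderiv (Suc 0) h x = 0" if "x \<notin> K" for x
    proof -
      have "(h has_vector_derivative 0) (at x)"
        by (rule has_vector_derivative_transform_within_open[OF has_vector_derivative_const[of 0], of "- K"])
           (use K h that in auto)
      moreover have "(h has_vector_derivative nth_vderiv (Suc 0) h x) (at x)"
        using smooth_has_vderiv[of h x] h by simp
      ultimately show ?thesis using vector_derivative_unique_at by blast
    qed
    then show "\<exists>h'\<in>{h. smooth h \<and> (\<forall>x. x \<notin> K \<longrightarrow> h x = 0)}. \<forall>x. (h has_vector_derivative h' x) (at x)"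
      using h smooth_nth smooth_has_vderiv by (intro bexI[of _ "nth_vderiv (Suc 0) h"]) auto
    show "(\<lambda>x. of_real x * h x) \<in> {h. smooth h \<and> (\<forall>x. x \<notin> K \<longrightarrow> h x = 0)}"
      using h by (auto intro: smooth_mult smooth_of_real)
    have "bounded (h ` K)"
      using h smooth_continuous K by (auto intro!: compact_imp_bounded compact_continuous_image)
    moreover have "range h \<subseteq> insert 0 (h ` K)" using h by auto
    ultimately show "bounded (range h)" by (meson bounded_insert bounded_subset)
  qed
qed

section \<open>The Fourier transform of integrable functions\<close>

text \<open>Fundamental lemma of the calculus of variations. Bumps give integral 0 over inner
  intervals, exhaustion gives it over rays, and rays are an intersection-stable generator, so a
  Dynkin argument reaches every Borel set.\<close>

lemma test_functions_zero_imp_AE_zero: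
  fixes f :: "real \<Rightarrow> complex"
  assumes f: "set_integrable lborel {c<..<d} f"
    and z: "\<And>\<phi>. \<phi> \<in> test_functions {c<..<d} \<Longrightarrow> (LINT x:{c<..<d}|lborel. f x * \<phi> x) = 0"
  shows "AE x in lborel. x \<in> {c<..<d} \<longrightarrow> f x = 0"
proof -
  define F where "F x = indicat_real {c<..<d} x *\<^sub>R f x" for x
  have F: "integrable lborel F"
    using f by (simp add: F_def[abs_def] set_integrable_def)
  note [measurable] = borel_measurable_integrable[OF F]
  have F0: "F x = 0" if "x \<notin> {c<..<d}" for x using that by (simp add: F_def)
  have inner: "(LINT x|lborel. F x * indicator {p<..<q} x) = 0" if "c < p" "q < d" for p q
  proof -
    have bm: "bump p q n \<in> borel_measurable lborel" for n
      using borel_measurable_continuous_onI[OF smooth_continuous[OF smooth_bump]] by simp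
    have "(\<lambda>n. LINT x|lborel. F x * bump p q n x) \<longlonglongrightarrow> (LINT x|lborel. F x * indicator {p<..<q} x)"
    proof (rule integral_dominated_convergence[where w="\<lambda>x. norm (F x)"])
      show "AE x in lborel. (\<lambda>n. F x * bump p q n x) \<longlonglongrightarrow> F x * indicator {p<..<q} x"
        by (intro AE_I2 tendsto_mult_left bump_tendsto)
      show "AE x in lborel. norm (F x * bump p q n x) \<le> norm (F x)" for n
        by (intro AE_I2) (simp add: norm_mult mult_left_le norm_bump_le)
    qed (use F bm in auto)
    moreover have "(LINT x|lborel. F x * bump p q n x) = 0" for n
    proof -
      have "bump p q n \<in> test_functions {c<..<d}"
        by (rule bump_test_function) (use that in auto)
      from z[OF this] show ?thesis
        by (simp add: set_lebesgue_integral_def F_def mult_ac)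
    qed
    ultimately show ?thesis by (simp add: LIMSEQ_const_iff)
  qed
  have ray: "(LINT x|lborel. F x * indicator {p<..} x) = 0" for p
  proof -
    \<comment> \<open>The endpoints are moved strictly inside (c, d), as \<open>inner\<close>
      requires; \<open>max p c\<close> covers rays that start to the left of c.\<close>
    define P where "P n = max p c + inverse (real (Suc n))" for n
    define Q where "Q n = d - inverse (real (Suc n))" for n
    have P: "P \<longlonglongrightarrow> max p c"
      using tendsto_add[OF tendsto_const LIMSEQ_inverse_real_of_nat, of "max p c"] by (simp add: P_def[abs_def])
    have Q: "Q \<longlonglongrightarrow> d"
      using tendsto_diff[OF tendsto_const LIMSEQ_inverse_real_of_nat, of d] by (simp add: Q_def[abs_def])
    have "(\<lambda>n. LINT x|lborel. F x * indicator {P n<..<Q n} x) \<longlonglongrightarrow> (LINT x|lborel. F x * indicator {p<..} x)"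
    proof (rule integral_dominated_convergence[where w="\<lambda>x. norm (F x)"])
      show "AE x in lborel. norm (F x * indicator {P n<..<Q n} x) \<le> norm (F x)" for n
        by (intro AE_I2) (simp add: indicator_def)
      have "(\<lambda>n. F x * indicator {P n<..<Q n} x) \<longlonglongrightarrow> F x * indicator {p<..} x" for x
      proof (cases "x \<in> {c<..<d} \<and> p < x")
        case True
        then have "\<forall>\<^sub>F n in sequentially. P n < x" "\<forall>\<^sub>F n in sequentially. x < Q n"
          using order_tendstoD(2)[OF P, of x] order_tendstoD(1)[OF Q, of x] by auto
        then have "\<forall>\<^sub>F n in sequentially. F x * indicator {P n<..<Q n} x = F x * indicator {p<..} x"
          by eventually_elim (use True in simp)
        then show ?thesis by (rule tendsto_eventually)
      next
        case False
        have "P n > p" for n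
          using inverse_positive_iff_positive[of "real (Suc n)"] unfolding P_def by linarith
        with False have "F x * indicator {P n<..<Q n} x = 0" for n
          using F0[of x] by (cases "x \<in> {c<..<d}") (auto simp: indicator_def dest: less_trans)
        moreover have "F x * indicator {p<..} x = 0"
          using False F0[of x] by (cases "x \<in> {c<..<d}") (auto simp: indicator_def)
        ultimately show ?thesis by (simp only: tendsto_const)
      qed
      then show "AE x in lborel. (\<lambda>n. F x * indicator {P n<..<Q n} x) \<longlonglongrightarrow> F x * indicator {p<..} x"
        by (intro AE_I2)
    qed (use F in auto)
    moreover have "c < P n" "Q n < d" for n
      using inverse_positive_iff_positive[of "real (Suc n)"] unfolding P_def Q_def by linarith+
    ultimately show ?thesis using inner by (simp add: LIMSEQ_const_iff)
  qed
  have set0: "(LINT x:A|lborel. F x) = (LINT x|lborel. F x * indicator A x)" for A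
    unfolding set_lebesgue_integral_def
    by (intro Bochner_Integration.integral_cong) (auto simp: indicator_def)
  have total: "(LINT x:UNIV|lborel. F x) = 0"
  proof -
    have "F x * indicator {c<..} x = F x" for x using F0[of x] by (cases "c < x") auto
    then have "(\<lambda>x. F x * indicator {c<..} x) = F" by (rule ext)
    then show ?thesis using ray[of c] by (simp add: set0)
  qed
  have "(LINT x:A|lborel. F x) = 0" if "A \<in> sets borel" for A
  proof -
    have "Int_stable (range greaterThan :: real set set)" "range greaterThan \<subseteq> Pow (UNIV :: real set)"
      "A \<in> sigma_sets UNIV (range greaterThan)"
    proof -
      have "{a<..} \<inter> {b<..} = {max a b<..}" for a b :: real by auto
      then show "Int_stable (range greaterThan :: real set set)" by (auto simp: Int_stable_def)
      show "A \<in> sigma_sets UNIV (range greaterThan)" using that unfolding borel_Ioi by simp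
    qed simp
    then show ?thesis
    proof (induction rule: sigma_sets_induct_disjoint)
      case (basic A)
      then show ?case using ray by (auto simp: set0)
    next
      case empty
      show ?case by (simp add: set_lebesgue_integral_def)
    next
      case (compl A)
      have A: "A \<in> sets lborel" using compl(1) by (simp add: borel_Ioi)
      have "(LINT x:(A \<union> (UNIV - A))|lborel. F x) = (LINT x:A|lborel. F x) + (LINT x:(UNIV - A)|lborel. F x)"
        by (rule set_integral_Un) (use A F in \<open>auto simp: set_integrable_def intro!: integrable_mult_indicator\<close>)
      then show ?case using compl total by simp
    next
      case (union A)
      have A: "A i \<in> sets lborel" for i using union(2) by (auto simp: borel_Ioi)
      have "(LINT x:(\<Union>i. A i)|lborel. F x) = (\<Sum>i. LINT x:A i|lborel. F x)"
        by (rule lebesgue_integral_countable_add)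
           (use union(1) A F in \<open>auto simp: disjoint_family_on_def set_integrable_def intro!: integrable_mult_indicator\<close>)
      then show ?case using union(3) by simp
    qed
  qed
  then have "AE x in lborel. F x = 0"
    by (intro sigma_finite_measure.density_zero[OF lborel.sigma_finite_measure_axioms] F) simp
  then show ?thesis by eventually_elim (auto simp: F_def)
qed

section \<open>Elementary properties of the Fourier transform\<close>

lemma measurable_cis [measurable]: "cis \<in> borel_measurable borel"
  by (intro borel_measurable_continuous_onI continuous_on_cis continuous_on_id)

lemma tendsto_cis: "(f \<longlongrightarrow> a) F \<Longrightarrow> ((\<lambda>x. cis (f x)) \<longlongrightarrow> cis a) F"
  unfolding cis_conv_exp by (intro tendsto_intros)

definition fourier_const :: real where "fourier_const = (2 * pi) powr (-1/2)"

lemma fourier_const_sq: "fourier_const * fourier_const = 1 / (2 * pi)" and fourier_const_pos: "fourier_const > 0"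
  by (simp_all add: fourier_const_def powr_add[symmetric] powr_minus_divide)

lemma fourier_cis: "fourier f \<xi> = of_real fourier_const * (LINT x|lborel. cis (- (\<xi> * x)) * f x)"
  by (simp add: fourier_def cis_conv_exp fourier_const_def)

lemma integrable_cis_mult:
  assumes "integrable lborel f" "g \<in> borel_measurable lborel"
  shows "integrable lborel (\<lambda>x. cis (g x) * f x)"
  by (rule Bochner_Integration.integrable_bound[OF assms(1)])
     (use assms in \<open>auto simp: norm_mult\<close>)

lemma norm_fourier_le:
  assumes "integrable lborel f" shows "cmod (fourier f \<xi>) \<le> fourier_const * (LINT x|lborel. cmod (f x))"
proof -
  have "cmod (LINT x|lborel. cis (- (\<xi> * x)) * f x) \<le> (LINT x|lborel. cmod (cis (- (\<xi> * x)) * f x))"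
    by simp
  also have "\<dots> = (LINT x|lborel. cmod (f x))" by (simp add: norm_mult)
  finally show ?thesis unfolding fourier_cis norm_mult using fourier_const_pos by (simp add: mult_left_mono)
qed

lemma fourier_isCont:
  assumes f: "integrable lborel f" shows "isCont (fourier f) \<xi>"
proof (rule continuous_at_sequentiallyI)
  fix u :: "nat \<Rightarrow> real" assume u: "u \<longlonglongrightarrow> \<xi>"
  note [measurable] = borel_measurable_integrable[OF f]
  have "(\<lambda>n. LINT x|lborel. cis (- (u n * x)) * f x) \<longlonglongrightarrow> (LINT x|lborel. cis (- (\<xi> * x)) * f x)"
  proof (rule integral_dominated_convergence[where w="\<lambda>x. norm (f x)"])
    show "AE x in lborel. (\<lambda>n. cis (- (u n * x)) * f x) \<longlonglongrightarrow> cis (- (\<xi> * x)) * f x"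
      by (intro AE_I2 tendsto_mult tendsto_const tendsto_cis tendsto_minus u)
  qed (use f in \<open>auto simp: norm_mult\<close>)
  then show "(\<lambda>n. fourier f (u n)) \<longlonglongrightarrow> fourier f \<xi>"
    unfolding fourier_cis by (intro tendsto_mult_left)
qed

lemma fourier_measurable [measurable]:
  assumes [measurable]: "f \<in> borel_measurable borel"
  shows "fourier f \<in> borel_measurable borel"
  unfolding fourier_cis[abs_def] by measurable

lemma fourier_cmult: "fourier (\<lambda>x. c * f x) \<xi> = c * fourier f \<xi>"
  by (simp add: fourier_cis mult.left_commute)

lemma fourier_add:
  assumes "integrable lborel f" "integrable lborel g"
  shows "fourier (\<lambda>x. f x + g x) \<xi> = fourier f \<xi> + fourier g \<xi>"
  unfolding fourier_cis distrib_left
  by (subst Bochner_Integration.integral_add) (auto intro!: integrable_cis_mult assms simp: distrib_left)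

lemma fourier_diff:
  assumes "integrable lborel f" "integrable lborel g"
  shows "fourier (\<lambda>x. f x - g x) \<xi> = fourier f \<xi> - fourier g \<xi>"
  using fourier_add[OF assms(1) integrable_mult_right[OF assms(2), of "-1"]] fourier_cmult[of "-1" g] by simp

lemma norm_cis_diff_le: "cmod (cis a - 1) \<le> \<bar>a\<bar>"
  using iexp_approx1[of a 0] by (simp add: cis_conv_exp)

text \<open>Differentiation under the integral: the difference quotient of the kernel is at most |x|
  in modulus by \<open>norm_cis_diff_le\<close>, so |x f(x)| is a majorant.\<close>

lemma fourier_has_vector_derivative:
  assumes f: "integrable lborel f" and xf: "integrable lborel (\<lambda>x. of_real x * f x)"
  shows "(fourier f has_vector_derivative fourier (\<lambda>x. - \<i> * (of_real x * f x)) \<xi>) (at \<xi>)"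
proof -
  note [measurable] = borel_measurable_integrable[OF f]
  let ?D = "fourier (\<lambda>x. - \<i> * (of_real x * f x)) \<xi>"
  have "((\<lambda>h. (fourier f (\<xi> + h) - fourier f \<xi>) / of_real h) \<longlongrightarrow> ?D) (at 0)"
    unfolding tendsto_at_iff_sequentially
  proof (intro allI impI)
    fix h :: "nat \<Rightarrow> real" assume h0: "\<forall>i. h i \<in> UNIV - {0}" and h: "h \<longlonglongrightarrow> 0"
    have quot: "(fourier f (\<xi> + h n) - fourier f \<xi>) / of_real (h n) =
       of_real fourier_const * (LINT x|lborel. cis (- (\<xi> * x)) * ((cis (- (h n * x)) - 1) / of_real (h n)) * f x)" for n
    proof -
      have "fourier f (\<xi> + h n) - fourier f \<xi> =
        of_real fourier_const * (LINT x|lborel. cis (- ((\<xi> + h n) * x)) * f x - cis (- (\<xi> * x)) * f x)"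
        unfolding fourier_cis right_diff_distrib[symmetric]
        by (subst Bochner_Integration.integral_diff) (auto intro!: integrable_cis_mult f)
      also have "(\<lambda>x. cis (- ((\<xi> + h n) * x)) * f x - cis (- (\<xi> * x)) * f x) =
         (\<lambda>x. of_real (h n) * (cis (- (\<xi> * x)) * ((cis (- (h n * x)) - 1) / of_real (h n)) * f x))"
      proof
        fix x
        have "cis (- ((\<xi> + h n) * x)) = cis (- (\<xi> * x)) * cis (- (h n * x))"
          by (simp add: cis_mult algebra_simps)
        then show "cis (- ((\<xi> + h n) * x)) * f x - cis (- (\<xi> * x)) * f x =
          of_real (h n) * (cis (- (\<xi> * x)) * ((cis (- (h n * x)) - 1) / of_real (h n)) * f x)"
          using h0 by (simp add: field_simps)
      qed
      finally show ?thesis using h0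
        unfolding integral_mult_right_zero by (simp only: nonzero_mult_div_cancel_left times_divide_eq_right mult.left_commute[of "of_real fourier_const"]) simp
    qed
    have "(\<lambda>n. LINT x|lborel. cis (- (\<xi> * x)) * ((cis (- (h n * x)) - 1) / of_real (h n)) * f x) \<longlonglongrightarrow>
        (LINT x|lborel. cis (- (\<xi> * x)) * (- \<i> * of_real x) * f x)"
    proof (rule integral_dominated_convergence[where w="\<lambda>x. norm (of_real x * f x)"])
      have "(\<lambda>n. (cis (- (h n * x)) - 1) / of_real (h n)) \<longlonglongrightarrow> - \<i> * of_real x" for x
      proof -
        have "((\<lambda>t. iexp (- x * t)) has_vector_derivative (- x) *\<^sub>R (\<i> * iexp (- x * 0))) (at 0)"
          by (rule vector_diff_chain_at[of "\<lambda>t. - x * t" "- x" 0 iexp, unfolded o_def])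
             (auto intro!: derivative_eq_intros has_vector_derivative_iexp[of _ UNIV, simplified])
        then have "(\<lambda>h. cmod (iexp (- x * h) - 1 - of_real h * (- \<i> * of_real x)) / \<bar>h\<bar>) \<midarrow>0\<rightarrow> 0"
          unfolding has_vector_derivative_def has_derivative_at
          by (simp add: scaleR_conv_of_real mult_ac)
        then have "(\<lambda>n. cmod (iexp (- x * h n) - 1 - of_real (h n) * (- \<i> * of_real x)) / \<bar>h n\<bar>) \<longlonglongrightarrow> 0"
          using h h0 unfolding tendsto_at_iff_sequentially comp_def by blast
        also have "(\<lambda>n. cmod (iexp (- x * h n) - 1 - of_real (h n) * (- \<i> * of_real x)) / \<bar>h n\<bar>) =
          (\<lambda>n. cmod ((cis (- (h n * x)) - 1) / of_real (h n) - (- \<i> * of_real x)))"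
        proof
          fix n
          have "(cis (- (h n * x)) - 1) / of_real (h n) - (- \<i> * of_real x) =
             (iexp (- x * h n) - 1 - of_real (h n) * (- \<i> * of_real x)) / of_real (h n)"
            using h0 by (simp add: cis_conv_exp field_simps)
          then show "cmod (iexp (- x * h n) - 1 - of_real (h n) * (- \<i> * of_real x)) / \<bar>h n\<bar> =
            cmod ((cis (- (h n * x)) - 1) / of_real (h n) - (- \<i> * of_real x))"
            by (simp add: norm_divide)
        qed
        finally show ?thesis unfolding tendsto_norm_zero_iff by (rule LIM_zero_cancel)
      qed
      then show "AE x in lborel. (\<lambda>n. cis (- (\<xi> * x)) * ((cis (- (h n * x)) - 1) / of_real (h n)) * f x)
          \<longlonglongrightarrow> cis (- (\<xi> * x)) * (- \<i> * of_real x) * f x"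
        by (intro AE_I2 tendsto_mult tendsto_const)
      have "cmod ((cis (- (h n * x)) - 1) / of_real (h n)) \<le> \<bar>x\<bar>" for n x
      proof -
        have "h n \<noteq> 0" using h0 by simp
        then show ?thesis using norm_cis_diff_le[of "- (h n * x)"]
          by (simp add: norm_divide abs_mult pos_divide_le_eq mult.commute)
      qed
      then show "AE x in lborel. norm (cis (- (\<xi> * x)) * ((cis (- (h n * x)) - 1) / of_real (h n)) * f x) \<le> norm (of_real x * f x)" for n
        by (intro AE_I2) (simp only: norm_mult norm_cis norm_of_real mult_1, intro mult_right_mono, auto)
    qed (use xf in auto)
    then have "(\<lambda>n. (fourier f (\<xi> + h n) - fourier f \<xi>) / of_real (h n)) \<longlonglongrightarrow> of_real fourier_const *
       (LINT x|lborel. cis (- (\<xi> * x)) * (- \<i> * of_real x) * f x)"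
      unfolding quot by (intro tendsto_mult_left)
    then show "((\<lambda>h. (fourier f (\<xi> + h) - fourier f \<xi>) / of_real h) \<circ> h) \<longlonglongrightarrow> ?D"
      by (simp add: fourier_cis o_def mult.assoc)
  qed
  then have "((\<lambda>h. cmod ((fourier f (\<xi> + h) - fourier f \<xi>) / of_real h - ?D)) \<longlongrightarrow> 0) (at 0)"
    using LIM_zero tendsto_norm_zero by blast
  moreover have "\<forall>\<^sub>F h in at 0. cmod ((fourier f (\<xi> + h) - fourier f \<xi>) / of_real h - ?D) =
      cmod (fourier f (\<xi> + h) - fourier f \<xi> - h *\<^sub>R ?D) / norm h"
  proof (rule eventually_mono[OF eventually_at_ball'[of 1]])
    fix h :: real assume "h \<in> ball 0 1 \<and> h \<noteq> 0 \<and> h \<in> UNIV"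
    then have "(fourier f (\<xi> + h) - fourier f \<xi>) / of_real h - ?D = (fourier f (\<xi> + h) - fourier f \<xi> - h *\<^sub>R ?D) / of_real h"
      by (simp add: field_simps scaleR_conv_of_real)
    then show "cmod ((fourier f (\<xi> + h) - fourier f \<xi>) / of_real h - ?D) =
      cmod (fourier f (\<xi> + h) - fourier f \<xi> - h *\<^sub>R ?D) / norm h"
      by (simp add: norm_divide)
  qed simp
  ultimately have "((\<lambda>h. cmod (fourier f (\<xi> + h) - fourier f \<xi> - h *\<^sub>R ?D) / norm h) \<longlongrightarrow> 0) (at 0)"
    by (rule Lim_transform_eventually)
  then show ?thesis unfolding has_vector_derivative_def has_derivative_at
    by (simp add: bounded_linear_scaleR_left)
qed

lemma integrable_prod_bounded:
  fixes a b :: "real \<Rightarrow> complex"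
  assumes a: "integrable lborel a" and b: "integrable lborel b"
    and k[measurable]: "k \<in> borel_measurable (lborel \<Otimes>\<^sub>M lborel)" and k1: "\<And>z. cmod (k z) \<le> 1"
  shows "integrable (lborel \<Otimes>\<^sub>M lborel) (\<lambda>(x, y). k (x, y) * (a x * b y))"
proof -
  note [measurable] = borel_measurable_integrable[OF a] borel_measurable_integrable[OF b]
  have "integrable (lborel \<Otimes>\<^sub>M lborel) (\<lambda>(x, y). a x * b y)"
  proof (rule lborel_pair.Fubini_integrable)
    have "(LINT y|lborel. norm (a x * b y)) = norm (a x) * (LINT y|lborel. norm (b y))" for x
      by (simp add: norm_mult)
    then show "integrable lborel (\<lambda>x. LINT y|lborel. norm (case (x, y) of (x, y) \<Rightarrow> a x * b y))"
      using a by simp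
  qed (use b in auto)
  then show ?thesis
    by (rule Bochner_Integration.integrable_bound)
       (use k1 in \<open>auto simp: norm_mult mult_left_le_one_le\<close>)
qed

text \<open>Integrability of the product of \<open>a\<close> and \<open>b\<close> survives a bounded
  kernel. The kernel is a unimodular exponential in both applications, the multiplication formula
  and the Plancherel estimate.\<close>

lemma fubini_bounded:
  fixes a b :: "real \<Rightarrow> complex"
  assumes "integrable lborel a" "integrable lborel b"
    and "k \<in> borel_measurable (lborel \<Otimes>\<^sub>M lborel)" "\<And>z. cmod (k z) \<le> 1"
  shows "(LINT y|lborel. b y * (LINT x|lborel. k (x, y) * a x)) = (LINT x|lborel. a x * (LINT y|lborel. k (x, y) * b y))"
proof -
  have "(LINT y|lborel. (LINT x|lborel. k (x, y) * (a x * b y))) = (LINT x|lborel. (LINT y|lborel. k (x, y) * (a x * b y)))"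
    by (rule lborel_pair.Fubini_integral) (use integrable_prod_bounded[OF assms] in simp)
  moreover have "b y * (LINT x|lborel. k (x, y) * a x) = (LINT x|lborel. k (x, y) * (a x * b y))" for y
    unfolding integral_mult_right_zero[symmetric] by (intro Bochner_Integration.integral_cong refl) (simp add: mult_ac)
  moreover have "a x * (LINT y|lborel. k (x, y) * b y) = (LINT y|lborel. k (x, y) * (a x * b y))" for x
    unfolding integral_mult_right_zero[symmetric] by (intro Bochner_Integration.integral_cong refl) (simp add: mult_ac)
  ultimately show ?thesis by simp
qed

text \<open>By Fubini both sides are the same double integral, the kernel being symmetric in x and
  xi. This identity transports the transform to distributions.\<close>

lemma fourier_mult_formula:
  assumes "integrable lborel f" "integrable lborel g"
  shows "(LINT \<xi>|lborel. fourier f \<xi> * g \<xi>) = (LINT x|lborel. f x * fourier g x)"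
proof -
  have "(LINT \<xi>|lborel. g \<xi> * (LINT x|lborel. cis (- (\<xi> * x)) * f x)) = (LINT x|lborel. f x * (LINT \<xi>|lborel. cis (- (\<xi> * x)) * g \<xi>))"
    using fubini_bounded[OF assms, of "\<lambda>(x, \<xi>). cis (- (\<xi> * x))"] by (simp add: split_beta)
  moreover have "fourier f \<xi> * g \<xi> = of_real fourier_const * (g \<xi> * (LINT x|lborel. cis (- (\<xi> * x)) * f x))" for \<xi>
    by (simp add: fourier_cis mult_ac)
  moreover have "f x * fourier g x = of_real fourier_const * (f x * (LINT \<xi>|lborel. cis (- (\<xi> * x)) * g \<xi>))" for x
    by (simp add: fourier_cis mult_ac)
  ultimately show ?thesis by (simp only: integral_mult_right_zero)
qed

section \<open>Inversion and the Plancherel inequality by Gaussian damping\<close>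

abbreviation gauss :: "real \<Rightarrow> real \<Rightarrow> complex" where
  "gauss \<epsilon> \<xi> \<equiv> of_real (exp (- (\<epsilon> * \<xi>)\<^sup>2 / 2))"

lemma integrable_gauss: assumes "\<epsilon> > 0" shows "integrable lborel (gauss \<epsilon>)"
proof -
  have "integrable lborel (\<lambda>\<xi>. std_normal_density (0 + \<epsilon> * \<xi>))"
    by (rule lborel_integrable_real_affine) (use assms in auto)
  then have "integrable lborel (\<lambda>\<xi>. complex_of_real (sqrt (2 * pi) * std_normal_density (\<epsilon> * \<xi>)))"
    by simp
  then show ?thesis by (simp add: std_normal_density_def)
qed

text \<open>Characteristic function of the standard normal law, rescaled by the substitution x =
  \<epsilon> \<xi>.\<close>

lemma fourier_gauss:
  assumes "\<epsilon> > 0"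
  shows "(LINT \<xi>|lborel. cis (\<xi> * z) * gauss \<epsilon> \<xi>) = of_real (2 * pi * normal_density 0 \<epsilon> z)"
proof -
  have "(LINT x|lborel. std_normal_density x *\<^sub>R iexp (z / \<epsilon> * x)) = of_real (exp (- ((z / \<epsilon>)\<^sup>2) / 2))"
    using fun_cong[OF char_std_normal_distribution, of "z / \<epsilon>"]
    unfolding char_def by (subst (asm) integral_density) auto
  then have "\<epsilon> *\<^sub>R (LINT \<xi>|lborel. std_normal_density (\<epsilon> * \<xi>) *\<^sub>R iexp (z / \<epsilon> * (\<epsilon> * \<xi>))) = of_real (exp (- ((z / \<epsilon>)\<^sup>2) / 2))"
    using assms by (subst (asm) lborel_integral_real_affine[where c=\<epsilon> and t=0]) auto
  also have "(\<lambda>\<xi>. std_normal_density (\<epsilon> * \<xi>) *\<^sub>R iexp (z / \<epsilon> * (\<epsilon> * \<xi>))) = (\<lambda>\<xi>. of_real (1 / sqrt (2 * pi)) * (cis (\<xi> * z) * gauss \<epsilon> \<xi>))"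
    using assms by (simp add: fun_eq_iff std_normal_density_def cis_conv_exp scaleR_conv_of_real mult_ac)
  finally have "of_real (\<epsilon> / sqrt (2 * pi)) * (LINT \<xi>|lborel. cis (\<xi> * z) * gauss \<epsilon> \<xi>) = of_real (exp (- ((z / \<epsilon>)\<^sup>2) / 2))"
    by (simp add: scaleR_conv_of_real)
  moreover have "exp (- ((z / \<epsilon>)\<^sup>2) / 2) = \<epsilon> / sqrt (2 * pi) * (2 * pi * normal_density 0 \<epsilon> z)"
  proof -
    have "sqrt (2 * pi * \<epsilon>\<^sup>2) = sqrt (2 * pi) * \<epsilon>" using assms by (simp add: real_sqrt_mult)
    moreover have "2 * pi / (sqrt (2 * pi) * sqrt (2 * pi)) = 1" by simp
    ultimately show ?thesis using assms by (simp add: normal_density_def power_divide)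
  qed
  ultimately have "of_real (\<epsilon> / sqrt (2 * pi)) * (LINT \<xi>|lborel. cis (\<xi> * z) * gauss \<epsilon> \<xi>) = of_real (\<epsilon> / sqrt (2 * pi)) * complex_of_real (2 * pi * normal_density 0 \<epsilon> z)"
    by (simp only: of_real_mult)
  then show ?thesis using assms by (simp only: mult_cancel_left) simp
qed

text \<open>The multiplication formula moves the transform from \<open>f\<close> to the damped
  exponential, whose transform is a normal density centred at \<open>x\<close>. The damped inversion
  integral is therefore an average of \<open>f\<close> around \<open>x\<close>.\<close>

lemma gauss_regularization:
  assumes f: "integrable lborel f" and "\<epsilon> > 0"
  shows "of_real fourier_const * (LINT \<xi>|lborel. cis (\<xi> * x) * (fourier f \<xi> * gauss \<epsilon> \<xi>)) = (LINT y|lborel. f y * of_real (normal_density x \<epsilon> y))"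
proof -
  have h: "integrable lborel (\<lambda>\<xi>. cis (\<xi> * x) * gauss \<epsilon> \<xi>)"
    by (rule integrable_cis_mult[OF integrable_gauss[OF \<open>\<epsilon> > 0\<close>]]) simp
  have "fourier (\<lambda>\<xi>. cis (\<xi> * x) * gauss \<epsilon> \<xi>) y = of_real (fourier_const * (2 * pi) * normal_density x \<epsilon> y)" for y
  proof -
    have "(\<lambda>\<xi>. cis (- (y * \<xi>)) * (cis (\<xi> * x) * gauss \<epsilon> \<xi>)) = (\<lambda>\<xi>. cis (\<xi> * (x - y)) * gauss \<epsilon> \<xi>)"
      by (simp add: fun_eq_iff cis_mult mult.assoc[symmetric]) (simp add: algebra_simps)
    moreover have "normal_density 0 \<epsilon> (x - y) = normal_density x \<epsilon> y"
      by (simp add: normal_density_def power2_commute)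
    ultimately show ?thesis unfolding fourier_cis by (simp only: fourier_gauss[OF \<open>\<epsilon> > 0\<close>]) simp
  qed
  then have *: "(LINT \<xi>|lborel. fourier f \<xi> * (cis (\<xi> * x) * gauss \<epsilon> \<xi>)) = (LINT y|lborel. f y * of_real (fourier_const * (2 * pi) * normal_density x \<epsilon> y))"
    using fourier_mult_formula[OF f h] by simp
  have "of_real fourier_const * (LINT \<xi>|lborel. cis (\<xi> * x) * (fourier f \<xi> * gauss \<epsilon> \<xi>)) = (LINT y|lborel. of_real fourier_const * (f y * of_real (fourier_const * (2 * pi) * normal_density x \<epsilon> y)))"
    unfolding integral_mult_right_zero *[symmetric] by (simp add: mult.left_commute)
  also have "(\<lambda>y. of_real fourier_const * (f y * of_real (fourier_const * (2 * pi) * normal_density x \<epsilon> y))) = (\<lambda>y. f y * of_real ((fourier_const * fourier_const * (2 * pi)) * normal_density x \<epsilon> y))"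
    by (simp only: of_real_mult mult_ac)
  also have "fourier_const * fourier_const * (2 * pi) = 1" by (simp add: fourier_const_sq)
  finally show ?thesis by simp
qed

text \<open>The damping is removed on both sides of \<open>gauss_regularization\<close>.
  Integrability of the transform controls one limit; after the substitution y = x + e z, boundedness
  of \<open>f\<close> and continuity at \<open>x\<close> control the other.\<close>

lemma fourier_inversion:
  assumes f: "integrable lborel f" and fh: "integrable lborel (fourier f)"
    and cont: "isCont f x" and bd: "\<And>y. cmod (f y) \<le> B"
  shows "fourier (fourier f) (- x) = f x"
proof -
  note [measurable] = borel_measurable_integrable[OF f] borel_measurable_integrable[OF fh]
  define e where "e n = inverse (real (Suc n))" for n
  have e: "e n > 0" for n by (simp add: e_def)
  have e0: "e \<longlonglongrightarrow> 0" unfolding e_def by (rule LIMSEQ_inverse_real_of_nat)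
  \<comment> \<open>\<open>gauss 0\<close> is the constant 1, so the limit is the undamped inversion
    integral.\<close>
  have "(\<lambda>n. LINT \<xi>|lborel. cis (\<xi> * x) * (fourier f \<xi> * gauss (e n) \<xi>)) \<longlonglongrightarrow> (LINT \<xi>|lborel. cis (\<xi> * x) * (fourier f \<xi> * gauss 0 \<xi>))"
  proof (rule integral_dominated_convergence[where w="\<lambda>\<xi>. norm (fourier f \<xi>)"])
    show "AE \<xi> in lborel. (\<lambda>n. cis (\<xi> * x) * (fourier f \<xi> * gauss (e n) \<xi>)) \<longlonglongrightarrow> cis (\<xi> * x) * (fourier f \<xi> * gauss 0 \<xi>)"
      by (intro AE_I2 tendsto_intros e0) simp
    show "AE \<xi> in lborel. norm (cis (\<xi> * x) * (fourier f \<xi> * gauss (e n) \<xi>)) \<le> norm (fourier f \<xi>)" for n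
      by (intro AE_I2) (simp add: norm_mult mult_left_le)
  qed (use fh in auto)
  then have 1: "(\<lambda>n. LINT y|lborel. f y * of_real (normal_density x (e n) y)) \<longlonglongrightarrow> of_real fourier_const * (LINT \<xi>|lborel. cis (\<xi> * x) * fourier f \<xi>)"
    unfolding gauss_regularization[OF f e, symmetric] by (intro tendsto_mult_left) simp
  have "(LINT y|lborel. f y * of_real (normal_density x (e n) y)) = (LINT z|lborel. f (x + e n * z) * of_real (std_normal_density z))" for n
  proof -
    have "(LINT y|lborel. f y * of_real (normal_density x (e n) y)) = \<bar>e n\<bar> *\<^sub>R (LINT z|lborel. f (x + e n * z) * of_real (normal_density x (e n) (x + e n * z)))"
      by (rule lborel_integral_real_affine) (use e[of n] in simp)
    also have "\<dots> = (LINT z|lborel. of_real (e n) * (f (x + e n * z) * of_real (normal_density x (e n) (x + e n * z))))"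
      using e[of n] by (simp add: scaleR_conv_of_real)
    also have "(\<lambda>z. of_real (e n) * (f (x + e n * z) * of_real (normal_density x (e n) (x + e n * z)))) = (\<lambda>z. f (x + e n * z) * of_real (std_normal_density z))"
    proof
      fix z
      have "sqrt (2 * pi * (e n)\<^sup>2) = sqrt (2 * pi) * e n" using e[of n] by (simp add: real_sqrt_mult)
      then have "e n * normal_density x (e n) (x + e n * z) = std_normal_density z"
        using e[of n] by (simp add: normal_density_def power_mult_distrib)
      then have "of_real (e n) * of_real (normal_density x (e n) (x + e n * z)) = complex_of_real (std_normal_density z)"
        unfolding of_real_mult[symmetric] by simp
      then show "of_real (e n) * (f (x + e n * z) * of_real (normal_density x (e n) (x + e n * z))) = f (x + e n * z) * of_real (std_normal_density z)"
        by (simp only: mult.left_commute[of "of_real (e n)"])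
    qed
    finally show ?thesis .
  qed
  moreover have "(\<lambda>n. LINT z|lborel. f (x + e n * z) * of_real (std_normal_density z)) \<longlonglongrightarrow> (LINT z|lborel. f x * of_real (std_normal_density z))"
  proof (rule integral_dominated_convergence[where w="\<lambda>z. B * std_normal_density z"])
    have "(\<lambda>n. x + e n * z) \<longlonglongrightarrow> x + 0 * z" for z by (intro tendsto_intros e0)
    then have "(\<lambda>n. f (x + e n * z)) \<longlonglongrightarrow> f x" for z
      using isCont_tendsto_compose[OF cont, of "\<lambda>n. x + e n * z"] by simp
    then show "AE z in lborel. (\<lambda>n. f (x + e n * z) * of_real (std_normal_density z)) \<longlonglongrightarrow> f x * of_real (std_normal_density z)"
      by (intro AE_I2 tendsto_mult_right)
    show "AE z in lborel. norm (f (x + e n * z) * of_real (std_normal_density z)) \<le> B * std_normal_density z" for n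
      by (intro AE_I2) (simp add: norm_mult mult_right_mono bd)
  qed auto
  moreover have "(LINT z|lborel. f x * of_real (std_normal_density z)) = f x"
  proof -
    have "(LINT z|lborel. complex_of_real (std_normal_density z)) = 1"
      unfolding integral_complex_of_real by simp
    then show ?thesis by simp
  qed
  ultimately have "(\<lambda>n. LINT y|lborel. f y * of_real (normal_density x (e n) y)) \<longlonglongrightarrow> f x" by simp
  from LIMSEQ_unique[OF 1 this] show ?thesis
    unfolding fourier_cis[of "fourier f"] by (simp add: mult.commute)
qed

lemma nn_integral_normal_density: "\<epsilon> > 0 \<Longrightarrow> (\<integral>\<^sup>+y. ennreal (normal_density x \<epsilon> y) \<partial>lborel) = 1"
  by (subst nn_integral_eq_integral) auto

lemma normal_density_commute: "normal_density x \<epsilon> y = normal_density y \<epsilon> x"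
  by (simp add: normal_density_def power2_commute)

lemma cnj_fourier: "cnj (fourier f \<xi>) = of_real fourier_const * (LINT x|lborel. cis (\<xi> * x) * cnj (f x))"
proof -
  have "cnj (LINT x|lborel. cis (- (\<xi> * x)) * f x) = (LINT x|lborel. cnj (cis (- (\<xi> * x)) * f x))"
    by (rule Bochner_Integration.integral_cnj[symmetric])
  then show ?thesis unfolding fourier_cis by (simp add: cis_cnj)
qed

text \<open>In the non-integrable case the left side is 0, the default value of the Bochner
  integral.\<close>

lemma norm_integral_le_nn:
  fixes f :: "'a \<Rightarrow> complex"
  shows "ennreal (cmod (LINT x|M. f x)) \<le> (\<integral>\<^sup>+x. cmod (f x) \<partial>M)"
  by (cases "integrable M f") (auto intro: integral_norm_bound_ennreal simp: not_integrable_integral_eq)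

text \<open>With damping, the left side becomes a double integral of the conjugate of f(x) times
  f(y) against a normal density that is symmetric in x and y. The inequality 2|f(x) f(y)| <=
  |f(x)|^2 + |f(y)|^2 and total mass 1 in either variable bound it by the right side; Fatou removes
  the damping.\<close>

lemma plancherel_le_nn:
  assumes f: "integrable lborel f"
  shows "(\<integral>\<^sup>+\<xi>. ennreal ((cmod (fourier f \<xi>))\<^sup>2) \<partial>lborel) \<le> (\<integral>\<^sup>+x. ennreal ((cmod (f x))\<^sup>2) \<partial>lborel)"
proof -
  note [measurable] = borel_measurable_integrable[OF f]
  define I where "I = (\<integral>\<^sup>+x. ennreal ((cmod (f x))\<^sup>2) \<partial>lborel)"
  have bound: "(\<integral>\<^sup>+\<xi>. ennreal ((cmod (fourier f \<xi>))\<^sup>2 * exp (- (\<epsilon> * \<xi>)\<^sup>2 / 2)) \<partial>lborel) \<le> I" if e: "\<epsilon> > 0" for \<epsilon>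
  proof -
    define C where "C = fourier_const * (LINT x|lborel. cmod (f x))"
    have C: "cmod (fourier f \<xi>) \<le> C" for \<xi> unfolding C_def by (rule norm_fourier_le[OF f])
    define a where "a \<xi> = fourier f \<xi> * gauss \<epsilon> \<xi>" for \<xi>
    have a: "integrable lborel a"
    proof (rule Bochner_Integration.integrable_bound)
      show "integrable lborel (\<lambda>\<xi>. of_real C * gauss \<epsilon> \<xi>)" by (intro integrable_mult_right integrable_gauss e)
      have "C \<ge> 0" using C[of 0] norm_ge_zero order.trans by blast
      then show "AE \<xi> in lborel. norm (a \<xi>) \<le> norm (of_real C * gauss \<epsilon> \<xi>)"
        by (intro AE_I2) (simp add: a_def norm_mult C mult_right_mono)
    qed (simp add: a_def[abs_def])
    have cf: "integrable lborel (\<lambda>x. cnj (f x))" using f by simp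
    let ?S = "\<lambda>\<xi>. (cmod (fourier f \<xi>))\<^sup>2 * exp (- (\<epsilon> * \<xi>)\<^sup>2 / 2)"
    have S: "of_real (?S \<xi>) = a \<xi> * cnj (fourier f \<xi>)" for \<xi>
    proof -
      have "of_real (?S \<xi>) = of_real ((cmod (fourier f \<xi>))\<^sup>2) * gauss \<epsilon> \<xi>" by (simp only: of_real_mult)
      then show ?thesis unfolding complex_norm_square by (simp add: a_def mult_ac)
    qed
    have Sint: "integrable lborel ?S"
    proof (rule Bochner_Integration.integrable_bound)
      show "integrable lborel (\<lambda>\<xi>. of_real C * a \<xi>)" by (intro integrable_mult_right a)
      have "cmod (of_real (?S \<xi>)) \<le> cmod (of_real C * a \<xi>)" for \<xi>
        unfolding S norm_mult complex_mod_cnj using C[of \<xi>] norm_ge_zero[of "fourier f \<xi>"]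
        by (subst mult.commute) (intro mult_right_mono, auto)
      then show "AE \<xi> in lborel. norm (?S \<xi>) \<le> norm (of_real C * a \<xi>)"
        by (intro AE_I2) (simp only: norm_of_real real_norm_def)
    qed simp
    have "of_real (LINT \<xi>|lborel. ?S \<xi>) = (LINT \<xi>|lborel. a \<xi> * cnj (fourier f \<xi>))"
      unfolding integral_complex_of_real[symmetric] S ..
    also have "\<dots> = of_real fourier_const * (LINT \<xi>|lborel. a \<xi> * (LINT x|lborel. cis (\<xi> * x) * cnj (f x)))"
      unfolding cnj_fourier integral_mult_right_zero[symmetric] by (simp only: mult.left_commute)
    also have "(LINT \<xi>|lborel. a \<xi> * (LINT x|lborel. cis (\<xi> * x) * cnj (f x))) = (LINT x|lborel. cnj (f x) * (LINT \<xi>|lborel. cis (\<xi> * x) * a \<xi>))"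
      using fubini_bounded[OF cf a, of "\<lambda>(x, \<xi>). cis (\<xi> * x)"] by (simp add: split_beta)
    also have "of_real fourier_const * \<dots> = (LINT x|lborel. cnj (f x) * (of_real fourier_const * (LINT \<xi>|lborel. cis (\<xi> * x) * a \<xi>)))"
      unfolding integral_mult_right_zero[symmetric] by (simp only: mult.left_commute)
    also have "\<dots> = (LINT x|lborel. cnj (f x) * (LINT y|lborel. f y * of_real (normal_density x \<epsilon> y)))"
      unfolding a_def gauss_regularization[OF f e] ..
    finally have "ennreal (LINT \<xi>|lborel. ?S \<xi>) = ennreal (cmod (LINT x|lborel. cnj (f x) * (LINT y|lborel. f y * of_real (normal_density x \<epsilon> y))))"
    proof -
      assume *: "of_real (LINT \<xi>|lborel. ?S \<xi>) = (LINT x|lborel. cnj (f x) * (LINT y|lborel. f y * of_real (normal_density x \<epsilon> y)))"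
      have "(LINT \<xi>|lborel. ?S \<xi>) \<ge> 0" by simp
      then show ?thesis unfolding *[symmetric] by simp
    qed
    also have "\<dots> \<le> (\<integral>\<^sup>+x. cmod (cnj (f x) * (LINT y|lborel. f y * of_real (normal_density x \<epsilon> y))) \<partial>lborel)"
      by (rule norm_integral_le_nn)
    also have "\<dots> \<le> (\<integral>\<^sup>+x. (\<integral>\<^sup>+y. ennreal (((cmod (f x))\<^sup>2 + (cmod (f y))\<^sup>2) / 2 * normal_density x \<epsilon> y) \<partial>lborel) \<partial>lborel)"
    proof (rule nn_integral_mono)
      fix x
      have "ennreal (cmod (cnj (f x) * (LINT y|lborel. f y * of_real (normal_density x \<epsilon> y)))) = ennreal (cmod (f x)) * ennreal (cmod (LINT y|lborel. f y * of_real (normal_density x \<epsilon> y)))"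
        by (simp add: norm_mult ennreal_mult)
      also have "\<dots> \<le> ennreal (cmod (f x)) * (\<integral>\<^sup>+y. cmod (f y * of_real (normal_density x \<epsilon> y)) \<partial>lborel)"
        by (intro mult_left_mono norm_integral_le_nn) simp
      also have "\<dots> = (\<integral>\<^sup>+y. ennreal (cmod (f x)) * cmod (f y * of_real (normal_density x \<epsilon> y)) \<partial>lborel)"
        by (subst nn_integral_cmult) auto
      also have "\<dots> \<le> (\<integral>\<^sup>+y. ennreal (((cmod (f x))\<^sup>2 + (cmod (f y))\<^sup>2) / 2 * normal_density x \<epsilon> y) \<partial>lborel)"
      proof (rule nn_integral_mono)
        fix y
        have "cmod (f x) * cmod (f y) \<le> ((cmod (f x))\<^sup>2 + (cmod (f y))\<^sup>2) / 2"
          using sum_squares_bound[of "cmod (f x)" "cmod (f y)"] by simp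
        then have "cmod (f x) * (cmod (f y) * normal_density x \<epsilon> y) \<le> ((cmod (f x))\<^sup>2 + (cmod (f y))\<^sup>2) / 2 * normal_density x \<epsilon> y"
          unfolding mult.assoc[symmetric] by (rule mult_right_mono) simp
        then show "ennreal (cmod (f x)) * cmod (f y * of_real (normal_density x \<epsilon> y)) \<le> ennreal (((cmod (f x))\<^sup>2 + (cmod (f y))\<^sup>2) / 2 * normal_density x \<epsilon> y)"
          by (simp add: norm_mult ennreal_mult[symmetric] ennreal_leI)
      qed
      finally show "ennreal (cmod (cnj (f x) * (LINT y|lborel. f y * of_real (normal_density x \<epsilon> y)))) \<le> (\<integral>\<^sup>+y. ennreal (((cmod (f x))\<^sup>2 + (cmod (f y))\<^sup>2) / 2 * normal_density x \<epsilon> y) \<partial>lborel)" .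
    qed
    also have "\<dots> = (\<integral>\<^sup>+x. (\<integral>\<^sup>+y. ennreal ((cmod (f x))\<^sup>2 / 2) * ennreal (normal_density x \<epsilon> y) + ennreal ((cmod (f y))\<^sup>2 / 2) * ennreal (normal_density x \<epsilon> y) \<partial>lborel) \<partial>lborel)"
      by (intro nn_integral_cong) (simp add: ennreal_mult[symmetric] ennreal_plus[symmetric] add_divide_distrib distrib_right del: ennreal_plus)
    also have "\<dots> = (\<integral>\<^sup>+x. (\<integral>\<^sup>+y. ennreal ((cmod (f x))\<^sup>2 / 2) * ennreal (normal_density x \<epsilon> y) \<partial>lborel) \<partial>lborel)
        + (\<integral>\<^sup>+x. (\<integral>\<^sup>+y. ennreal ((cmod (f y))\<^sup>2 / 2) * ennreal (normal_density x \<epsilon> y) \<partial>lborel) \<partial>lborel)"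
      by (subst nn_integral_add[symmetric]) (auto intro!: nn_integral_cong nn_integral_add simp: normal_density_def)
    also have "(\<integral>\<^sup>+x. (\<integral>\<^sup>+y. ennreal ((cmod (f x))\<^sup>2 / 2) * ennreal (normal_density x \<epsilon> y) \<partial>lborel) \<partial>lborel) = (\<integral>\<^sup>+x. ennreal ((cmod (f x))\<^sup>2 / 2) \<partial>lborel)"
      by (intro nn_integral_cong) (simp add: nn_integral_cmult nn_integral_normal_density[OF e])
    also have "(\<integral>\<^sup>+x. (\<integral>\<^sup>+y. ennreal ((cmod (f y))\<^sup>2 / 2) * ennreal (normal_density x \<epsilon> y) \<partial>lborel) \<partial>lborel)
       = (\<integral>\<^sup>+y. (\<integral>\<^sup>+x. ennreal ((cmod (f y))\<^sup>2 / 2) * ennreal (normal_density x \<epsilon> y) \<partial>lborel) \<partial>lborel)"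
      by (rule lborel_pair.Fubini'[symmetric]) (simp add: normal_density_def)
    also have "\<dots> = (\<integral>\<^sup>+x. ennreal ((cmod (f x))\<^sup>2 / 2) \<partial>lborel)"
      by (intro nn_integral_cong) (simp add: nn_integral_cmult normal_density_commute[of _ \<epsilon>] nn_integral_normal_density[OF e])
    also have "(\<integral>\<^sup>+x. ennreal ((cmod (f x))\<^sup>2 / 2) \<partial>lborel) + (\<integral>\<^sup>+x. ennreal ((cmod (f x))\<^sup>2 / 2) \<partial>lborel) = I"
      unfolding I_def by (subst nn_integral_add[symmetric]) (auto simp: ennreal_plus[symmetric] simp del: ennreal_plus)
    finally show ?thesis by (subst nn_integral_eq_integral[OF Sint]) auto
  qed
  define e where "e n = inverse (real (Suc n))" for n
  have e: "e n > 0" for n by (simp add: e_def)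
  have e0: "e \<longlonglongrightarrow> 0" unfolding e_def by (rule LIMSEQ_inverse_real_of_nat)
  have "(\<lambda>n. ennreal ((cmod (fourier f \<xi>))\<^sup>2 * exp (- (e n * \<xi>)\<^sup>2 / 2))) \<longlonglongrightarrow> ennreal ((cmod (fourier f \<xi>))\<^sup>2 * exp (- (0 * \<xi>)\<^sup>2 / 2))" for \<xi>
    by (intro tendsto_ennrealI tendsto_intros e0) simp
  then have "(\<integral>\<^sup>+\<xi>. ennreal ((cmod (fourier f \<xi>))\<^sup>2) \<partial>lborel) = (\<integral>\<^sup>+\<xi>. liminf (\<lambda>n. ennreal ((cmod (fourier f \<xi>))\<^sup>2 * exp (- (e n * \<xi>)\<^sup>2 / 2))) \<partial>lborel)"
    by (intro nn_integral_cong lim_imp_Liminf[symmetric]) auto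
  also have "\<dots> \<le> liminf (\<lambda>n. \<integral>\<^sup>+\<xi>. ennreal ((cmod (fourier f \<xi>))\<^sup>2 * exp (- (e n * \<xi>)\<^sup>2 / 2)) \<partial>lborel)"
    by (rule nn_integral_liminf) simp
  also have "\<dots> \<le> liminf (\<lambda>n. I)" by (intro Liminf_mono always_eventually allI bound e)
  finally show ?thesis by (simp add: I_def Liminf_const)
qed

section \<open>Square-integrable Fourier densities\<close>

lemma integrable_inverse_1_plus_square: "integrable lborel (\<lambda>x::real. 1 / (1 + x\<^sup>2))"
proof -
  let ?h = "\<lambda>x::real. 1 / (1 + x\<^sup>2)"
  have pos: "1 + x\<^sup>2 > 0" for x :: real by (simp add: add_pos_nonneg)
  have half: "(\<integral>\<^sup>+x. ennreal (?h x) * indicator {0..} x \<partial>lborel) = ennreal (pi / 2 - arctan 0)"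
    by (rule nn_integral_FTC_atLeast)
       (use pos in \<open>auto intro!: derivative_eq_intros tendsto_arctan_at_top simp: inverse_eq_divide less_imp_le\<close>)
  have 1: "integrable lborel (\<lambda>x. ?h x * indicator {0..} x)"
  proof (rule integrableI_nonneg)
    show "(\<integral>\<^sup>+x. ennreal (?h x * indicator {0..} x) \<partial>lborel) < \<infinity>"
    proof -
      have "(\<integral>\<^sup>+x. ennreal (?h x * indicator {0..} x) \<partial>lborel) = (\<integral>\<^sup>+x. ennreal (?h x) * indicator {0..} x \<partial>lborel)"
        by (intro nn_integral_cong) (simp add: indicator_def)
      then show ?thesis using half by simp
    qed
  qed (use pos in \<open>auto simp: less_imp_le\<close>)
  have 2: "integrable lborel (\<lambda>x. ?h x * indicator {0..} (- x))"
    using lborel_integrable_real_affine[OF 1, of "-1" 0] by simp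
  show ?thesis
    by (rule Bochner_Integration.integrable_bound[OF Bochner_Integration.integrable_add[OF 1 2]])
       (auto simp: indicator_def)
qed

lemma schwartz_decay:
  assumes "f \<in> schwartz" obtains A where "A \<ge> 0" "\<And>x. cmod (f x) \<le> A / (1 + x\<^sup>2)"
proof -
  obtain A where A: "A \<ge> 0" "\<And>x. cmod (f x) \<le> A"
    using bounded_rangeE[OF schwartz_bounded'[OF assms]] by blast
  obtain B where B: "B \<ge> 0" "\<And>x. cmod (of_real (x ^ 2) * nth_vderiv 0 f x) \<le> B"
    using bounded_rangeE[OF schwartz_bounded[OF assms, of 2 0]] by blast
  have "cmod (f x) * (1 + x\<^sup>2) \<le> A + B" for x
    using A(2)[of x] B(2)[of x] by (simp add: norm_mult norm_power distrib_left mult.commute)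
  then have "cmod (f x) \<le> (A + B) / (1 + x\<^sup>2)" for x
    by (subst pos_le_divide_eq) (auto intro: add_pos_nonneg)
  with A B that show ?thesis by (metis add_nonneg_nonneg)
qed

lemma schwartz_measurable: "f \<in> schwartz \<Longrightarrow> f \<in> borel_measurable borel"
  by (intro borel_measurable_continuous_onI smooth_continuous schwartz_smooth)

lemma schwartz_integrable: assumes "f \<in> schwartz" shows "integrable lborel f"
proof -
  obtain A where A: "A \<ge> 0" "\<And>x. cmod (f x) \<le> A / (1 + x\<^sup>2)" using schwartz_decay[OF assms] by blast
  show ?thesis
    by (rule Bochner_Integration.integrable_bound[OF integrable_mult_right[OF integrable_inverse_1_plus_square, of A]])
       (use A schwartz_measurable[OF assms] in \<open>auto simp: abs_of_nonneg add_nonneg_nonneg\<close>)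
qed

lemma schwartz_square_integrable: assumes "f \<in> schwartz" shows "integrable lborel (\<lambda>x. (cmod (f x))\<^sup>2)"
proof -
  obtain B where B: "B \<ge> 0" "\<And>x. cmod (f x) \<le> B"
    using bounded_rangeE[OF schwartz_bounded'[OF assms]] by blast
  note [measurable] = schwartz_measurable[OF assms]
  show ?thesis
    by (rule Bochner_Integration.integrable_bound[OF integrable_mult_right[OF integrable_norm[OF schwartz_integrable[OF assms]], of B]])
       (use B in \<open>auto simp: power2_eq_square abs_mult intro!: mult_right_mono\<close>)
qed

lemma schwartz_tendsto_0:
  assumes "f \<in> schwartz" shows "(f \<longlongrightarrow> 0) at_top" "(f \<longlongrightarrow> 0) at_bot"
proof -
  obtain A where A: "A \<ge> 0" "\<And>x. cmod (f x) \<le> A / (1 + x\<^sup>2)" using schwartz_decay[OF assms] by blast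
  have 1: "((\<lambda>x::real. A / (1 + x\<^sup>2)) \<longlongrightarrow> 0) at_top" by real_asymp
  have 2: "((\<lambda>x::real. A / (1 + x\<^sup>2)) \<longlongrightarrow> 0) at_bot" by real_asymp
  show "(f \<longlongrightarrow> 0) at_top"
    by (rule Lim_null_comparison[OF always_eventually 1]) (use A in blast)
  show "(f \<longlongrightarrow> 0) at_bot"
    by (rule Lim_null_comparison[OF always_eventually 2]) (use A in blast)
qed

lemma integral_derivative_eq_0:
  fixes F F' :: "real \<Rightarrow> complex"
  assumes "\<And>x. (F has_vector_derivative F' x) (at x)" "\<And>x. isCont F' x" "integrable lborel F'"
    and "(F \<longlongrightarrow> 0) at_top" "(F \<longlongrightarrow> 0) at_bot"
  shows "(LINT x|lborel. F' x) = 0"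
proof -
  have "(LBINT x=-\<infinity>..\<infinity>. F' x) = 0 - 0"
  proof (rule interval_integral_FTC_integrable[where F=F])
    show "set_integrable lborel (einterval (- \<infinity>) \<infinity>) F'"
      using assms(3) by (simp add: set_integrable_def)
    show "((F \<circ> real_of_ereal) \<longlongrightarrow> 0) (at_right (- \<infinity>))" "((F \<circ> real_of_ereal) \<longlongrightarrow> 0) (at_left \<infinity>)"
      using assms(4,5) by (simp_all add: ereal_tendsto_simps1)
  qed (use assms in auto)
  then show ?thesis by (simp add: interval_lebesgue_integral_def set_lebesgue_integral_def)
qed

lemma cis_has_vderiv: "((\<lambda>x. cis (c * x)) has_vector_derivative (\<i> * of_real c * cis (c * x))) (at x)"
proof -
  have "((\<lambda>x. c * x) has_vector_derivative c) (at x)" by (auto intro!: derivative_eq_intros)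
  from vector_diff_chain_at[OF this has_vector_derivative_iexp] show ?thesis
    by (simp add: o_def cis_conv_exp scaleR_conv_of_real mult_ac)
qed

lemma tendsto_0_cis_mult: "(f \<longlongrightarrow> 0) F \<Longrightarrow> ((\<lambda>x. cis (g x) * f x) \<longlongrightarrow> 0) F"
  by (rule tendsto_norm_zero_cancel) (simp add: norm_mult tendsto_norm_zero)

lemma fourier_vderiv:
  assumes f: "f \<in> schwartz"
  shows "fourier (nth_vderiv (Suc 0) f) \<xi> = \<i> * of_real \<xi> * fourier f \<xi>"
proof -
  let ?f' = "nth_vderiv (Suc 0) f"
  have f': "?f' \<in> schwartz" by (rule schwartz_deriv[OF f])
  let ?e = "\<lambda>x. cis (- \<xi> * x)"
  let ?G = "\<lambda>x. ?e x * ?f' x + \<i> * of_real (- \<xi>) * ?e x * f x"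
  have i1: "integrable lborel (\<lambda>x. ?e x * ?f' x)" and i2: "integrable lborel (\<lambda>x. ?e x * f x)"
    by (intro integrable_cis_mult schwartz_integrable f f'; simp)+
  from integrable_mult_right[OF i2, of "\<i> * of_real (- \<xi>)"]
  have i3: "integrable lborel (\<lambda>x. \<i> * of_real (- \<xi>) * ?e x * f x)" by (simp add: mult.assoc)
  have "(LINT x|lborel. ?G x) = 0"
  proof (rule integral_derivative_eq_0)
    show "((\<lambda>x. ?e x * f x) has_vector_derivative ?G x) (at x)" for x
      by (rule has_vector_derivative_mult[OF cis_has_vderiv schwartz_has_vderiv[OF f]])
    have "continuous_on UNIV ?G"
      by (intro continuous_intros smooth_continuous schwartz_smooth f f')
    then show "isCont ?G x" for x by (simp add: continuous_on_eq_continuous_at)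
    show "integrable lborel ?G" by (intro Bochner_Integration.integrable_add i1 i3)
    show "((\<lambda>x. ?e x * f x) \<longlongrightarrow> 0) at_top" "((\<lambda>x. ?e x * f x) \<longlongrightarrow> 0) at_bot"
      by (intro tendsto_0_cis_mult schwartz_tendsto_0[OF f])+
  qed
  then have "(LINT x|lborel. ?e x * ?f' x) = \<i> * of_real \<xi> * (LINT x|lborel. ?e x * f x)"
    by (subst (asm) Bochner_Integration.integral_add[OF i1 i3]) (simp add: mult.assoc add_eq_0_iff2)
  then show ?thesis by (simp add: fourier_cis)
qed

text \<open>The image of the Schwartz space meets the conditions of
  \<open>schwartz_coinduct\<close>: differentiating a transform multiplies the original by -i x, and
  multiplying a transform by xi differentiates the original up to the factor -i.\<close>

lemma fourier_schwartz: assumes "f \<in> schwartz" shows "fourier f \<in> schwartz"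
proof (rule schwartz_coinduct[where S="fourier ` schwartz"])
  fix h assume "h \<in> fourier ` schwartz"
  then obtain f where f: "f \<in> schwartz" and h: "h = fourier f" by auto
  have xf: "(\<lambda>x. of_real x * f x) \<in> schwartz" by (rule schwartz_mult_of_real[OF f])
  have 1: "fourier (\<lambda>x. - \<i> * (of_real x * f x)) \<in> fourier ` schwartz"
    by (intro imageI schwartz_cmult xf)
  show "\<exists>h'\<in>fourier ` schwartz. \<forall>x. (h has_vector_derivative h' x) (at x)"
    unfolding h by (rule bexI[OF _ 1]) (use fourier_has_vector_derivative[OF schwartz_integrable[OF f] schwartz_integrable[OF xf]] in blast)
  have "(\<lambda>\<xi>. of_real \<xi> * h \<xi>) = fourier (\<lambda>x. - \<i> * nth_vderiv (Suc 0) f x)"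
    unfolding fourier_cmult[abs_def] fourier_vderiv[OF f] h by (simp add: fun_eq_iff mult.assoc[symmetric])
  then show "(\<lambda>\<xi>. of_real \<xi> * h \<xi>) \<in> fourier ` schwartz"
    using imageI[OF schwartz_cmult[OF schwartz_deriv[OF f, of "Suc 0"], of "- \<i>"], of fourier] by simp
  show "bounded (range h)" unfolding h
    by (rule bounded_rangeI[OF norm_fourier_le[OF schwartz_integrable[OF f]]])
qed (use assms in auto)

lemma schwartz_inversion: assumes "f \<in> schwartz" shows "fourier (fourier f) (- x) = f x"
proof -
  obtain B where "\<And>x. cmod (f x) \<le> B"
    using bounded_rangeE[OF schwartz_bounded'[OF assms]] by blast
  moreover have "isCont f x"
    using smooth_continuous[OF schwartz_smooth[OF assms], of UNIV] by (simp add: continuous_on_eq_continuous_at)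
  ultimately show ?thesis
    by (intro fourier_inversion schwartz_integrable fourier_schwartz assms)
qed

lemma fourier_reflect: "fourier (\<lambda>x. f (- x)) \<xi> = fourier f (- \<xi>)"
  unfolding fourier_cis by (subst lborel_integral_real_affine[where c="-1" and t=0]) auto

definition invfour :: "(real \<Rightarrow> complex) \<Rightarrow> real \<Rightarrow> complex" where
  "invfour f x = fourier f (- x)"

lemma invfour_schwartz: "f \<in> schwartz \<Longrightarrow> invfour f \<in> schwartz"
  unfolding invfour_def[abs_def] by (intro schwartz_reflect fourier_schwartz)

lemma invfour_fourier: "f \<in> schwartz \<Longrightarrow> invfour (fourier f) = f"
  by (simp add: fun_eq_iff invfour_def schwartz_inversion)

lemma fourier_invfour: "f \<in> schwartz \<Longrightarrow> fourier (invfour f) = f"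
  unfolding invfour_def[abs_def] by (simp add: fun_eq_iff fourier_reflect schwartz_inversion)

section \<open>Weighted square-integrable densities and their tempered distributions\<close>

lemma square_integrable_mult:
  fixes a b :: "'a \<Rightarrow> complex"
  assumes [measurable]: "a \<in> borel_measurable M" "b \<in> borel_measurable M"
    and a: "integrable M (\<lambda>x. (cmod (a x))\<^sup>2)" and b: "integrable M (\<lambda>x. (cmod (b x))\<^sup>2)"
  shows "integrable M (\<lambda>x. a x * b x)"
    and "(LINT x|M. cmod (a x) * cmod (b x)) \<le> sqrt (LINT x|M. (cmod (a x))\<^sup>2) * sqrt (LINT x|M. (cmod (b x))\<^sup>2)"
    and "cmod (LINT x|M. a x * b x) \<le> sqrt (LINT x|M. (cmod (a x))\<^sup>2) * sqrt (LINT x|M. (cmod (b x))\<^sup>2)"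
proof -
  show i: "integrable M (\<lambda>x. a x * b x)"
  proof (rule Bochner_Integration.integrable_bound[OF Bochner_Integration.integrable_add[OF a b]])
    have "cmod (a x) * cmod (b x) \<le> (cmod (a x))\<^sup>2 + (cmod (b x))\<^sup>2" for x
      using sum_squares_bound[of "cmod (a x)" "cmod (b x)"] mult_nonneg_nonneg[OF norm_ge_zero[of "a x"] norm_ge_zero[of "b x"]]
      by linarith
    then show "AE x in M. norm (a x * b x) \<le> norm ((cmod (a x))\<^sup>2 + (cmod (b x))\<^sup>2)"
      by (intro AE_I2) (simp add: norm_mult)
  qed simp
  have ab: "integrable M (\<lambda>x. cmod (a x) * cmod (b x))"
    using integrable_norm[OF i] by (simp add: norm_mult)
  have "(\<integral>\<^sup>+x. ennreal (cmod (a x)) * ennreal (cmod (b x)) \<partial>M)\<^sup>2 \<le> (\<integral>\<^sup>+x. (ennreal (cmod (a x)))\<^sup>2 \<partial>M) * (\<integral>\<^sup>+x. (ennreal (cmod (b x)))\<^sup>2 \<partial>M)"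
    by (rule Cauchy_Schwarz_nn_integral) auto
  also have "(\<integral>\<^sup>+x. (ennreal (cmod (a x)))\<^sup>2 \<partial>M) = ennreal (LINT x|M. (cmod (a x))\<^sup>2)"
    by (subst nn_integral_eq_integral[OF a, symmetric]) (auto simp: ennreal_power)
  also have "(\<integral>\<^sup>+x. (ennreal (cmod (b x)))\<^sup>2 \<partial>M) = ennreal (LINT x|M. (cmod (b x))\<^sup>2)"
    by (subst nn_integral_eq_integral[OF b, symmetric]) (auto simp: ennreal_power)
  also have "(\<integral>\<^sup>+x. ennreal (cmod (a x)) * ennreal (cmod (b x)) \<partial>M) = ennreal (LINT x|M. cmod (a x) * cmod (b x))"
    by (subst nn_integral_eq_integral[OF ab, symmetric]) (auto simp: ennreal_mult)
  finally have "(LINT x|M. cmod (a x) * cmod (b x))\<^sup>2 \<le> (LINT x|M. (cmod (a x))\<^sup>2) * (LINT x|M. (cmod (b x))\<^sup>2)"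
    by (simp add: ennreal_power ennreal_mult[symmetric])
  then have "(LINT x|M. cmod (a x) * cmod (b x)) \<le> sqrt ((LINT x|M. (cmod (a x))\<^sup>2) * (LINT x|M. (cmod (b x))\<^sup>2))"
    by (rule real_le_rsqrt)
  then show *: "(LINT x|M. cmod (a x) * cmod (b x)) \<le> sqrt (LINT x|M. (cmod (a x))\<^sup>2) * sqrt (LINT x|M. (cmod (b x))\<^sup>2)"
    by (simp add: real_sqrt_mult)
  have "cmod (LINT x|M. a x * b x) \<le> (LINT x|M. cmod (a x * b x))" by simp
  then show "cmod (LINT x|M. a x * b x) \<le> sqrt (LINT x|M. (cmod (a x))\<^sup>2) * sqrt (LINT x|M. (cmod (b x))\<^sup>2)"
    using * by (simp add: norm_mult)
qed

lemma plancherel_le: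
  assumes f: "integrable lborel f" and f2: "integrable lborel (\<lambda>x. (cmod (f x))\<^sup>2)"
  shows "integrable lborel (\<lambda>\<xi>. (cmod (fourier f \<xi>))\<^sup>2)"
    and "(LINT \<xi>|lborel. (cmod (fourier f \<xi>))\<^sup>2) \<le> (LINT x|lborel. (cmod (f x))\<^sup>2)"
proof -
  note [measurable] = borel_measurable_integrable[OF f]
  have le: "(\<integral>\<^sup>+\<xi>. ennreal ((cmod (fourier f \<xi>))\<^sup>2) \<partial>lborel) \<le> ennreal (LINT x|lborel. (cmod (f x))\<^sup>2)"
    using plancherel_le_nn[OF f] nn_integral_eq_integral[OF f2] by simp
  show i: "integrable lborel (\<lambda>\<xi>. (cmod (fourier f \<xi>))\<^sup>2)"
    by (rule integrableI_nonneg) (use le in \<open>auto intro: le_less_trans\<close>)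
  show "(LINT \<xi>|lborel. (cmod (fourier f \<xi>))\<^sup>2) \<le> (LINT x|lborel. (cmod (f x))\<^sup>2)"
    using le nn_integral_eq_integral[OF i] by simp
qed

text \<open>The Fourier side of \<open>Sobolev_line s\<close>, with functions in place of classes.
  The companion \<open>weighted_norm2\<close> is the square of the norm, which spares roots in the
  estimates.\<close>

definition weighted_L2 :: "real \<Rightarrow> (real \<Rightarrow> complex) set" where
  "weighted_L2 s = {g \<in> borel_measurable borel. integrable lborel (\<lambda>\<xi>. (1 + \<xi>\<^sup>2) powr s * (cmod (g \<xi>))\<^sup>2)}"

definition weighted_norm2 :: "real \<Rightarrow> (real \<Rightarrow> complex) \<Rightarrow> real" where
  "weighted_norm2 s g = (LINT \<xi>|lborel. (1 + \<xi>\<^sup>2) powr s * (cmod (g \<xi>))\<^sup>2)"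

lemma weighted_L2_measurable: "g \<in> weighted_L2 s \<Longrightarrow> g \<in> borel_measurable borel"
  by (simp add: weighted_L2_def)

lemma one_plus_square_ne_0 [simp]: "1 + x\<^sup>2 \<noteq> (0::real)"
  using zero_le_power2[of x] by linarith

lemma weighted_norm2_nonneg: "weighted_norm2 s g \<ge> 0"
  by (simp add: weighted_norm2_def)

lemma weighted_L2_mono: assumes "g \<in> weighted_L2 s" "r \<le> s" shows "g \<in> weighted_L2 r"
proof -
  have [measurable]: "g \<in> borel_measurable borel" using assms by (simp add: weighted_L2_def)
  have "integrable lborel (\<lambda>\<xi>. (1 + \<xi>\<^sup>2) powr r * (cmod (g \<xi>))\<^sup>2)"
    by (rule Bochner_Integration.integrable_bound[where f="\<lambda>\<xi>. (1 + \<xi>\<^sup>2) powr s * (cmod (g \<xi>))\<^sup>2"])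
       (use assms in \<open>auto simp: weighted_L2_def intro!: mult_right_mono powr_mono\<close>)
  then show ?thesis by (simp add: weighted_L2_def)
qed

lemma weighted_L2_0: "g \<in> weighted_L2 0 \<longleftrightarrow> g \<in> borel_measurable borel \<and> integrable lborel (\<lambda>\<xi>. (cmod (g \<xi>))\<^sup>2)"
  by (simp add: weighted_L2_def)

lemma weighted_norm2_0: "weighted_norm2 0 g = (LINT \<xi>|lborel. (cmod (g \<xi>))\<^sup>2)"
  by (simp add: weighted_norm2_def)

text \<open>The tempered distribution with Fourier density \<open>g\<close>: Schwartz functions are Fourier transforms of Schwartz functions.\<close>

definition fourier_distr :: "(real \<Rightarrow> complex) \<Rightarrow> functional" where
  "fourier_distr g \<psi> = (if \<psi> \<in> schwartz then LINT \<xi>|lborel. g \<xi> * invfour \<psi> \<xi> else 0)"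

lemma weighted_L2_mult_schwartz:
  assumes g: "g \<in> weighted_L2 0" and \<psi>: "\<psi> \<in> schwartz"
  shows "integrable lborel (\<lambda>\<xi>. g \<xi> * \<psi> \<xi>)"
  by (rule square_integrable_mult(1)) (use g \<psi> schwartz_measurable schwartz_square_integrable in \<open>auto simp: weighted_L2_0\<close>)

lemma invfour_lincomb:
  assumes "\<phi> \<in> schwartz" "\<psi> \<in> schwartz"
  shows "invfour (\<lambda>x. \<phi> x + \<psi> x) \<xi> = invfour \<phi> \<xi> + invfour \<psi> \<xi>" "invfour (\<lambda>x. c * \<phi> x) \<xi> = c * invfour \<phi> \<xi>"
  using assms by (simp_all add: invfour_def fourier_add schwartz_integrable fourier_cmult)

lemma linear_fourier_distr: assumes g: "g \<in> weighted_L2 0" shows "linear_functional_on schwartz (fourier_distr g)"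
  unfolding linear_functional_on_def
proof (intro conjI ballI allI impI)
  fix \<phi> \<psi> assume \<phi>: "\<phi> \<in> schwartz" and \<psi>: "\<psi> \<in> schwartz"
  show "fourier_distr g (\<lambda>x. \<phi> x + \<psi> x) = fourier_distr g \<phi> + fourier_distr g \<psi>"
    using \<phi> \<psi> schwartz_add[OF \<phi> \<psi>] weighted_L2_mult_schwartz[OF g invfour_schwartz[OF \<phi>]] weighted_L2_mult_schwartz[OF g invfour_schwartz[OF \<psi>]]
    by (simp add: fourier_distr_def invfour_lincomb(1)[OF \<phi> \<psi>] distrib_left)
next
  fix c \<phi> assume \<phi>: "\<phi> \<in> schwartz"
  show "fourier_distr g (\<lambda>x. c * \<phi> x) = c * fourier_distr g \<phi>"
    using \<phi> schwartz_cmult[OF \<phi>] by (simp add: fourier_distr_def invfour_lincomb(2)[OF \<phi> \<phi>] mult.left_commute[of _ c])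
qed (simp add: fourier_distr_def)

lemma square_integral_invfour_le:
  assumes "\<psi> \<in> schwartz"
  shows "(LINT \<xi>|lborel. (cmod (invfour \<psi> \<xi>))\<^sup>2) \<le> (LINT x|lborel. (cmod (\<psi> x))\<^sup>2)"
proof -
  have "(LINT \<xi>|lborel. (cmod (fourier (\<lambda>x. \<psi> (- x)) \<xi>))\<^sup>2) \<le> (LINT x|lborel. (cmod (\<psi> (- x)))\<^sup>2)"
    by (rule plancherel_le(2)) (use schwartz_reflect[OF assms] schwartz_integrable schwartz_square_integrable in blast)+
  also have "(LINT x|lborel. (cmod (\<psi> (- x)))\<^sup>2) = (LINT x|lborel. (cmod (\<psi> x))\<^sup>2)"
    by (subst (2) lborel_integral_real_affine[where c="-1" and t=0]) auto
  finally show ?thesis by (simp add: fourier_reflect invfour_def)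
qed

lemma norm_fourier_distr_le:
  assumes g: "g \<in> weighted_L2 0" and \<psi>: "\<psi> \<in> schwartz"
  shows "cmod (fourier_distr g \<psi>) \<le> sqrt (weighted_norm2 0 g) * sqrt (LINT x|lborel. (cmod (\<psi> x))\<^sup>2)"
proof -
  have "cmod (LINT \<xi>|lborel. g \<xi> * invfour \<psi> \<xi>) \<le> sqrt (LINT \<xi>|lborel. (cmod (g \<xi>))\<^sup>2) * sqrt (LINT \<xi>|lborel. (cmod (invfour \<psi> \<xi>))\<^sup>2)"
    by (rule square_integrable_mult(3)) (use g invfour_schwartz[OF \<psi>] schwartz_measurable schwartz_square_integrable in \<open>auto simp: weighted_L2_0\<close>)
  also have "\<dots> \<le> sqrt (LINT \<xi>|lborel. (cmod (g \<xi>))\<^sup>2) * sqrt (LINT x|lborel. (cmod (\<psi> x))\<^sup>2)"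
    by (intro mult_left_mono real_sqrt_le_mono square_integral_invfour_le[OF \<psi>]) simp
  finally show ?thesis using \<psi> by (simp add: fourier_distr_def weighted_norm2_0)
qed

lemma seminorm_le_sum:
  assumes \<psi>: "\<psi> \<in> schwartz" and "k \<le> N" "m \<le> N"
  shows "cmod (of_real (x ^ k) * nth_vderiv m \<psi> x) \<le> (\<Sum>k\<le>N. \<Sum>m\<le>N. SUP x. cmod (of_real (x ^ k) * nth_vderiv m \<psi> x))"
proof -
  let ?p = "\<lambda>k m. SUP x. cmod (of_real (x ^ k) * nth_vderiv m \<psi> x)"
  have le: "cmod (of_real (x ^ k) * nth_vderiv m \<psi> x) \<le> ?p k m" for x k m
  proof (rule cSUP_upper)
    obtain A where "\<And>x. cmod (of_real (x ^ k) * nth_vderiv m \<psi> x) \<le> A"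
      using bounded_rangeE[OF schwartz_bounded[OF \<psi>]] by blast
    then show "bdd_above (range (\<lambda>x. cmod (of_real (x ^ k) * nth_vderiv m \<psi> x)))"
      by (intro bdd_aboveI2)
  qed simp
  have nn: "?p k m \<ge> 0" for k m by (rule order.trans[OF norm_ge_zero le[of 0]])
  have "?p k m \<le> (\<Sum>m\<le>N. ?p k m)" by (rule member_le_sum) (use assms nn in auto)
  also have "\<dots> \<le> (\<Sum>k\<le>N. \<Sum>m\<le>N. ?p k m)"
    by (rule member_le_sum[where f="\<lambda>k. \<Sum>m\<le>N. ?p k m"]) (use assms nn in \<open>auto intro: sum_nonneg\<close>)
  finally show ?thesis by (rule order.trans[OF le])
qed

text \<open>The seminorms with k = 0 and k = 2 bound psi by 2M/(1+x^2), hence its L^2 norm by a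
  multiple of M; that L^2 norm controls the pairing.\<close>

lemma fourier_distr_tempered: assumes g: "g \<in> weighted_L2 0" shows "fourier_distr g \<in> tempered_distributions"
proof -
  define J where "J = (LINT x|lborel. 1 / (1 + x\<^sup>2) :: real)"
  have "cmod (fourier_distr g \<psi>) \<le> (sqrt (weighted_norm2 0 g) * sqrt J * 2) *
      (\<Sum>k\<le>2. \<Sum>m\<le>2. SUP x. cmod (of_real (x ^ k) * nth_vderiv m \<psi> x))" (is "_ \<le> _ * ?M") if \<psi>: "\<psi> \<in> schwartz" for \<psi>
  proof -
    have b: "cmod (\<psi> x) \<le> 2 * ?M / (1 + x\<^sup>2)" for x
    proof -
      have "cmod (\<psi> x) * (1 + x\<^sup>2) \<le> 2 * ?M"
        using seminorm_le_sum[OF \<psi>, of 0 2 0 x] seminorm_le_sum[OF \<psi>, of 2 2 0 x]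
        by (simp add: norm_mult norm_power distrib_left mult.commute)
      then show ?thesis by (subst pos_le_divide_eq) (auto intro: add_pos_nonneg)
    qed
    have M: "?M \<ge> 0" by (rule order.trans[OF norm_ge_zero seminorm_le_sum[OF \<psi>, of 0 2 0 0]]) simp_all
    have "(LINT x|lborel. (cmod (\<psi> x))\<^sup>2) \<le> (LINT x|lborel. (2 * ?M)\<^sup>2 * (1 / (1 + x\<^sup>2)))"
    proof (rule integral_mono)
      fix x :: real
      have "(cmod (\<psi> x))\<^sup>2 \<le> (2 * ?M / (1 + x\<^sup>2))\<^sup>2" by (rule power_mono[OF b]) simp
      also have "\<dots> = (2 * ?M)\<^sup>2 * (1 / (1 + x\<^sup>2)) * (1 / (1 + x\<^sup>2))"
        by (simp add: power2_eq_square)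
      also have "\<dots> \<le> (2 * ?M)\<^sup>2 * (1 / (1 + x\<^sup>2)) * 1"
        by (intro mult_left_mono) (auto simp: divide_le_eq add_pos_nonneg intro: mult_nonneg_nonneg)
      finally show "(cmod (\<psi> x))\<^sup>2 \<le> (2 * ?M)\<^sup>2 * (1 / (1 + x\<^sup>2))" by simp
    qed (intro schwartz_square_integrable \<psi> integrable_mult_right integrable_inverse_1_plus_square)+
    then have "sqrt (LINT x|lborel. (cmod (\<psi> x))\<^sup>2) \<le> sqrt ((2 * ?M)\<^sup>2 * J)"
      unfolding J_def integral_mult_right_zero by (rule real_sqrt_le_mono)
    also have "\<dots> = 2 * ?M * sqrt J" using M by (simp add: real_sqrt_mult)
    finally have "sqrt (weighted_norm2 0 g) * sqrt (LINT x|lborel. (cmod (\<psi> x))\<^sup>2) \<le> sqrt (weighted_norm2 0 g) * (2 * ?M * sqrt J)"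
      by (intro mult_left_mono) (simp_all add: weighted_norm2_nonneg)
    with norm_fourier_distr_le[OF g \<psi>] show ?thesis by (simp add: mult_ac)
  qed
  then show ?thesis unfolding tempered_distributions_def by (intro CollectI conjI linear_fourier_distr[OF g] exI ballI)
qed

lemma fourier_distr_density: assumes g: "g \<in> weighted_L2 0" shows "has_fourier_density (fourier_distr g) g"
  unfolding has_fourier_density_def
  using weighted_L2_mult_schwartz[OF g] weighted_L2_measurable[OF g]
  by (auto simp: fourier_distr_def fourier_schwartz invfour_fourier)

text \<open>Every Schwartz function is the transform of its inverse transform, so the density fixes
  the functional on \<open>schwartz\<close>; elsewhere both sides are 0 by the convention on
  functionals.\<close>

lemma tempered_eq_fourier_distr:
  assumes "u \<in> tempered_distributions" "has_fourier_density u g" shows "u = fourier_distr g"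
proof
  fix \<psi>
  show "u \<psi> = fourier_distr g \<psi>"
  proof (cases "\<psi> \<in> schwartz")
    case True
    have "u (fourier (invfour \<psi>)) = (LINT \<xi>|lborel. g \<xi> * invfour \<psi> \<xi>)"
      using assms(2) invfour_schwartz[OF True] by (simp add: has_fourier_density_def)
    then show ?thesis using True by (simp add: fourier_invfour fourier_distr_def)
  next
    case False
    then show ?thesis using assms(1) by (simp add: tempered_distributions_def linear_functional_on_def fourier_distr_def)
  qed
qed

lemma test_functions_smooth_mult:
  assumes "smooth \<phi>" "\<psi> \<in> test_functions \<Omega>" shows "(\<lambda>x. \<phi> x * \<psi> x) \<in> test_functions \<Omega>"
proof -
  have *: "closure {x. \<phi> x * \<psi> x \<noteq> 0} \<subseteq> closure {x. \<psi> x \<noteq> 0}" by (rule closure_mono) auto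
  moreover from this have "compact (closure {x. \<phi> x * \<psi> x \<noteq> 0})"
    using assms compact_closure_subset unfolding test_functions_def by blast
  ultimately show ?thesis using assms smooth_mult unfolding test_functions_def by blast
qed

lemma bump_nonzero: assumes "c < x" "x < d" shows "bump c d 1 x \<noteq> 0"
  using assms by (simp add: bump_def flat_exp_def)

text \<open>Densities are known to be integrable against Schwartz functions only. Multiplying the
  difference by a bump without zeros in (-n, n) makes it integrable, and the bump is divided out
  afterwards.\<close>

lemma fourier_density_unique:
  assumes g: "has_fourier_density u g" and h: "has_fourier_density u h"
  shows "AE \<xi> in lborel. g \<xi> = h \<xi>"
proof -
  have "AE \<xi> in lborel. \<xi> \<in> {- real n<..<real n} \<longrightarrow> g \<xi> = h \<xi>" for n
  proof -
    let ?b = "bump (- real n) (real n) 1" and ?I = "{- real n<..<real n}"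
    have b: "?b \<in> test_functions UNIV" by (rule bump_test_function) simp
    then have bs: "?b \<in> schwartz" using test_functions_schwartz by blast
    have i: "integrable lborel (\<lambda>\<xi>. g \<xi> * \<phi> \<xi>)" "integrable lborel (\<lambda>\<xi>. h \<xi> * \<phi> \<xi>)"
      and e: "(LINT \<xi>|lborel. g \<xi> * \<phi> \<xi>) = (LINT \<xi>|lborel. h \<xi> * \<phi> \<xi>)" if "\<phi> \<in> schwartz" for \<phi>
      using g h that by (auto simp: has_fourier_density_def)
    have "AE \<xi> in lborel. \<xi> \<in> ?I \<longrightarrow> (g \<xi> - h \<xi>) * ?b \<xi> = 0"
    proof (rule test_functions_zero_imp_AE_zero)
      have "integrable lborel (\<lambda>\<xi>. (g \<xi> - h \<xi>) * ?b \<xi>)"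
        using i[OF bs] by (simp add: left_diff_distrib)
      then show "set_integrable lborel ?I (\<lambda>\<xi>. (g \<xi> - h \<xi>) * ?b \<xi>)"
        unfolding set_integrable_def by (rule integrable_mult_indicator[rotated]) simp
    next
      fix \<phi> assume \<phi>: "\<phi> \<in> test_functions ?I"
      have p: "(\<lambda>x. ?b x * \<phi> x) \<in> schwartz"
        using test_functions_smooth_mult[OF smooth_bump \<phi>] test_functions_schwartz by blast
      have "(LINT x:?I|lborel. (g x - h x) * ?b x * \<phi> x) = (LINT x|lborel. g x * (?b x * \<phi> x) - h x * (?b x * \<phi> x))"
        unfolding set_lebesgue_integral_def
        by (intro Bochner_Integration.integral_cong) (use test_functionsD(2)[OF \<phi>] in \<open>auto simp: indicator_def algebra_simps\<close>)
      also have "\<dots> = 0" using i[OF p] e[OF p] by simp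
      finally show "(LINT x:?I|lborel. (g x - h x) * ?b x * \<phi> x) = 0" .
    qed
    then show ?thesis by eventually_elim (use bump_nonzero in auto)
  qed
  then have "AE \<xi> in lborel. \<forall>n. \<xi> \<in> {- real n<..<real n} \<longrightarrow> g \<xi> = h \<xi>"
    by (rule iffD2[OF AE_all_countable, rule_format])
  then show ?thesis
  proof eventually_elim
    case (elim \<xi>)
    obtain n where "\<bar>\<xi>\<bar> < real n" using reals_Archimedean2 by blast
    then have "\<xi> \<in> {- real n<..<real n}" by (auto simp: abs_less_iff)
    with elim show ?case by blast
  qed
qed

lemma Sobolev_line_carrI: "g \<in> weighted_L2 s \<Longrightarrow> 0 \<le> s \<Longrightarrow> fourier_distr g \<in> carr (Sobolev_line s)"
  using fourier_distr_tempered fourier_distr_density weighted_L2_mono[of g s 0]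
  by (auto simp: Sobolev_line_def weighted_L2_def)

lemma Sobolev_line_carrE:
  assumes "U \<in> carr (Sobolev_line s)" obtains g where "g \<in> weighted_L2 s" "U = fourier_distr g"
  using assms tempered_eq_fourier_distr by (auto simp: Sobolev_line_def weighted_L2_def has_fourier_density_def)

text \<open>The density chosen by SOME agrees with \<open>g\<close> almost everywhere, so any known
  density computes the norm.\<close>

lemma Sobolev_line_nrm:
  assumes "g \<in> weighted_L2 s" "0 \<le> s"
  shows "nrm (Sobolev_line s) (fourier_distr g) = sqrt (weighted_norm2 s g)"
proof -
  have d: "has_fourier_density (fourier_distr g) g" using assms weighted_L2_mono fourier_distr_density by blast
  then have d': "has_fourier_density (fourier_distr g) (fourier_density (fourier_distr g))"
    unfolding fourier_density_def by (rule someI[where P="has_fourier_density (fourier_distr g)"])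
  have [measurable]: "g \<in> borel_measurable borel" "fourier_density (fourier_distr g) \<in> borel_measurable borel"
    using d d' by (auto simp: has_fourier_density_def)
  have "(LINT \<xi>|lborel. (1 + \<xi>\<^sup>2) powr s * (cmod (fourier_density (fourier_distr g) \<xi>))\<^sup>2) = weighted_norm2 s g"
    unfolding weighted_norm2_def
    by (rule integral_cong_AE) (use fourier_density_unique[OF d' d] in auto)
  then show ?thesis by (simp add: Sobolev_line_def)
qed

section \<open>Restriction to a bounded interval\<close>

lemma invfour_integrable: "\<psi> \<in> schwartz \<Longrightarrow> integrable lborel (invfour \<psi>)"
  by (intro schwartz_integrable invfour_schwartz)

lemma fourier_distr_fourier:
  assumes "integrable lborel f" "\<psi> \<in> schwartz"
  shows "fourier_distr (fourier f) \<psi> = (LINT x|lborel. f x * \<psi> x)"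
  using fourier_mult_formula[OF assms(1) invfour_integrable[OF assms(2)]] assms(2)
  by (simp add: fourier_distr_def fourier_invfour)

lemma fourier_weighted_L2:
  assumes "integrable lborel f" "integrable lborel (\<lambda>x. (cmod (f x))\<^sup>2)"
  shows "fourier f \<in> weighted_L2 0" "weighted_norm2 0 (fourier f) \<le> (LINT x|lborel. (cmod (f x))\<^sup>2)"
proof -
  note [measurable] = borel_measurable_integrable[OF assms(1)]
  show "fourier f \<in> weighted_L2 0" "weighted_norm2 0 (fourier f) \<le> (LINT x|lborel. (cmod (f x))\<^sup>2)"
    using plancherel_le[OF assms] by (auto simp: weighted_L2_0 weighted_norm2_0)
qed

text \<open>An integrable density represents the distribution by the function
  \<open>invfour g\<close>. For square-integrable densities a representing function on the interval
  is obtained from this case by truncation, in \<open>L2_representation\<close>.\<close>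

lemma fourier_distr_L1:
  assumes g: "integrable lborel g" and \<psi>: "\<psi> \<in> schwartz"
  shows "fourier_distr g \<psi> = (LINT x|lborel. invfour g x * \<psi> x)"
proof -
  have "fourier_distr g \<psi> = (LINT \<xi>|lborel. g \<xi> * fourier (\<lambda>x. \<psi> (- x)) \<xi>)"
    using \<psi> by (simp add: fourier_distr_def fourier_reflect invfour_def)
  also have "\<dots> = (LINT x|lborel. fourier g x * \<psi> (- x))"
    by (rule fourier_mult_formula[OF g schwartz_integrable[OF schwartz_reflect[OF \<psi>]], symmetric])
  also have "\<dots> = (LINT x|lborel. invfour g x * \<psi> x)"
    by (subst lborel_integral_real_affine[where c="-1" and t=0]) (auto simp: invfour_def)
  finally show ?thesis .
qed

lemma invfour_measurable [measurable]:
  "f \<in> borel_measurable borel \<Longrightarrow> invfour f \<in> borel_measurable borel"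
  unfolding invfour_def[abs_def]
  by (rule measurable_compose[OF borel_measurable_continuous_onI[OF continuous_on_minus[OF continuous_on_id]] fourier_measurable])

lemma integrable_mult_bounded:
  fixes f \<phi> :: "real \<Rightarrow> complex"
  assumes f: "integrable lborel f" and m: "\<phi> \<in> borel_measurable borel" and B: "\<And>x. cmod (\<phi> x) \<le> B"
  shows "integrable lborel (\<lambda>x. f x * \<phi> x)"
proof (rule Bochner_Integration.integrable_bound[OF integrable_mult_right[OF f, of "of_real B"]])
  have "B \<ge> 0" by (rule order.trans[OF norm_ge_zero B])
  then have "cmod (f x * \<phi> x) \<le> cmod (of_real B * f x)" for x
    using mult_left_mono[OF B[of x] norm_ge_zero[of "f x"]] by (simp add: norm_mult mult.commute)
  then show "AE x in lborel. norm (f x * \<phi> x) \<le> norm (of_real B * f x)" by (intro AE_I2)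
qed (use borel_measurable_integrable[OF f] m in auto)

lemma integrable_mult_schwartz:
  assumes "integrable lborel f" "\<phi> \<in> schwartz" shows "integrable lborel (\<lambda>x. f x * \<phi> x)"
proof -
  obtain B where B: "\<And>x. cmod (\<phi> x) \<le> B"
    using bounded_rangeE[OF schwartz_bounded'[OF assms(2)]] by blast
  show ?thesis by (rule integrable_mult_bounded[OF assms(1) schwartz_measurable[OF assms(2)] B])
qed

lemma invfour_plancherel_le:
  assumes g: "integrable lborel g" and g2: "integrable lborel (\<lambda>x. (cmod (g x))\<^sup>2)"
  shows "integrable lborel (\<lambda>x. (cmod (invfour g x))\<^sup>2)"
    and "(LINT x|lborel. (cmod (invfour g x))\<^sup>2) \<le> (LINT x|lborel. (cmod (g x))\<^sup>2)"
proof -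
  show "integrable lborel (\<lambda>x. (cmod (invfour g x))\<^sup>2)"
    using lborel_integrable_real_affine[OF plancherel_le(1)[OF assms], of "-1" 0] by (simp add: invfour_def)
  have "(LINT x|lborel. (cmod (invfour g x))\<^sup>2) = (LINT x|lborel. (cmod (fourier g x))\<^sup>2)"
    by (subst (2) lborel_integral_real_affine[where c="-1" and t=0]) (auto simp: invfour_def)
  then show "(LINT x|lborel. (cmod (invfour g x))\<^sup>2) \<le> (LINT x|lborel. (cmod (g x))\<^sup>2)"
    using plancherel_le(2)[OF assms] by simp
qed

lemma invfour_isCont: "integrable lborel g \<Longrightarrow> isCont (invfour g) x"
  unfolding invfour_def[abs_def]
  by (rule isCont_o2[where g="fourier g" and f=uminus, OF _ fourier_isCont]) auto

lemma invfour_diff: "integrable lborel f \<Longrightarrow> integrable lborel g \<Longrightarrow> invfour (\<lambda>x. f x - g x) x = invfour f x - invfour g x"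
  by (simp add: invfour_def fourier_diff)

text \<open>Zero extension: set integrals over \<Omega> become integrals over the line, and
  functions on \<Omega> are compared through their cuts.\<close>

definition cut :: "real set \<Rightarrow> (real \<Rightarrow> complex) \<Rightarrow> real \<Rightarrow> complex" where
  "cut \<Omega> f x = indicat_real \<Omega> x *\<^sub>R f x"

lemma fun_distr_cut:
  assumes "\<phi> \<in> test_functions \<Omega>" shows "fun_distr \<Omega> f \<phi> = (LINT x|lborel. cut \<Omega> f x * \<phi> x)"
  using assms by (simp add: fun_distr_def set_lebesgue_integral_def cut_def)

lemma restrict_eq_fun_distr:
  assumes "\<And>\<phi>. \<phi> \<in> test_functions \<Omega> \<Longrightarrow> U \<phi> = (LINT x|lborel. f x * \<phi> x)"
  shows "restrict_distr \<Omega> U = fun_distr \<Omega> f"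
proof
  fix \<phi>
  show "restrict_distr \<Omega> U \<phi> = fun_distr \<Omega> f \<phi>"
  proof (cases "\<phi> \<in> test_functions \<Omega>")
    case True
    have "(LINT x|lborel. f x * \<phi> x) = (LINT x|lborel. cut \<Omega> f x * \<phi> x)"
      by (intro Bochner_Integration.integral_cong) (use test_functionsD(2)[OF True] in \<open>auto simp: cut_def indicator_def\<close>)
    then show ?thesis using assms[OF True] True by (simp add: restrict_distr_def fun_distr_cut)
  qed (simp add: restrict_distr_def fun_distr_def)
qed

lemma restrict_fourier_distr_L1: "integrable lborel g \<Longrightarrow> restrict_distr \<Omega> (fourier_distr g) = fun_distr \<Omega> (invfour g)"
  using test_functions_schwartz by (intro restrict_eq_fun_distr fourier_distr_L1) auto

lemma restrict_fourier_distr_fourier: "integrable lborel f \<Longrightarrow> restrict_distr \<Omega> (fourier_distr (fourier f)) = fun_distr \<Omega> f"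
  using test_functions_schwartz by (intro restrict_eq_fun_distr fourier_distr_fourier) auto

lemma L2_functions_cut:
  "f \<in> L2_functions \<Omega> \<longleftrightarrow> cut \<Omega> f \<in> borel_measurable borel \<and> integrable lborel (\<lambda>x. (cmod (cut \<Omega> f x))\<^sup>2)"
proof -
  have "(\<lambda>x. indicat_real \<Omega> x *\<^sub>R (cmod (f x))\<^sup>2) = (\<lambda>x. (cmod (cut \<Omega> f x))\<^sup>2)"
    by (auto simp: fun_eq_iff cut_def indicator_def)
  then show ?thesis
    by (simp add: L2_functions_def set_borel_measurable_def set_integrable_def cut_def[abs_def])
qed

lemma L2_integral_cut: "(LINT x:\<Omega>|lborel. (cmod (f x))\<^sup>2) = (LINT x|lborel. (cmod (cut \<Omega> f x))\<^sup>2)"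
  unfolding set_lebesgue_integral_def
  by (intro Bochner_Integration.integral_cong) (auto simp: cut_def indicator_def)

lemma cut_cut [simp]: "cut \<Omega> (cut \<Omega> f) = cut \<Omega> f"
  by (auto simp: cut_def indicator_def fun_eq_iff)

lemma fun_distr_cut_eq [simp]: "fun_distr \<Omega> (cut \<Omega> f) = fun_distr \<Omega> f"
proof
  fix \<phi> show "fun_distr \<Omega> (cut \<Omega> f) \<phi> = fun_distr \<Omega> f \<phi>"
    by (cases "\<phi> \<in> test_functions \<Omega>") (simp_all add: fun_distr_cut, simp add: fun_distr_def)
qed

lemma fun_distr_cong_cut: "cut \<Omega> f = cut \<Omega> h \<Longrightarrow> fun_distr \<Omega> f = fun_distr \<Omega> h"
  by (metis fun_distr_cut_eq)

text \<open>Cauchy-Schwarz against the indicator of the interval, which has finite measure.\<close>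

lemma L2_cut_integrable:
  assumes f: "f \<in> L2_functions {0<..<a}"
  shows "integrable lborel (cut {0<..<a} f)"
proof -
  let ?\<Omega> = "{0<..<a}"
  have "integrable lborel (\<lambda>x. cut ?\<Omega> f x * of_real (indicat_real ?\<Omega> x))"
  proof (rule square_integrable_mult(1))
    have "(\<lambda>x. (cmod (of_real (indicat_real ?\<Omega> x)))\<^sup>2) = indicat_real ?\<Omega>"
      by (auto simp: fun_eq_iff indicator_def)
    moreover have "emeasure lborel ?\<Omega> < \<infinity>" by (cases "0 \<le> a") auto
    ultimately show "integrable lborel (\<lambda>x. (cmod (of_real (indicat_real ?\<Omega> x)))\<^sup>2)" by simp
  qed (use f in \<open>auto simp: L2_functions_cut\<close>)
  also have "(\<lambda>x. cut ?\<Omega> f x * of_real (indicat_real ?\<Omega> x)) = cut ?\<Omega> f"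
    by (auto simp: fun_eq_iff cut_def indicator_def)
  finally show ?thesis .
qed

lemma fun_distr_unique:
  assumes f: "integrable lborel (cut {0<..<a} f)" and h: "integrable lborel (cut {0<..<a} h)"
    and eq: "fun_distr {0<..<a} f = fun_distr {0<..<a} h"
  shows "AE x in lborel. cut {0<..<a} f x = cut {0<..<a} h x"
proof -
  let ?\<Omega> = "{0<..<a}"
  have "AE x in lborel. x \<in> ?\<Omega> \<longrightarrow> cut ?\<Omega> f x - cut ?\<Omega> h x = 0"
  proof (rule test_functions_zero_imp_AE_zero)
    show "set_integrable lborel ?\<Omega> (\<lambda>x. cut ?\<Omega> f x - cut ?\<Omega> h x)"
      unfolding set_integrable_def by (rule integrable_mult_indicator) (use f h in auto)
  next
    fix \<phi> assume \<phi>: "\<phi> \<in> test_functions ?\<Omega>"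
    have s: "\<phi> \<in> schwartz" using \<phi> test_functions_schwartz by blast
    note i = integrable_mult_schwartz[OF _ s]
    have "(LINT x:?\<Omega>|lborel. (cut ?\<Omega> f x - cut ?\<Omega> h x) * \<phi> x) = (LINT x|lborel. cut ?\<Omega> f x * \<phi> x - cut ?\<Omega> h x * \<phi> x)"
      unfolding set_lebesgue_integral_def
      by (intro Bochner_Integration.integral_cong) (auto simp: cut_def indicator_def algebra_simps)
    also have "\<dots> = fun_distr ?\<Omega> f \<phi> - fun_distr ?\<Omega> h \<phi>"
      using i[OF f] i[OF h] by (simp add: fun_distr_cut[OF \<phi>])
    finally show "(LINT x:?\<Omega>|lborel. (cut ?\<Omega> f x - cut ?\<Omega> h x) * \<phi> x) = 0" using eq by simp
  qed
  then show ?thesis by eventually_elim (auto simp: cut_def indicator_def)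
qed

text \<open>Here too SOME does no harm: representatives of one distribution agree almost everywhere
  on the interval.\<close>

lemma L2_space_nrm:
  assumes f: "f \<in> L2_functions {0<..<a}"
  shows "nrm (L2_space {0<..<a}) (fun_distr {0<..<a} f) = sqrt (LINT x|lborel. (cmod (cut {0<..<a} f x))\<^sup>2)"
proof -
  let ?\<Omega> = "{0<..<a}"
  define h where "h = (SOME h. h \<in> L2_functions ?\<Omega> \<and> fun_distr ?\<Omega> h = fun_distr ?\<Omega> f)"
  have h: "h \<in> L2_functions ?\<Omega> \<and> fun_distr ?\<Omega> h = fun_distr ?\<Omega> f"
    unfolding h_def by (rule someI[of _ f]) (use f in simp)
  have ae: "AE x in lborel. cut ?\<Omega> h x = cut ?\<Omega> f x"
    by (rule fun_distr_unique) (use h f L2_cut_integrable in auto)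
  have "(LINT x|lborel. (cmod (cut ?\<Omega> h x))\<^sup>2) = (LINT x|lborel. (cmod (cut ?\<Omega> f x))\<^sup>2)"
    by (rule integral_cong_AE) (use ae h f in \<open>auto simp: L2_functions_cut\<close>)
  then show ?thesis by (simp add: L2_space_def h_def[symmetric] L2_integral_cut)
qed

text \<open>The order is zero: the L^1 norm of the cut function is a constant that works for every
  compact subset at once.\<close>

lemma fun_distr_distributions:
  assumes f: "integrable lborel (cut \<Omega> f)"
  shows "fun_distr \<Omega> f \<in> distributions \<Omega>"
proof -
  let ?F = "cut \<Omega> f"
  note [measurable] = borel_measurable_integrable[OF f]
  note i = integrable_mult_schwartz[OF f]
  have "linear_functional_on (test_functions \<Omega>) (fun_distr \<Omega> f)"
    unfolding linear_functional_on_def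
  proof (intro conjI ballI allI impI)
    fix \<phi> \<psi> assume \<phi>: "\<phi> \<in> test_functions \<Omega>" and \<psi>: "\<psi> \<in> test_functions \<Omega>"
    then have "integrable lborel (\<lambda>x. ?F x * \<phi> x)" "integrable lborel (\<lambda>x. ?F x * \<psi> x)"
      using i test_functions_schwartz by blast+
    then show "fun_distr \<Omega> f (\<lambda>x. \<phi> x + \<psi> x) = fun_distr \<Omega> f \<phi> + fun_distr \<Omega> f \<psi>"
      using \<phi> \<psi> by (simp add: fun_distr_cut test_functions_add distrib_left)
  next
    fix c \<phi> assume \<phi>: "\<phi> \<in> test_functions \<Omega>"
    then show "fun_distr \<Omega> f (\<lambda>x. c * \<phi> x) = c * fun_distr \<Omega> f \<phi>"
      by (simp add: fun_distr_cut test_functions_cmult mult.left_commute[of _ c])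
  qed (simp add: fun_distr_def)
  moreover have "cmod (fun_distr \<Omega> f \<phi>) \<le> (LINT x|lborel. cmod (?F x)) * (\<Sum>m\<le>0. SUP x. cmod (nth_vderiv m \<phi> x))"
    if \<phi>: "\<phi> \<in> test_functions \<Omega>" for \<phi>
  proof -
    have s: "\<phi> \<in> schwartz" using \<phi> test_functions_schwartz by blast
    obtain B where B: "\<And>x. cmod (\<phi> x) \<le> B"
      using bounded_rangeE[OF schwartz_bounded'[OF s]] by blast
    have le: "cmod (\<phi> x) \<le> (SUP x. cmod (\<phi> x))" for x
      by (rule cSUP_upper[OF UNIV_I bdd_aboveI2[OF B]])
    have "cmod (LINT x|lborel. ?F x * \<phi> x) \<le> (LINT x|lborel. cmod (?F x * \<phi> x))" by simp
    also have "\<dots> \<le> (LINT x|lborel. cmod (?F x) * (SUP x. cmod (\<phi> x)))"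
      by (rule integral_mono) (use integrable_norm[OF i[OF s]] f le in \<open>auto simp: norm_mult intro: mult_left_mono\<close>)
    finally show ?thesis using \<phi> by (simp add: fun_distr_cut)
  qed
  ultimately show ?thesis unfolding distributions_def by blast
qed

text \<open>Restriction contracts L^2 densities into L^2 of the interval. Since \<open>g\<close> may
  fail to be integrable, it is truncated to [-n, n]; the cut inverse transforms \<open>v n\<close>
  form an L^2 Cauchy sequence, and its limit represents the restricted distribution.\<close>

lemma L2_representation:
  assumes g: "g \<in> weighted_L2 0"
  obtains f where "f \<in> L2_functions {0<..<a}" "restrict_distr {0<..<a} (fourier_distr g) = fun_distr {0<..<a} f"
    "(LINT x|lborel. (cmod (cut {0<..<a} f x))\<^sup>2) \<le> weighted_norm2 0 g"
proof -
  let ?\<Omega> = "{0<..<a}"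
  have gm [measurable]: "g \<in> borel_measurable borel" and g2: "integrable lborel (\<lambda>\<xi>. (cmod (g \<xi>))\<^sup>2)"
    using g by (auto simp: weighted_L2_0)
  define G where "G n \<xi> = g \<xi> * of_real (indicat_real {- real n..real n} \<xi>)" for n \<xi>
  have Gm [measurable]: "G n \<in> borel_measurable borel" for n by (simp add: G_def[abs_def])
  have G1: "integrable lborel (G n)" for n
    unfolding G_def
  proof (rule square_integrable_mult(1))
    have "(\<lambda>x. (cmod (of_real (indicat_real {- real n..real n} x)))\<^sup>2) = indicat_real {- real n..real n}"
      by (auto simp: fun_eq_iff indicator_def)
    then show "integrable lborel (\<lambda>x. (cmod (of_real (indicat_real {- real n..real n} x)))\<^sup>2)" by simp
  qed (use g2 in auto)
  define T where "T n = (LINT \<xi>|lborel. (cmod (g \<xi> - G n \<xi>))\<^sup>2)" for n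
  have gG: "cmod (g \<xi> - G n \<xi>) \<le> cmod (g \<xi>)" for n \<xi> by (simp add: G_def indicator_def)
  have dI: "integrable lborel (\<lambda>\<xi>. (cmod (g \<xi> - G n \<xi>))\<^sup>2)" for n
    by (rule Bochner_Integration.integrable_bound[OF g2]) (auto intro!: power_mono gG)
  have T0: "T \<longlonglongrightarrow> 0"
  proof -
    have "(\<lambda>n. LINT \<xi>|lborel. (cmod (g \<xi> - G n \<xi>))\<^sup>2) \<longlonglongrightarrow> (LINT \<xi>|(lborel :: real measure). (0::real))"
    proof (rule integral_dominated_convergence[where w="\<lambda>\<xi>. (cmod (g \<xi>))\<^sup>2"])
      have "(\<lambda>n. (cmod (g \<xi> - G n \<xi>))\<^sup>2) \<longlonglongrightarrow> 0" for \<xi>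
      proof (rule tendsto_eventually)
        obtain N where N: "\<bar>\<xi>\<bar> < real N" using reals_Archimedean2 by blast
        show "\<forall>\<^sub>F n in sequentially. (cmod (g \<xi> - G n \<xi>))\<^sup>2 = 0"
          using eventually_ge_at_top[of N] by eventually_elim (use N in \<open>auto simp: G_def indicator_def\<close>)
      qed
      then show "AE \<xi> in lborel. (\<lambda>n. (cmod (g \<xi> - G n \<xi>))\<^sup>2) \<longlonglongrightarrow> 0" by (intro AE_I2)
      show "AE \<xi> in lborel. norm ((cmod (g \<xi> - G n \<xi>))\<^sup>2) \<le> (cmod (g \<xi>))\<^sup>2" for n
        by (intro AE_I2) (auto intro!: power_mono gG)
    qed (use g2 in auto)
    then show ?thesis by (simp add: T_def[abs_def])
  qed
  \<comment> \<open>From index n on all truncations agree with \<open>g\<close> on [-n, n], so their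
    differences are dominated by the tail g - G n.\<close>
  have GG: "integrable lborel (\<lambda>\<xi>. (cmod (G i \<xi> - G j \<xi>))\<^sup>2)"
      "(LINT \<xi>|lborel. (cmod (G i \<xi> - G j \<xi>))\<^sup>2) \<le> T n" if "n \<le> i" "n \<le> j" for i j n
  proof -
    have le: "(cmod (G i \<xi> - G j \<xi>))\<^sup>2 \<le> (cmod (g \<xi> - G n \<xi>))\<^sup>2" for \<xi>
      using that by (intro power_mono) (auto simp: G_def indicator_def)
    show i: "integrable lborel (\<lambda>\<xi>. (cmod (G i \<xi> - G j \<xi>))\<^sup>2)"
      by (rule Bochner_Integration.integrable_bound[OF dI[of n]]) (use le in auto)
    show "(LINT \<xi>|lborel. (cmod (G i \<xi> - G j \<xi>))\<^sup>2) \<le> T n"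
      unfolding T_def by (rule integral_mono[OF i dI le])
  qed
  define v where "v n = cut ?\<Omega> (invfour (G n))" for n
  have vm [measurable]: "v n \<in> borel_measurable borel" for n by (simp add: v_def cut_def[abs_def])
  have vv: "integrable lborel (\<lambda>x. (cmod (v i x - v j x))\<^sup>2)"
      "(LINT x|lborel. (cmod (v i x - v j x))\<^sup>2) \<le> T n" if "n \<le> i" "n \<le> j" for i j n
  proof -
    have d1: "integrable lborel (\<lambda>\<xi>. G i \<xi> - G j \<xi>)" using G1 by simp
    have le: "(cmod (v i x - v j x))\<^sup>2 \<le> (cmod (invfour (\<lambda>\<xi>. G i \<xi> - G j \<xi>) x))\<^sup>2" for x
      by (simp add: v_def cut_def indicator_def invfour_diff G1)
    note pl = invfour_plancherel_le[OF d1 GG(1)[OF that]]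
    show i: "integrable lborel (\<lambda>x. (cmod (v i x - v j x))\<^sup>2)"
      by (rule Bochner_Integration.integrable_bound[OF pl(1)]) (use le in auto)
    show "(LINT x|lborel. (cmod (v i x - v j x))\<^sup>2) \<le> T n"
      using integral_mono[OF i pl(1) le] pl(2) GG(2)[OF that] by linarith
  qed
  have v2: "integrable lborel (\<lambda>x. (cmod (v n x))\<^sup>2)" "(LINT x|lborel. (cmod (v n x))\<^sup>2) \<le> weighted_norm2 0 g" for n
  proof -
    have le: "(cmod (v n x))\<^sup>2 \<le> (cmod (invfour (G n) x))\<^sup>2" for x by (simp add: v_def cut_def indicator_def)
    have le': "(cmod (G n \<xi>))\<^sup>2 \<le> (cmod (g \<xi>))\<^sup>2" for \<xi> by (simp add: G_def indicator_def)
    have i': "integrable lborel (\<lambda>\<xi>. (cmod (G n \<xi>))\<^sup>2)"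
      by (rule Bochner_Integration.integrable_bound[OF g2]) (use le' in auto)
    note pl = invfour_plancherel_le[OF G1 i']
    show i: "integrable lborel (\<lambda>x. (cmod (v n x))\<^sup>2)"
      by (rule Bochner_Integration.integrable_bound[OF pl(1)]) (use le in auto)
    show "(LINT x|lborel. (cmod (v n x))\<^sup>2) \<le> weighted_norm2 0 g"
      using integral_mono[OF i pl(1) le] pl(2) integral_mono[OF i' g2 le'] unfolding weighted_norm2_0 by linarith
  qed
  have vL2: "v n \<in> L2_functions ?\<Omega>" for n
  proof -
    have "cut ?\<Omega> (v n) = v n" by (simp add: v_def)
    then show ?thesis using v2 by (simp add: L2_functions_cut)
  qed
  have v1: "integrable lborel (v n)" for n
    using L2_cut_integrable[OF vL2[of n]] by (simp add: v_def)
  \<comment> \<open>Square root of the measure of the interval. By Cauchy-Schwarz it turns L^2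
    differences into L^1 differences, from which an almost everywhere convergent subsequence is
    extracted.\<close>
  define K where "K = sqrt (LINT x|lborel. (cmod (of_real (indicat_real ?\<Omega> x)))\<^sup>2)"
  have K_nn: "K \<ge> 0" by (simp add: K_def)
  have L1: "(LINT x|lborel. cmod (v i x - v j x)) \<le> sqrt (T n) * K" if "n \<le> i" "n \<le> j" for i j n
  proof -
    have "(\<lambda>x. (cmod (of_real (indicat_real ?\<Omega> x)))\<^sup>2) = indicat_real ?\<Omega>"
      by (auto simp: fun_eq_iff indicator_def)
    moreover have "emeasure lborel ?\<Omega> < \<infinity>" by (cases "0 \<le> a") auto
    ultimately have "integrable lborel (\<lambda>x. (cmod (of_real (indicat_real ?\<Omega> x)))\<^sup>2)" by simp
    then have "(LINT x|lborel. cmod (v i x - v j x) * cmod (of_real (indicat_real ?\<Omega> x))) \<le> sqrt (LINT x|lborel. (cmod (v i x - v j x))\<^sup>2) * K"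
      unfolding K_def by (intro square_integrable_mult(2) vv(1)[OF that]) auto
    also have "\<dots> \<le> sqrt (T n) * K" by (intro mult_right_mono real_sqrt_le_mono vv(2)[OF that] K_nn)
    also have "(\<lambda>x. cmod (v i x - v j x) * cmod (of_real (indicat_real ?\<Omega> x))) = (\<lambda>x. cmod (v i x - v j x))"
      by (auto simp: fun_eq_iff v_def cut_def indicator_def)
    finally show ?thesis .
  qed
  obtain r where r: "strict_mono r" and cauchy: "AE x in lborel. Cauchy (\<lambda>i. v (r i) x)"
  proof (rule cauchy_L1_AE_cauchy_subseq[of lborel v])
    fix e :: real assume "e > 0"
    have "(\<lambda>n. sqrt (T n) * K) \<longlonglongrightarrow> sqrt 0 * K" by (intro tendsto_intros T0)
    then have "\<forall>\<^sub>F n in sequentially. sqrt (T n) * K < e"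
      using \<open>e > 0\<close> by (intro order_tendstoD(2)) auto
    then obtain N where "sqrt (T N) * K < e" by (auto simp: eventually_sequentially)
    then show "\<exists>N. \<forall>i\<ge>N. \<forall>j\<ge>N. (LINT x|lborel. cmod (v i x - v j x)) < e"
      using L1[of N] le_less_trans by blast
  qed (use v1 in auto)
  define f where "f x = lim (\<lambda>i. v (r i) x)" for x
  have fm [measurable]: "f \<in> borel_measurable borel"
    unfolding f_def by (rule borel_measurable_lim_metric) simp
  have fcut: "cut ?\<Omega> f = f"
  proof
    fix x show "cut ?\<Omega> f x = f x"
    proof (cases "x \<in> ?\<Omega>")
      case False
      then have "(\<lambda>i. v (r i) x) = (\<lambda>_. 0)" by (simp add: v_def cut_def)
      then have "f x = 0" unfolding f_def by (simp add: lim_const)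
      then show ?thesis by (simp add: cut_def)
    qed (simp add: cut_def)
  qed
  have lim: "AE x in lborel. (\<lambda>i. v (r i) x) \<longlonglongrightarrow> f x"
    using cauchy by eventually_elim (simp add: f_def Cauchy_convergent convergent_LIMSEQ_iff[symmetric])
  \<comment> \<open>Fatou along the subsequence with a free comparison function: h = 0 yields the
    norm bound, h = v n the rate \<open>T n\<close>.\<close>
  have fatou: "integrable lborel (\<lambda>x. (cmod (f x - h x))\<^sup>2) \<and> (LINT x|lborel. (cmod (f x - h x))\<^sup>2) \<le> C"
    if [measurable]: "h \<in> borel_measurable borel" and ev: "\<forall>\<^sub>F i in sequentially. integrable lborel (\<lambda>x. (cmod (v (r i) x - h x))\<^sup>2) \<and> (LINT x|lborel. (cmod (v (r i) x - h x))\<^sup>2) \<le> C" for h C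
  proof -
    have "AE x in lborel. ennreal ((cmod (f x - h x))\<^sup>2) = liminf (\<lambda>i. ennreal ((cmod (v (r i) x - h x))\<^sup>2))"
      using lim
    proof eventually_elim
      case (elim x)
      have "(\<lambda>i. ennreal ((cmod (v (r i) x - h x))\<^sup>2)) \<longlonglongrightarrow> ennreal ((cmod (f x - h x))\<^sup>2)"
        by (intro tendsto_ennrealI tendsto_intros elim)
      from lim_imp_Liminf[OF _ this] show ?case by simp
    qed
    then have "(\<integral>\<^sup>+x. ennreal ((cmod (f x - h x))\<^sup>2) \<partial>lborel) = (\<integral>\<^sup>+x. liminf (\<lambda>i. ennreal ((cmod (v (r i) x - h x))\<^sup>2)) \<partial>lborel)"
      by (rule nn_integral_cong_AE)
    also have "\<dots> \<le> liminf (\<lambda>i. \<integral>\<^sup>+x. ennreal ((cmod (v (r i) x - h x))\<^sup>2) \<partial>lborel)"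
      by (rule nn_integral_liminf) simp
    also have "\<dots> \<le> liminf (\<lambda>i. ennreal C)"
    proof (rule Liminf_mono)
      show "\<forall>\<^sub>F i in sequentially. (\<integral>\<^sup>+x. ennreal ((cmod (v (r i) x - h x))\<^sup>2) \<partial>lborel) \<le> ennreal C"
        using ev by eventually_elim (simp add: nn_integral_eq_integral ennreal_leI)
    qed
    finally have le: "(\<integral>\<^sup>+x. ennreal ((cmod (f x - h x))\<^sup>2) \<partial>lborel) \<le> ennreal C"
      by (simp add: Liminf_const)
    have i: "integrable lborel (\<lambda>x. (cmod (f x - h x))\<^sup>2)"
      by (rule integrableI_nonneg) (use le in \<open>auto intro: le_less_trans\<close>)
    have "C \<ge> 0"
    proof -
      obtain i where "(LINT x|lborel. (cmod (v (r i) x - h x))\<^sup>2) \<le> C"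
        using ev by (auto simp: eventually_sequentially)
      moreover have "0 \<le> (LINT x|lborel. (cmod (v (r i) x - h x))\<^sup>2)" by simp
      ultimately show ?thesis by linarith
    qed
    then show ?thesis using i le by (simp add: nn_integral_eq_integral)
  qed
  have f2: "integrable lborel (\<lambda>x. (cmod (f x))\<^sup>2)" "(LINT x|lborel. (cmod (f x))\<^sup>2) \<le> weighted_norm2 0 g"
    using fatou[of "\<lambda>_. 0" "weighted_norm2 0 g"] v2 by auto
  have fv: "integrable lborel (\<lambda>x. (cmod (f x - v n x))\<^sup>2)" "(LINT x|lborel. (cmod (f x - v n x))\<^sup>2) \<le> T n" for n
  proof -
    have "\<forall>\<^sub>F i in sequentially. integrable lborel (\<lambda>x. (cmod (v (r i) x - v n x))\<^sup>2) \<and> (LINT x|lborel. (cmod (v (r i) x - v n x))\<^sup>2) \<le> T n"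
      using eventually_ge_at_top[of n]
    proof eventually_elim
      case (elim i)
      then have "n \<le> r i" using seq_suble[OF r, of i] by linarith
      then show ?case using vv[of n "r i" n] by simp
    qed
    from fatou[OF vm this] show "integrable lborel (\<lambda>x. (cmod (f x - v n x))\<^sup>2)" "(LINT x|lborel. (cmod (f x - v n x))\<^sup>2) \<le> T n"
      by auto
  qed
  have "fourier_distr g \<phi> = (LINT x|lborel. f x * \<phi> x)" if \<phi>: "\<phi> \<in> test_functions ?\<Omega>" for \<phi>
  proof -
    have s: "\<phi> \<in> schwartz" using \<phi> test_functions_schwartz by blast
    note s2 = schwartz_square_integrable[OF s] and [measurable] = schwartz_measurable[OF s]
    define P where "P = sqrt (LINT x|lborel. (cmod (\<phi> x))\<^sup>2)"
    \<comment> \<open>Both g - G n and f - v n have squared norm at most \<open>T n\<close>, so the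
      two errors against the test function add up to at most 2 sqrt(T n) P, which tends to
      0.\<close>
    have "cmod (fourier_distr g \<phi> - (LINT x|lborel. f x * \<phi> x)) \<le> 2 * (sqrt (T n) * P)" for n
    proof -
      have w: "(\<lambda>\<xi>. g \<xi> - G n \<xi>) \<in> weighted_L2 0" using dI by (simp add: weighted_L2_0)
      have Gn: "G n \<in> weighted_L2 0"
        using Bochner_Integration.integrable_bound[OF g2, of "\<lambda>\<xi>. (cmod (G n \<xi>))\<^sup>2"] by (auto simp: weighted_L2_0 G_def indicator_def)
      have a: "fourier_distr (\<lambda>\<xi>. g \<xi> - G n \<xi>) \<phi> = fourier_distr g \<phi> - fourier_distr (G n) \<phi>"
        using s weighted_L2_mult_schwartz[OF g invfour_schwartz[OF s]] weighted_L2_mult_schwartz[OF Gn invfour_schwartz[OF s]]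
        by (simp add: fourier_distr_def left_diff_distrib)
      have b: "fourier_distr (G n) \<phi> = (LINT x|lborel. v n x * \<phi> x)"
        unfolding fourier_distr_L1[OF G1 s] v_def
        by (intro Bochner_Integration.integral_cong) (use test_functionsD(2)[OF \<phi>] in \<open>auto simp: cut_def indicator_def\<close>)
      have c: "(LINT x|lborel. (f x - v n x) * \<phi> x) = (LINT x|lborel. f x * \<phi> x) - (LINT x|lborel. v n x * \<phi> x)"
        using square_integrable_mult(1)[OF _ _ f2(1) s2] square_integrable_mult(1)[OF _ _ v2(1)[of n] s2]
        by (simp add: left_diff_distrib)
      have "cmod (fourier_distr (\<lambda>\<xi>. g \<xi> - G n \<xi>) \<phi>) \<le> sqrt (T n) * P"
        using norm_fourier_distr_le[OF w s] by (simp add: P_def T_def weighted_norm2_0)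
      moreover have "cmod (LINT x|lborel. (f x - v n x) * \<phi> x) \<le> sqrt (T n) * P"
      proof -
        have "cmod (LINT x|lborel. (f x - v n x) * \<phi> x) \<le> sqrt (LINT x|lborel. (cmod (f x - v n x))\<^sup>2) * P"
          unfolding P_def by (rule square_integrable_mult(3)[OF _ _ fv(1) s2]) auto
        also have "\<dots> \<le> sqrt (T n) * P" by (intro mult_right_mono real_sqrt_le_mono fv(2)) (simp add: P_def)
        finally show ?thesis .
      qed
      moreover have "fourier_distr g \<phi> - (LINT x|lborel. f x * \<phi> x) = fourier_distr (\<lambda>\<xi>. g \<xi> - G n \<xi>) \<phi> - (LINT x|lborel. (f x - v n x) * \<phi> x)"
        using a b c by simp
      ultimately show ?thesis using norm_triangle_ineq4[of "fourier_distr (\<lambda>\<xi>. g \<xi> - G n \<xi>) \<phi>" "LINT x|lborel. (f x - v n x) * \<phi> x"] by simp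
    qed
    then have "\<exists>N. \<forall>n\<ge>N. cmod (fourier_distr g \<phi> - (LINT x|lborel. f x * \<phi> x)) \<le> 2 * (sqrt (T n) * P)" by blast
    moreover have "(\<lambda>n. 2 * (sqrt (T n) * P)) \<longlonglongrightarrow> 2 * (sqrt 0 * P)" by (intro tendsto_intros T0)
    ultimately have "cmod (fourier_distr g \<phi> - (LINT x|lborel. f x * \<phi> x)) \<le> 2 * (sqrt 0 * P)"
      by (rule LIMSEQ_le_const[rotated])
    then show ?thesis by simp
  qed
  then have "restrict_distr ?\<Omega> (fourier_distr g) = fun_distr ?\<Omega> f" by (rule restrict_eq_fun_distr)
  moreover have "f \<in> L2_functions ?\<Omega>" using f2 by (simp add: L2_functions_cut fcut)
  ultimately show ?thesis using that[of f] f2 by (simp add: fcut)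
qed

section \<open>Membership and norm bounds in the restricted Sobolev spaces\<close>

lemma Sobolev_carrI:
  assumes "g \<in> weighted_L2 s" "0 \<le> s"
  shows "restrict_distr {0<..<a} (fourier_distr g) \<in> carr (Sobolev {0<..<a} s)"
proof -
  obtain f where "f \<in> L2_functions {0<..<a}" "restrict_distr {0<..<a} (fourier_distr g) = fun_distr {0<..<a} f"
    using L2_representation[of g a] weighted_L2_mono[OF assms] by blast
  then have "restrict_distr {0<..<a} (fourier_distr g) \<in> distributions {0<..<a}"
    using fun_distr_distributions L2_cut_integrable by metis
  then show ?thesis using Sobolev_line_carrI[OF assms] by (auto simp: Sobolev_def)
qed

lemma Sobolev_carrE:
  assumes "u \<in> carr (Sobolev \<Omega> s)"
  obtains g where "g \<in> weighted_L2 s" "u = restrict_distr \<Omega> (fourier_distr g)"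
  using assms Sobolev_line_carrE unfolding Sobolev_def by (smt (verit) mem_Collect_eq select_convs(1))

lemma Sobolev_nrm_le:
  assumes "g \<in> weighted_L2 s" "0 \<le> s"
  shows "nrm (Sobolev \<Omega> s) (restrict_distr \<Omega> (fourier_distr g)) \<le> sqrt (weighted_norm2 s g)"
proof -
  have "Inf {nrm (Sobolev_line s) U | U. U \<in> carr (Sobolev_line s) \<and> restrict_distr \<Omega> U = restrict_distr \<Omega> (fourier_distr g)} \<le> nrm (Sobolev_line s) (fourier_distr g)"
  proof (rule cInf_lower)
    show "bdd_below {nrm (Sobolev_line s) U | U. U \<in> carr (Sobolev_line s) \<and> restrict_distr \<Omega> U = restrict_distr \<Omega> (fourier_distr g)}"
      by (rule bdd_belowI[of _ 0]) (auto simp: Sobolev_line_def)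
  qed (use Sobolev_line_carrI[OF assms] in blast)
  then show ?thesis by (simp add: Sobolev_def Sobolev_line_nrm[OF assms])
qed

text \<open>The norm is an infimum over extensions, so a lower bound has to hold for every density.
  Membership of \<open>u\<close> makes the set nonempty, so that \<open>Inf\<close> is a true
  infimum.\<close>

lemma Sobolev_nrm_ge:
  assumes u: "u \<in> carr (Sobolev \<Omega> s)" and s: "0 \<le> s"
    and "\<And>g. g \<in> weighted_L2 s \<Longrightarrow> u = restrict_distr \<Omega> (fourier_distr g) \<Longrightarrow> L \<le> sqrt (weighted_norm2 s g)"
  shows "L \<le> nrm (Sobolev \<Omega> s) u"
proof -
  have "L \<le> Inf {nrm (Sobolev_line s) U | U. U \<in> carr (Sobolev_line s) \<and> restrict_distr \<Omega> U = u}"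
  proof (rule cInf_greatest)
    show "{nrm (Sobolev_line s) U | U. U \<in> carr (Sobolev_line s) \<and> restrict_distr \<Omega> U = u} \<noteq> {}"
    proof -
      obtain g where "g \<in> weighted_L2 s" "u = restrict_distr \<Omega> (fourier_distr g)" using Sobolev_carrE[OF u] .
      then have "fourier_distr g \<in> carr (Sobolev_line s) \<and> restrict_distr \<Omega> (fourier_distr g) = u"
        using Sobolev_line_carrI[OF _ s] by simp
      then show ?thesis by blast
    qed
  next
    fix x assume "x \<in> {nrm (Sobolev_line s) U | U. U \<in> carr (Sobolev_line s) \<and> restrict_distr \<Omega> U = u}"
    then obtain U where U: "U \<in> carr (Sobolev_line s)" "restrict_distr \<Omega> U = u" "x = nrm (Sobolev_line s) U" by blast
    obtain g where g: "g \<in> weighted_L2 s" "U = fourier_distr g" using Sobolev_line_carrE[OF U(1)] .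
    then show "L \<le> x" using assms(3)[of g] U Sobolev_line_nrm[OF g(1) s] by simp
  qed
  then show ?thesis by (simp add: Sobolev_def)
qed

section \<open>An extension operator for the interval\<close>

lemma weighted_L2_bound:
  assumes [measurable]: "h \<in> borel_measurable borel" and g: "g \<in> weighted_L2 s"
    and le: "\<And>\<xi>. (1 + \<xi>\<^sup>2) powr r * (cmod (h \<xi>))\<^sup>2 \<le> C * ((1 + \<xi>\<^sup>2) powr s * (cmod (g \<xi>))\<^sup>2)"
  shows "h \<in> weighted_L2 r" "weighted_norm2 r h \<le> C * weighted_norm2 s g"
proof -
  have ig: "integrable lborel (\<lambda>\<xi>. C * ((1 + \<xi>\<^sup>2) powr s * (cmod (g \<xi>))\<^sup>2))"
    using g by (simp add: weighted_L2_def)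
  have ih: "integrable lborel (\<lambda>\<xi>. (1 + \<xi>\<^sup>2) powr r * (cmod (h \<xi>))\<^sup>2)"
  proof (rule Bochner_Integration.integrable_bound[OF ig])
    have "norm ((1 + \<xi>\<^sup>2) powr r * (cmod (h \<xi>))\<^sup>2) \<le> norm (C * ((1 + \<xi>\<^sup>2) powr s * (cmod (g \<xi>))\<^sup>2))" for \<xi>
      using le[of \<xi>] zero_le_mult_iff[of "(1 + \<xi>\<^sup>2) powr r" "(cmod (h \<xi>))\<^sup>2"] unfolding real_norm_def by simp
    then show "AE \<xi> in lborel. norm ((1 + \<xi>\<^sup>2) powr r * (cmod (h \<xi>))\<^sup>2) \<le> norm (C * ((1 + \<xi>\<^sup>2) powr s * (cmod (g \<xi>))\<^sup>2))"
      by (intro AE_I2)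
  qed simp
  show "h \<in> weighted_L2 r" using ih by (simp add: weighted_L2_def)
  show "weighted_norm2 r h \<le> C * weighted_norm2 s g"
    unfolding weighted_norm2_def integral_mult_right_zero[symmetric] by (rule integral_mono[OF ih ig le])
qed

lemma norm_add_sq: "(cmod (a + b))\<^sup>2 \<le> 2 * (cmod a)\<^sup>2 + 2 * (cmod b)\<^sup>2"
proof -
  have "(cmod (a + b))\<^sup>2 \<le> (cmod a + cmod b)\<^sup>2" by (intro power_mono norm_triangle_ineq) simp
  also have "\<dots> \<le> 2 * (cmod a)\<^sup>2 + 2 * (cmod b)\<^sup>2"
    using sum_squares_bound[of "cmod a" "cmod b"] by (simp add: power2_sum)
  finally show ?thesis .
qed

lemma weighted_L2_add:
  assumes g: "g \<in> weighted_L2 s" and h: "h \<in> weighted_L2 s"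
  shows "(\<lambda>\<xi>. g \<xi> + h \<xi>) \<in> weighted_L2 s"
    and "weighted_norm2 s (\<lambda>\<xi>. g \<xi> + h \<xi>) \<le> 2 * weighted_norm2 s g + 2 * weighted_norm2 s h"
proof -
  have [measurable]: "g \<in> borel_measurable borel" "h \<in> borel_measurable borel"
    using g h by (auto simp: weighted_L2_def)
  let ?W = "\<lambda>\<xi>::real. (1 + \<xi>\<^sup>2) powr s"
  have ig: "integrable lborel (\<lambda>\<xi>. 2 * (?W \<xi> * (cmod (g \<xi>))\<^sup>2) + 2 * (?W \<xi> * (cmod (h \<xi>))\<^sup>2))"
    using g h by (simp add: weighted_L2_def)
  have le: "?W \<xi> * (cmod (g \<xi> + h \<xi>))\<^sup>2 \<le> 2 * (?W \<xi> * (cmod (g \<xi>))\<^sup>2) + 2 * (?W \<xi> * (cmod (h \<xi>))\<^sup>2)" for \<xi>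
    using mult_left_mono[OF norm_add_sq[of "g \<xi>" "h \<xi>"], of "?W \<xi>"] by (simp add: algebra_simps)
  have ih: "integrable lborel (\<lambda>\<xi>. ?W \<xi> * (cmod (g \<xi> + h \<xi>))\<^sup>2)"
  proof (rule Bochner_Integration.integrable_bound[OF ig])
    show "AE \<xi> in lborel. norm (?W \<xi> * (cmod (g \<xi> + h \<xi>))\<^sup>2) \<le> norm (2 * (?W \<xi> * (cmod (g \<xi>))\<^sup>2) + 2 * (?W \<xi> * (cmod (h \<xi>))\<^sup>2))"
      using le by (intro AE_I2) simp
  qed simp
  show "(\<lambda>\<xi>. g \<xi> + h \<xi>) \<in> weighted_L2 s" using ih by (simp add: weighted_L2_def)
  have "weighted_norm2 s (\<lambda>\<xi>. g \<xi> + h \<xi>) \<le> (LINT \<xi>|lborel. 2 * (?W \<xi> * (cmod (g \<xi>))\<^sup>2) + 2 * (?W \<xi> * (cmod (h \<xi>))\<^sup>2))"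
    unfolding weighted_norm2_def by (rule integral_mono[OF ih ig le])
  also have "\<dots> = 2 * weighted_norm2 s g + 2 * weighted_norm2 s h"
    using g h by (simp add: weighted_L2_def weighted_norm2_def)
  finally show "weighted_norm2 s (\<lambda>\<xi>. g \<xi> + h \<xi>) \<le> 2 * weighted_norm2 s g + 2 * weighted_norm2 s h" .
qed

lemma weighted_L2_cmult:
  assumes g: "g \<in> weighted_L2 s"
  shows "(\<lambda>\<xi>. c * g \<xi>) \<in> weighted_L2 s" "weighted_norm2 s (\<lambda>\<xi>. c * g \<xi>) = (cmod c)\<^sup>2 * weighted_norm2 s g"
proof -
  have [measurable]: "g \<in> borel_measurable borel" using g by (simp add: weighted_L2_def)
  show "(\<lambda>\<xi>. c * g \<xi>) \<in> weighted_L2 s"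
    by (rule weighted_L2_bound(1)[OF _ g, of _ _ "(cmod c)\<^sup>2"]) (auto simp: norm_mult power_mult_distrib)
  show "weighted_norm2 s (\<lambda>\<xi>. c * g \<xi>) = (cmod c)\<^sup>2 * weighted_norm2 s g"
    by (simp add: weighted_norm2_def norm_mult power_mult_distrib mult.left_commute[of _ "(cmod c)\<^sup>2"])
qed

text \<open>The weight at xi is at most the weight at t xi, and the substitution contributes 1/|t|
  <= 1. The reflected terms use t = -1 and t = -2.\<close>

lemma weighted_L2_scale:
  assumes g: "g \<in> weighted_L2 s" and s: "0 \<le> s" and t: "1 \<le> \<bar>t\<bar>"
  shows "(\<lambda>\<xi>. g (t * \<xi>)) \<in> weighted_L2 s" "weighted_norm2 s (\<lambda>\<xi>. g (t * \<xi>)) \<le> weighted_norm2 s g"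
proof -
  have [measurable]: "g \<in> borel_measurable borel" using g by (simp add: weighted_L2_def)
  have t0: "t \<noteq> 0" using t by auto
  let ?h = "\<lambda>\<xi>. (1 + \<xi>\<^sup>2) powr s * (cmod (g \<xi>))\<^sup>2"
  have ig: "integrable lborel (\<lambda>\<xi>. ?h (t * \<xi>))"
    using lborel_integrable_real_affine[OF _ t0, of ?h 0] g by (simp add: weighted_L2_def)
  have le: "(1 + \<xi>\<^sup>2) powr s * (cmod (g (t * \<xi>)))\<^sup>2 \<le> ?h (t * \<xi>)" for \<xi>
  proof (intro mult_right_mono powr_mono2 s)
    have "1 * \<xi>\<^sup>2 \<le> t\<^sup>2 * \<xi>\<^sup>2" using t by (intro mult_right_mono) (auto simp: abs_le_square_iff[of 1 t, simplified])
    then show "1 + \<xi>\<^sup>2 \<le> 1 + (t * \<xi>)\<^sup>2" by (simp add: power_mult_distrib)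
  qed auto
  have ih: "integrable lborel (\<lambda>\<xi>. (1 + \<xi>\<^sup>2) powr s * (cmod (g (t * \<xi>)))\<^sup>2)"
  proof (rule Bochner_Integration.integrable_bound[OF ig])
    show "AE \<xi> in lborel. norm ((1 + \<xi>\<^sup>2) powr s * (cmod (g (t * \<xi>)))\<^sup>2) \<le> norm (?h (t * \<xi>))"
      using le by (intro AE_I2) simp
  qed simp
  show "(\<lambda>\<xi>. g (t * \<xi>)) \<in> weighted_L2 s" using ih by (simp add: weighted_L2_def)
  have nn: "(LINT \<xi>|lborel. ?h (t * \<xi>)) \<ge> 0" by (intro Bochner_Integration.integral_nonneg) simp
  have "weighted_norm2 s (\<lambda>\<xi>. g (t * \<xi>)) \<le> (LINT \<xi>|lborel. ?h (t * \<xi>))"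
    unfolding weighted_norm2_def by (rule integral_mono[OF ih ig le])
  also have "\<dots> \<le> \<bar>t\<bar> * (LINT \<xi>|lborel. ?h (t * \<xi>))"
    using mult_right_mono[OF t nn] by simp
  also have "\<dots> = weighted_norm2 s g"
    unfolding weighted_norm2_def by (subst lborel_integral_real_affine[OF t0, of ?h 0]) simp
  finally show "weighted_norm2 s (\<lambda>\<xi>. g (t * \<xi>)) \<le> weighted_norm2 s g" .
qed

text \<open>For c = -a this is the Fourier side of the flip x -> a - x: a reflection times a
  unimodular factor.\<close>

lemma weighted_L2_cis:
  assumes g: "g \<in> weighted_L2 s"
  shows "(\<lambda>\<xi>. cis (c * \<xi>) * g (- \<xi>)) \<in> weighted_L2 s" "weighted_norm2 s (\<lambda>\<xi>. cis (c * \<xi>) * g (- \<xi>)) = weighted_norm2 s g"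
proof -
  have [measurable]: "g \<in> borel_measurable borel" using g by (simp add: weighted_L2_def)
  have "integrable lborel (\<lambda>\<xi>. (1 + \<xi>\<^sup>2) powr s * (cmod (g (- \<xi>)))\<^sup>2)"
    using lborel_integrable_real_affine[of "\<lambda>\<xi>. (1 + \<xi>\<^sup>2) powr s * (cmod (g \<xi>))\<^sup>2" "-1" 0] g
    by (simp add: weighted_L2_def)
  then show "(\<lambda>\<xi>. cis (c * \<xi>) * g (- \<xi>)) \<in> weighted_L2 s"
    by (simp add: weighted_L2_def norm_mult)
  show "weighted_norm2 s (\<lambda>\<xi>. cis (c * \<xi>) * g (- \<xi>)) = weighted_norm2 s g"
    unfolding weighted_norm2_def
    by (subst (2) lborel_integral_real_affine[where c="-1" and t=0]) (simp_all add: norm_mult)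
qed

text \<open>Carries a uniform norm bound from truncated densities to their pointwise limit.\<close>

lemma weighted_L2_fatou:
  assumes D: "\<And>n::nat. D n \<in> weighted_L2 s" "\<And>n. weighted_norm2 s (D n) \<le> C"
    and lim: "\<And>\<xi>. (\<lambda>n. D n \<xi>) \<longlonglongrightarrow> E \<xi>"
  shows "E \<in> weighted_L2 s" "weighted_norm2 s E \<le> C"
proof -
  have [measurable]: "D n \<in> borel_measurable borel" for n using D(1) by (simp add: weighted_L2_def)
  have [measurable]: "E \<in> borel_measurable borel"
    by (rule borel_measurable_LIMSEQ_metric[OF _ lim]) simp
  let ?h = "\<lambda>g \<xi>. (1 + \<xi>\<^sup>2) powr s * (cmod (g \<xi>))\<^sup>2"
  have "C \<ge> 0" by (rule order.trans[OF weighted_norm2_nonneg D(2)[of 0]])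
  have "(\<integral>\<^sup>+\<xi>. ennreal (?h E \<xi>) \<partial>lborel) = (\<integral>\<^sup>+\<xi>. liminf (\<lambda>n. ennreal (?h (D n) \<xi>)) \<partial>lborel)"
    by (intro nn_integral_cong lim_imp_Liminf[symmetric] tendsto_ennrealI tendsto_intros lim) simp
  also have "\<dots> \<le> liminf (\<lambda>n. \<integral>\<^sup>+\<xi>. ennreal (?h (D n) \<xi>) \<partial>lborel)"
    by (rule nn_integral_liminf) simp
  also have "\<dots> \<le> liminf (\<lambda>n. ennreal C)"
  proof (intro Liminf_mono always_eventually allI)
    fix n
    have "(\<integral>\<^sup>+\<xi>. ennreal (?h (D n) \<xi>) \<partial>lborel) = ennreal (weighted_norm2 s (D n))"
      unfolding weighted_norm2_def by (rule nn_integral_eq_integral) (use D(1)[of n] in \<open>auto simp: weighted_L2_def\<close>)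
    then show "(\<integral>\<^sup>+\<xi>. ennreal (?h (D n) \<xi>) \<partial>lborel) \<le> ennreal C" using D(2)[of n] by (simp add: ennreal_leI)
  qed
  finally have le: "(\<integral>\<^sup>+\<xi>. ennreal (?h E \<xi>) \<partial>lborel) \<le> ennreal C" by (simp add: Liminf_const)
  have i: "integrable lborel (?h E)"
    by (rule integrableI_nonneg) (use le in \<open>auto intro: le_less_trans\<close>)
  then show "E \<in> weighted_L2 s" by (simp add: weighted_L2_def)
  show "weighted_norm2 s E \<le> C"
    using le nn_integral_eq_integral[OF i] \<open>C \<ge> 0\<close> by (simp add: weighted_norm2_def)
qed

text \<open>Cauchy-Schwarz with the factor (1+xi^2)^(-1/2); this is the one-dimensional Sobolev
  embedding. Elements of H^1 get the continuous representative \<open>invfour g\<close> and hence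
  point values.\<close>

lemma weighted_L2_integrable: assumes g: "g \<in> weighted_L2 1" shows "integrable lborel g"
proof -
  have [measurable]: "g \<in> borel_measurable borel" using g by (simp add: weighted_L2_def)
  let ?q = "\<lambda>\<xi>::real. sqrt (1 + \<xi>\<^sup>2)"
  have q: "?q \<xi> > 0" "(?q \<xi>)\<^sup>2 = 1 + \<xi>\<^sup>2" for \<xi> by (simp_all add: add_pos_nonneg)
  have "integrable lborel (\<lambda>\<xi>. (of_real (?q \<xi>) * g \<xi>) * of_real (1 / ?q \<xi>))"
  proof (rule square_integrable_mult(1))
    show "integrable lborel (\<lambda>\<xi>. (cmod (of_real (?q \<xi>) * g \<xi>))\<^sup>2)"
      using g by (simp add: weighted_L2_def norm_mult power_mult_distrib)
    show "integrable lborel (\<lambda>\<xi>. (cmod (of_real (1 / ?q \<xi>)))\<^sup>2)"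
      using integrable_inverse_1_plus_square by (simp add: power_divide norm_divide)
  qed auto
  also have "(\<lambda>\<xi>. (of_real (?q \<xi>) * g \<xi>) * of_real (1 / ?q \<xi>)) = g"
    using q(1) by (auto simp: fun_eq_iff field_simps less_imp_neq[symmetric])
  finally show ?thesis .
qed

text \<open>A cutoff with $\<rho>(x) + \<rho>(a-x) = 1$ and $\<rho>(a) = \<rho>'(a) = 0$, so that each endpoint can be treated alone.\<close>

definition rho :: "real \<Rightarrow> real \<Rightarrow> real" where "rho a x = (1 - x / a)\<^sup>2 * (1 + 2 * x / a)"
definition rho' :: "real \<Rightarrow> real \<Rightarrow> real" where "rho' a x = - 6 * (x / a) * (1 - x / a) / a"
definition rho'' :: "real \<Rightarrow> real \<Rightarrow> real" where "rho'' a x = (12 * (x / a) - 6) / a\<^sup>2"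

lemma rho_derivs:
  assumes "a > 0"
  shows "(rho a has_real_derivative rho' a x) (at x)" "(rho' a has_real_derivative rho'' a x) (at x)"
  using assms unfolding rho_def[abs_def] rho'_def[abs_def] rho''_def
  by (auto intro!: derivative_eq_intros simp: field_simps power2_eq_square)

lemma rho_sum: assumes "a > 0" shows "rho a x + rho a (a - x) = 1"
proof -
  have "(a - x) / a = 1 - x / a" using assms by (simp add: diff_divide_distrib)
  moreover have "(1 - y)\<^sup>2 * (1 + 2 * y) + (1 - (1 - y))\<^sup>2 * (1 + 2 * (1 - y)) = 1" for y :: real
    by (simp add: power2_eq_square algebra_simps)
  ultimately show ?thesis by (metis rho_def times_divide_eq_right)
qed

lemma rho_bounds:
  assumes "a > 0" "x \<in> {0<..<a}"
  shows "\<bar>rho a x\<bar> \<le> 1" "\<bar>rho' a x\<bar> \<le> 6 / a" "\<bar>rho'' a x\<bar> \<le> 6 / a\<^sup>2"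
proof -
  have y: "0 < x / a" "x / a < 1" using assms by auto
  have nn: "rho a z \<ge> 0" if "z \<in> {0<..<a}" for z
    unfolding rho_def using that assms(1) by (intro mult_nonneg_nonneg) auto
  have "rho a x \<ge> 0" "rho a (a - x) \<ge> 0" using assms by (auto intro!: nn)
  then show "\<bar>rho a x\<bar> \<le> 1" using rho_sum[OF assms(1), of x] by linarith
  have "\<bar>- 6 * t * (1 - t)\<bar> \<le> 6" if "0 < t" "t < 1" for t :: real
  proof -
    have "t * (1 - t) \<le> 1" "0 \<le> t * (1 - t)" using that by (auto intro!: mult_le_one)
    then show ?thesis by simp
  qed
  from divide_right_mono[OF this[OF y], of a] show "\<bar>rho' a x\<bar> \<le> 6 / a"
    using assms(1) unfolding rho'_def abs_divide by simp
  have "\<bar>12 * (x / a) - 6\<bar> \<le> 6" using y by (simp add: abs_le_iff)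
  then show "\<bar>rho'' a x\<bar> \<le> 6 / a\<^sup>2"
    using assms(1) by (simp add: rho''_def divide_right_mono)
qed

lemma rho_end: "a > 0 \<Longrightarrow> rho a a = 0" "a > 0 \<Longrightarrow> rho' a a = 0"
  by (simp_all add: rho_def rho'_def)

definition tapered :: "real \<Rightarrow> (real \<Rightarrow> complex) \<Rightarrow> real \<Rightarrow> complex" where
  "tapered a f = cut {0<..<a} (\<lambda>x. of_real (rho a x) * f x)"

text \<open>The coefficients make value and first derivative agree at 0: $1 = -3 + 4$ and $1 = 3 - 4/2$.\<close>

definition refl_ext :: "(real \<Rightarrow> complex) \<Rightarrow> real \<Rightarrow> complex" where
  "refl_ext w x = w x - 3 * w (- x) + 4 * w (- x / 2)"

text \<open>The two summands treat the ends 0 and a; the second is of the same kind after the flip x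
  -> a - x. The reflected parts live beyond the respective endpoint, so on the interval only the two
  cutoffs remain, and they sum to 1.\<close>

definition ext :: "real \<Rightarrow> (real \<Rightarrow> complex) \<Rightarrow> real \<Rightarrow> complex" where
  "ext a f x = refl_ext (tapered a f) x + refl_ext (tapered a (\<lambda>y. f (a - y))) (a - x)"

lemma rho_measurable [measurable]: "rho a \<in> borel_measurable borel"
  unfolding rho_def[abs_def] by measurable

lemma tapered_cut: "tapered a f x = of_real (rho a x) * cut {0<..<a} f x"
  by (simp add: tapered_def cut_def)

lemma norm_tapered_le: assumes "a > 0" shows "cmod (tapered a f x) \<le> cmod (cut {0<..<a} f x)"
proof (cases "x \<in> {0<..<a}")
  case True
  then show ?thesis using rho_bounds(1)[OF assms True] by (simp add: tapered_cut norm_mult mult_left_le_one_le)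
qed (simp add: tapered_cut cut_def)

lemma tapered_L2:
  assumes a: "a > 0" and f: "f \<in> L2_functions {0<..<a}"
  shows "integrable lborel (tapered a f)" "integrable lborel (\<lambda>x. (cmod (tapered a f x))\<^sup>2)"
    "(LINT x|lborel. (cmod (tapered a f x))\<^sup>2) \<le> (LINT x|lborel. (cmod (cut {0<..<a} f x))\<^sup>2)"
proof -
  have [measurable]: "cut {0<..<a} f \<in> borel_measurable borel" and f2: "integrable lborel (\<lambda>x. (cmod (cut {0<..<a} f x))\<^sup>2)"
    using f by (auto simp: L2_functions_cut)
  have [measurable]: "tapered a f \<in> borel_measurable borel" unfolding tapered_cut[abs_def] by measurable
  have le: "(cmod (tapered a f x))\<^sup>2 \<le> (cmod (cut {0<..<a} f x))\<^sup>2" for x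
    by (intro power_mono norm_tapered_le a) simp
  show "integrable lborel (tapered a f)"
    by (rule Bochner_Integration.integrable_bound[OF L2_cut_integrable[OF f]]) (use norm_tapered_le[OF a] in auto)
  show i: "integrable lborel (\<lambda>x. (cmod (tapered a f x))\<^sup>2)"
    by (rule Bochner_Integration.integrable_bound[OF f2]) (use le in auto)
  show "(LINT x|lborel. (cmod (tapered a f x))\<^sup>2) \<le> (LINT x|lborel. (cmod (cut {0<..<a} f x))\<^sup>2)"
    by (rule integral_mono[OF i f2 le])
qed

lemma integrable_scaled:
  fixes w :: "real \<Rightarrow> complex"
  assumes "integrable lborel w"
  shows "integrable lborel (\<lambda>x. w (- x))" "integrable lborel (\<lambda>x. w (- x / 2))" "integrable lborel (\<lambda>x. w (a - x))"
  using lborel_integrable_real_affine[OF assms, of "-1" 0] lborel_integrable_real_affine[OF assms, of "-1/2" 0]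
    lborel_integrable_real_affine[OF assms, of "-1" a] by simp_all

lemma refl_ext_integrable: "integrable lborel w \<Longrightarrow> integrable lborel (refl_ext w)"
  unfolding refl_ext_def[abs_def] using integrable_scaled[of w] by simp

lemma fourier_half: "fourier (\<lambda>x. w (- x / 2)) \<xi> = 2 * fourier w (- 2 * \<xi>)"
  unfolding fourier_cis
  by (subst lborel_integral_real_affine[where c="-2" and t=0]) (auto simp: scaleR_conv_of_real mult_ac)

lemma fourier_shift: "fourier (\<lambda>x. w (a - x)) \<xi> = cis (- (a * \<xi>)) * fourier w (- \<xi>)"
proof -
  have "(LINT x|lborel. cis (- (\<xi> * x)) * w (a - x)) = (LINT x|lborel. cis (- (\<xi> * (a - x))) * w x)"
    by (subst lborel_integral_real_affine[where c="-1" and t=a]) auto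
  also have "(\<lambda>x. cis (- (\<xi> * (a - x))) * w x) = (\<lambda>x. cis (- (a * \<xi>)) * (cis (- (- \<xi> * x)) * w x))"
    by (simp add: fun_eq_iff mult.assoc[symmetric] cis_mult) (simp add: algebra_simps)
  also have "(LINT x|lborel. cis (- (a * \<xi>)) * (cis (- (- \<xi> * x)) * w x)) = cis (- (a * \<xi>)) * (LINT x|lborel. cis (- (- \<xi> * x)) * w x)"
    by (rule integral_mult_right_zero)
  finally show ?thesis unfolding fourier_cis by (simp only: mult.left_commute)
qed

text \<open>The coefficient 8 is 4 times the Jacobian 2 of the dilation x -> -x/2.\<close>

lemma fourier_refl_ext:
  assumes w: "integrable lborel w"
  shows "fourier (refl_ext w) \<xi> = fourier w \<xi> - 3 * fourier w (- \<xi>) + 8 * fourier w (- 2 * \<xi>)"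
proof -
  note i = integrable_scaled[OF w]
  have "fourier (refl_ext w) \<xi> = fourier (\<lambda>x. w x - 3 * w (- x)) \<xi> + fourier (\<lambda>x. 4 * w (- x / 2)) \<xi>"
    unfolding refl_ext_def[abs_def] by (rule fourier_add) (use w i in auto)
  also have "fourier (\<lambda>x. w x - 3 * w (- x)) \<xi> = fourier w \<xi> - fourier (\<lambda>x. 3 * w (- x)) \<xi>"
    by (rule fourier_diff) (use w i in auto)
  finally show ?thesis by (simp add: fourier_cmult fourier_reflect fourier_half[simplified])
qed

lemma fourier_ext:
  assumes "integrable lborel (tapered a f)" "integrable lborel (tapered a (\<lambda>y. f (a - y)))"
  shows "fourier (ext a f) \<xi> = fourier (refl_ext (tapered a f)) \<xi> + cis (- a * \<xi>) * fourier (refl_ext (tapered a (\<lambda>y. f (a - y)))) (- \<xi>)"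
proof -
  have "fourier (ext a f) \<xi> = fourier (refl_ext (tapered a f)) \<xi> + fourier (\<lambda>x. refl_ext (tapered a (\<lambda>y. f (a - y))) (a - x)) \<xi>"
    unfolding ext_def[abs_def] by (rule fourier_add) (use assms refl_ext_integrable integrable_scaled(3) in auto)
  then show ?thesis by (simp add: fourier_shift)
qed

lemma cut_flip: "cut {0<..<a} (\<lambda>y. f (a - y)) x = cut {0<..<a} f (a - x)"
  by (auto simp: cut_def indicator_def)

lemma L2_functions_flip:
  assumes f: "f \<in> L2_functions {0<..<a}"
  shows "(\<lambda>y. f (a - y)) \<in> L2_functions {0<..<a}"
    "(LINT x|lborel. (cmod (cut {0<..<a} (\<lambda>y. f (a - y)) x))\<^sup>2) = (LINT x|lborel. (cmod (cut {0<..<a} f x))\<^sup>2)"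
proof -
  have [measurable]: "cut {0<..<a} f \<in> borel_measurable borel" and f2: "integrable lborel (\<lambda>x. (cmod (cut {0<..<a} f x))\<^sup>2)"
    using f by (auto simp: L2_functions_cut)
  have "integrable lborel (\<lambda>x. (cmod (cut {0<..<a} f (a - x)))\<^sup>2)"
    using lborel_integrable_real_affine[OF f2, of "-1" a] by simp
  then show "(\<lambda>y. f (a - y)) \<in> L2_functions {0<..<a}"
    by (simp add: L2_functions_cut cut_flip[abs_def])
  show "(LINT x|lborel. (cmod (cut {0<..<a} (\<lambda>y. f (a - y)) x))\<^sup>2) = (LINT x|lborel. (cmod (cut {0<..<a} f x))\<^sup>2)"
    unfolding cut_flip by (subst (2) lborel_integral_real_affine[where c="-1" and t=a]) auto
qed

lemma ext_integrable: assumes "a > 0" "f \<in> L2_functions {0<..<a}" shows "integrable lborel (ext a f)"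
  unfolding ext_def[abs_def]
  using refl_ext_integrable[OF tapered_L2(1)[OF assms]] integrable_scaled(3)[OF refl_ext_integrable[OF tapered_L2(1)[OF assms(1) L2_functions_flip(1)[OF assms(2)]]]]
  by simp

lemma ext_restrict:
  assumes a: "a > 0" shows "cut {0<..<a} (ext a f) = cut {0<..<a} f"
proof
  fix x show "cut {0<..<a} (ext a f) x = cut {0<..<a} f x"
  proof (cases "x \<in> {0<..<a}")
    case True
    have 1: "refl_ext (tapered a h) y = of_real (rho a y) * h y" if "y \<in> {0<..<a}" for y h
      using that by (simp add: refl_ext_def tapered_def cut_def)
    have "a - x \<in> {0<..<a}" using True by auto
    then have "ext a f x = of_real (rho a x + rho a (a - x)) * f x"
      using 1[OF True, of f] 1[of "a - x" "\<lambda>y. f (a - y)"] by (simp add: ext_def distrib_right)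
    then show ?thesis using rho_sum[OF a, of x] by (simp add: cut_def)
  qed (simp add: cut_def)
qed

text \<open>The factor \<open>c\<close> is left free: it is 8 for the function itself and 2 for its
  second derivative. The number 40 is 2 (2 + 2 times 9), from using |x+y|^2 <= 2|x|^2 + 2|y|^2
  twice.\<close>

lemma refl_comb:
  assumes F: "F \<in> weighted_L2 0"
  shows "(\<lambda>\<xi>. F \<xi> - 3 * F (- \<xi>) + c * F (- 2 * \<xi>)) \<in> weighted_L2 0"
    "weighted_norm2 0 (\<lambda>\<xi>. F \<xi> - 3 * F (- \<xi>) + c * F (- 2 * \<xi>)) \<le> (40 + 2 * (cmod c)\<^sup>2) * weighted_norm2 0 F"
proof -
  let ?A = "\<lambda>\<xi>. (-3) * F (- \<xi>)" and ?B = "\<lambda>\<xi>. c * F (-2 * \<xi>)"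
  have A: "(\<lambda>\<xi>. F (- \<xi>)) \<in> weighted_L2 0" "weighted_norm2 0 (\<lambda>\<xi>. F (- \<xi>)) \<le> weighted_norm2 0 F"
    using weighted_L2_scale[OF F, of "-1"] by auto
  have B: "(\<lambda>\<xi>. F (-2 * \<xi>)) \<in> weighted_L2 0" "weighted_norm2 0 (\<lambda>\<xi>. F (-2 * \<xi>)) \<le> weighted_norm2 0 F"
    using weighted_L2_scale[OF F, of "-2"] by auto
  note A' = weighted_L2_cmult[OF A(1), of "-3"] and B' = weighted_L2_cmult[OF B(1), of c]
  note 1 = weighted_L2_add[OF F A'(1)]
  note 2 = weighted_L2_add[OF 1(1) B'(1)]
  have eq: "(\<lambda>\<xi>. F \<xi> - 3 * F (- \<xi>) + c * F (- 2 * \<xi>)) = (\<lambda>\<xi>. F \<xi> + (-3) * F (- \<xi>) + c * F (-2 * \<xi>))" by simp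
  show "(\<lambda>\<xi>. F \<xi> - 3 * F (- \<xi>) + c * F (- 2 * \<xi>)) \<in> weighted_L2 0" unfolding eq by (rule 2)
  have "weighted_norm2 0 (\<lambda>\<xi>. F \<xi> + (-3) * F (- \<xi>) + c * F (-2 * \<xi>)) \<le> 2 * (2 * weighted_norm2 0 F + 2 * (9 * weighted_norm2 0 F)) + 2 * ((cmod c)\<^sup>2 * weighted_norm2 0 F)"
    using 1(2) 2(2) A'(2) B'(2) A(2) mult_left_mono[OF B(2), of "(cmod c)\<^sup>2"] by simp
  then show "weighted_norm2 0 (\<lambda>\<xi>. F \<xi> - 3 * F (- \<xi>) + c * F (- 2 * \<xi>)) \<le> (40 + 2 * (cmod c)\<^sup>2) * weighted_norm2 0 F"
    unfolding eq by (simp add: algebra_simps)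
qed

lemma fourier_refl_ext_L2:
  assumes "integrable lborel w" "integrable lborel (\<lambda>x. (cmod (w x))\<^sup>2)"
  shows "fourier (refl_ext w) \<in> weighted_L2 0" "weighted_norm2 0 (fourier (refl_ext w)) \<le> 168 * (LINT x|lborel. (cmod (w x))\<^sup>2)"
proof -
  note F = fourier_weighted_L2[OF assms]
  have eq: "fourier (refl_ext w) = (\<lambda>\<xi>. fourier w \<xi> - 3 * fourier w (- \<xi>) + 8 * fourier w (- 2 * \<xi>))"
    using fourier_refl_ext[OF assms(1)] by (simp add: fun_eq_iff)
  show "fourier (refl_ext w) \<in> weighted_L2 0" unfolding eq by (rule refl_comb(1)[OF F(1)])
  show "weighted_norm2 0 (fourier (refl_ext w)) \<le> 168 * (LINT x|lborel. (cmod (w x))\<^sup>2)"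
    unfolding eq using refl_comb(2)[OF F(1), of 8] F(2) by simp
qed

text \<open>Each end contributes 168 = 40 + 2 times 64, and adding two ends doubles both
  contributions: 672 = 4 times 168.\<close>

lemma fourier_ext_L2:
  assumes a: "a > 0" and f: "f \<in> L2_functions {0<..<a}"
  shows "fourier (ext a f) \<in> weighted_L2 0"
    "weighted_norm2 0 (fourier (ext a f)) \<le> 672 * (LINT x|lborel. (cmod (cut {0<..<a} f x))\<^sup>2)"
proof -
  note f' = L2_functions_flip[OF f]
  note l1 = tapered_L2[OF a f] and l2 = tapered_L2[OF a f'(1)]
  note e1 = fourier_refl_ext_L2[OF l1(1,2)] and e2 = fourier_refl_ext_L2[OF l2(1,2)]
  note e3 = weighted_L2_cis[OF e2(1), of "- a"]
  note s = weighted_L2_add[OF e1(1) e3(1)]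
  have eq: "fourier (ext a f) = (\<lambda>\<xi>. fourier (refl_ext (tapered a f)) \<xi> + cis (- a * \<xi>) * fourier (refl_ext (tapered a (\<lambda>y. f (a - y)))) (- \<xi>))"
    using fourier_ext[OF l1(1) l2(1)] by (simp add: fun_eq_iff)
  show "fourier (ext a f) \<in> weighted_L2 0" unfolding eq by (rule s(1))
  show "weighted_norm2 0 (fourier (ext a f)) \<le> 672 * (LINT x|lborel. (cmod (cut {0<..<a} f x))\<^sup>2)"
    unfolding eq using s(2) e1(2) e2(2) e3(2) l1(3) l2(3) f'(2) by linarith
qed

section \<open>Boundary terms and the extension in H^2\<close>

lemma integral_cut_FTC:
  fixes F F' :: "real \<Rightarrow> complex"
  assumes "a > 0" "\<And>x. (F has_vector_derivative F' x) (at x)" "\<And>x. isCont F' x"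
  shows "(LINT x|lborel. cut {0<..<a} F' x) = F a - F 0"
proof -
  have "(LINT x|lborel. cut {0<..<a} F' x) = (LINT x|lborel. indicat_real {0..a} x *\<^sub>R F' x)"
  proof (rule integral_cong_AE)
    have [measurable]: "F' \<in> borel_measurable borel"
      using assms(3) by (intro borel_measurable_continuous_onI continuous_at_imp_continuous_on) auto
    show "cut {0<..<a} F' \<in> borel_measurable lborel" by (simp add: cut_def[abs_def])
    show "(\<lambda>x. indicat_real {0..a} x *\<^sub>R F' x) \<in> borel_measurable lborel" by simp
    show "AE x in lborel. cut {0<..<a} F' x = indicat_real {0..a} x *\<^sub>R F' x"
      using AE_lborel_singleton[of 0] AE_lborel_singleton[of a]
      by eventually_elim (auto simp: cut_def indicator_def)
  qed
  also have "\<dots> = F a - F 0"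
  proof (rule integral_FTC_Icc)
    show "(F has_vector_derivative F' x) (at x within {0..a})" for x
      using assms(2) by (rule has_vector_derivative_at_within)
    show "continuous_on {0..a} F'" using assms(3) by (intro continuous_at_imp_continuous_on) auto
  qed (use assms(1) in simp)
  finally show ?thesis .
qed

lemma cut_continuous_L2:
  assumes "continuous_on {0..a} h"
  shows "h \<in> L2_functions {0<..<a}"
proof -
  obtain B where "\<forall>y\<in>h ` {0..a}. cmod y \<le> B"
    using compact_imp_bounded[OF compact_continuous_image[OF assms compact_Icc]] unfolding bounded_iff by blast
  then have B: "cmod (h x) \<le> B" if "x \<in> {0..a}" for x using that by blast
  have "set_borel_measurable borel {0<..<a} h"
    by (rule borel_measurable_continuous_on_indicator[folded set_borel_measurable_def, OF _ continuous_on_subset[OF assms]]) auto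
  then have m[measurable]: "cut {0<..<a} h \<in> borel_measurable borel"
    by (simp add: set_borel_measurable_def cut_def[abs_def])
  have "integrable lborel (\<lambda>x. (cmod (cut {0<..<a} h x))\<^sup>2)"
  proof (rule Bochner_Integration.integrable_bound)
    have "emeasure lborel {0<..<a} < \<infinity>" by (cases "0 \<le> a") auto
    then show "integrable lborel (\<lambda>x. B\<^sup>2 * indicat_real {0<..<a} x)" by simp
    show "AE x in lborel. norm ((cmod (cut {0<..<a} h x))\<^sup>2) \<le> norm (B\<^sup>2 * indicat_real {0<..<a} x)"
      by (intro AE_I2) (auto simp: cut_def indicator_def intro!: power_mono B)
  qed simp
  then show ?thesis by (simp add: L2_functions_cut)
qed

text \<open>Two integrations by parts; only the boundary term at 0 survives.\<close>

lemma fourier_second_derivative: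
  assumes w: "\<And>x. (w has_vector_derivative w1 x) (at x)" and w1: "\<And>x. (w1 has_vector_derivative w2 x) (at x)"
    and w2: "\<And>x. isCont w2 x" and i: "integrable lborel (cut S w2)" "integrable lborel (cut S w)"
    and FTC: "\<And>F'. (\<And>x. ((\<lambda>x. cis (- \<xi> * x) * (w1 x + \<i> * of_real \<xi> * w x)) has_vector_derivative F' x) (at x)) \<Longrightarrow>
      (\<And>x. isCont F' x) \<Longrightarrow> integrable lborel (cut S F') \<Longrightarrow> (LINT x|lborel. cut S F' x) = - (w1 0 + \<i> * of_real \<xi> * w 0)"
  shows "of_real (\<xi>\<^sup>2) * fourier (cut S w) \<xi> = - fourier (cut S w2) \<xi> - of_real fourier_const * (w1 0 + \<i> * of_real \<xi> * w 0)"
proof -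
  let ?e = "\<lambda>x. cis (- \<xi> * x)"
  have cw: "isCont w x" for x using w has_vector_derivative_continuous by blast
  \<comment> \<open>The factor w1 + i xi w is chosen so that the first-order terms of the derivative
    cancel and e (w2 + xi^2 w) remains; one use of the fundamental theorem thus covers both
    integrations by parts.\<close>
  let ?F = "\<lambda>x. ?e x * (w1 x + \<i> * of_real \<xi> * w x)"
  let ?G = "\<lambda>x. ?e x * (w2 x + \<i> * of_real \<xi> * w1 x) + \<i> * of_real (- \<xi>) * ?e x * (w1 x + \<i> * of_real \<xi> * w x)"
  let ?F' = "\<lambda>x. ?e x * w2 x + of_real (\<xi>\<^sup>2) * (?e x * w x)"
  have "(?F has_vector_derivative ?G x) (at x)" for x
    by (rule has_vector_derivative_mult[OF cis_has_vderiv has_vector_derivative_add[OF w1 has_vector_derivative_mult_right[OF w]]])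
  moreover have "?G x = ?F' x" for x
    by (simp add: algebra_simps power2_eq_square)
  ultimately have F: "(?F has_vector_derivative ?F' x) (at x)" for x by simp
  from i have i': "integrable lborel (\<lambda>x. ?e x * cut S w2 x)" "integrable lborel (\<lambda>x. ?e x * cut S w x)"
    by (auto intro!: integrable_cis_mult)
  have cF': "cut S ?F' x = ?e x * cut S w2 x + of_real (\<xi>\<^sup>2) * (?e x * cut S w x)" for x
    by (simp add: cut_def scaleR_right_distrib)
  have "(LINT x|lborel. cut S ?F' x) = - (w1 0 + \<i> * of_real \<xi> * w 0)"
  proof (rule FTC[OF F])
    have "isCont ?e x" for x using cis_has_vderiv has_vector_derivative_continuous by blast
    then show "isCont ?F' x" for x
      by (intro continuous_intros w2 cw)
    show "integrable lborel (cut S ?F')" unfolding cF'[abs_def] using i' by simp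
  qed
  then have "(LINT x|lborel. ?e x * cut S w2 x) + of_real (\<xi>\<^sup>2) * (LINT x|lborel. ?e x * cut S w x) = - (w1 0 + \<i> * of_real \<xi> * w 0)"
    unfolding cF' using i' by simp
  moreover have "y = - x - z" if "x + y = - z" for x y z :: complex
  proof -
    have "y = (x + y) - x" by simp
    also have "\<dots> = - x - z" unfolding that by simp
    finally show ?thesis .
  qed
  ultimately have "of_real (\<xi>\<^sup>2) * (LINT x|lborel. ?e x * cut S w x) = - (LINT x|lborel. ?e x * cut S w2 x) - (w1 0 + \<i> * of_real \<xi> * w 0)"
    by blast
  then have "of_real fourier_const * (of_real (\<xi>\<^sup>2) * (LINT x|lborel. ?e x * cut S w x)) = of_real fourier_const * (- (LINT x|lborel. ?e x * cut S w2 x) - (w1 0 + \<i> * of_real \<xi> * w 0))"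
    by simp
  then show ?thesis unfolding fourier_cis by (simp add: algebra_simps)
qed

text \<open>The endpoint a contributes nothing because the function and its derivative vanish there;
  for a tapered function this is the double zero of \<open>rho\<close> at a.\<close>

lemma fourier_cut_second_derivative:
  assumes a: "a > 0"
    and w: "\<And>x. (w has_vector_derivative w1 x) (at x)" and w1: "\<And>x. (w1 has_vector_derivative w2 x) (at x)"
    and w2: "\<And>x. isCont w2 x" and 0: "w a = 0" "w1 a = 0"
  shows "of_real (\<xi>\<^sup>2) * fourier (cut {0<..<a} w) \<xi> = - fourier (cut {0<..<a} w2) \<xi> - of_real fourier_const * (w1 0 + \<i> * of_real \<xi> * w 0)"
proof (rule fourier_second_derivative[OF w w1 w2])
  have "isCont w x" for x using w has_vector_derivative_continuous by blast
  then show "integrable lborel (cut {0<..<a} w2)" "integrable lborel (cut {0<..<a} w)"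
    using w2 by (auto intro!: L2_cut_integrable cut_continuous_L2 continuous_at_imp_continuous_on)
next
  fix F' assume "\<And>x. ((\<lambda>x. cis (- \<xi> * x) * (w1 x + \<i> * of_real \<xi> * w x)) has_vector_derivative F' x) (at x)" "\<And>x. isCont F' x"
  from integral_cut_FTC[OF a this] show "(LINT x|lborel. cut {0<..<a} F' x) = - (w1 0 + \<i> * of_real \<xi> * w 0)"
    using 0 by simp
qed

text \<open>At s = 2 the weight is the square of 1 + xi^2, so the norm is the L^2 norm of g + xi^2
  g.\<close>

lemma weighted_norm2_2_le:
  assumes g: "g \<in> weighted_L2 0" and h: "(\<lambda>\<xi>. of_real (\<xi>\<^sup>2) * g \<xi>) \<in> weighted_L2 0"
  shows "g \<in> weighted_L2 2"
    "weighted_norm2 2 g \<le> 2 * weighted_norm2 0 g + 2 * weighted_norm2 0 (\<lambda>\<xi>. of_real (\<xi>\<^sup>2) * g \<xi>)"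
proof -
  note s = weighted_L2_add[OF g h]
  have "(1 + \<xi>\<^sup>2) powr 2 * (cmod (g \<xi>))\<^sup>2 = 1 * ((1 + \<xi>\<^sup>2) powr 0 * (cmod (g \<xi> + of_real (\<xi>\<^sup>2) * g \<xi>))\<^sup>2)" for \<xi>
  proof -
    have "g \<xi> + of_real (\<xi>\<^sup>2) * g \<xi> = of_real (1 + \<xi>\<^sup>2) * g \<xi>" by (simp add: algebra_simps)
    then have "cmod (g \<xi> + of_real (\<xi>\<^sup>2) * g \<xi>) = (1 + \<xi>\<^sup>2) * cmod (g \<xi>)"
      by (simp only: norm_mult norm_of_real) simp
    then show ?thesis by (simp add: power_mult_distrib powr_numeral add_nonneg_nonneg)
  qed
  then have le: "(1 + \<xi>\<^sup>2) powr 2 * (cmod (g \<xi>))\<^sup>2 \<le> 1 * ((1 + \<xi>\<^sup>2) powr 0 * (cmod (g \<xi> + of_real (\<xi>\<^sup>2) * g \<xi>))\<^sup>2)" for \<xi>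
    by (simp only: order_refl)
  have m: "g \<in> borel_measurable borel" using g by (simp add: weighted_L2_def)
  note b = weighted_L2_bound[OF m s(1) le]
  show "g \<in> weighted_L2 2" by (rule b(1))
  show "weighted_norm2 2 g \<le> 2 * weighted_norm2 0 g + 2 * weighted_norm2 0 (\<lambda>\<xi>. of_real (\<xi>\<^sup>2) * g \<xi>)"
    using b(2) s(2) by linarith
qed

lemma invfour_has_vector_derivative:
  assumes "integrable lborel g" "integrable lborel (\<lambda>\<xi>. of_real \<xi> * g \<xi>)"
  shows "(invfour g has_vector_derivative invfour (\<lambda>\<xi>. \<i> * (of_real \<xi> * g \<xi>)) x) (at x)"
proof -
  have "(uminus has_vector_derivative (- 1)) (at x)"
    by (auto intro!: derivative_eq_intros)
  from vector_diff_chain_at[OF this fourier_has_vector_derivative[OF assms]]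
  show ?thesis by (simp add: o_def invfour_def[abs_def] fourier_cmult[of _ "\<lambda>x. - (\<i> * (of_real x * g x))", symmetric] fourier_cmult[of "-1", simplified, symmetric])
qed

lemma cut_square_le:
  assumes u: "integrable lborel (\<lambda>x. (cmod (u x))\<^sup>2)" and [measurable]: "h \<in> borel_measurable borel"
    and le: "\<And>x. x \<in> {0<..<a} \<Longrightarrow> cmod (h x) \<le> cmod (u x)"
  shows "integrable lborel (\<lambda>x. (cmod (cut {0<..<a} h x))\<^sup>2)" "(LINT x|lborel. (cmod (cut {0<..<a} h x))\<^sup>2) \<le> (LINT x|lborel. (cmod (u x))\<^sup>2)"
proof -
  have le': "(cmod (cut {0<..<a} h x))\<^sup>2 \<le> (cmod (u x))\<^sup>2" for x
    using le[of x] by (auto simp: cut_def indicator_def intro!: power_mono)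
  show i: "integrable lborel (\<lambda>x. (cmod (cut {0<..<a} h x))\<^sup>2)"
    by (rule Bochner_Integration.integrable_bound[OF u]) (use le' in \<open>auto simp: cut_def[abs_def]\<close>)
  show "(LINT x|lborel. (cmod (cut {0<..<a} h x))\<^sup>2) \<le> (LINT x|lborel. (cmod (u x))\<^sup>2)"
    by (rule integral_mono[OF i u le'])
qed

text \<open>336 = 2 times 168 and 96 = 2 times 48 combine the L^2 bounds of the extension and of its
  second derivative. The inner factor belongs to the second derivative of rho u: 6/a^2, 12/a and 1
  bound rho'', 2 rho' and rho, and 3 comes from squaring a sum of three terms.\<close>

definition H2_const :: "real \<Rightarrow> real" where
  "H2_const a = 336 + 96 * (3 * ((6 / a\<^sup>2)\<^sup>2 + (12 / a)\<^sup>2 + 1))"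

text \<open>Derivatives of order k <= 2 are controlled by the H^2 norm; the unimodular
  \<open>c\<close> stands for the factor i^k.\<close>

lemma weighted_L2_poly:
  assumes "g \<in> weighted_L2 2" "k \<le> 2" "cmod c = 1"
  shows "(\<lambda>\<xi>. c * (of_real \<xi> ^ k * g \<xi>)) \<in> weighted_L2 0" "weighted_norm2 0 (\<lambda>\<xi>. c * (of_real \<xi> ^ k * g \<xi>)) \<le> weighted_norm2 2 g"
proof -
  have [measurable]: "g \<in> borel_measurable borel" using assms by (simp add: weighted_L2_def)
  have "(1 + \<xi>\<^sup>2) powr 0 * (cmod (c * (of_real \<xi> ^ k * g \<xi>)))\<^sup>2 \<le> 1 * ((1 + \<xi>\<^sup>2) powr 2 * (cmod (g \<xi>))\<^sup>2)" for \<xi> :: real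
  proof -
    have "(\<xi>\<^sup>2) ^ k \<le> (1 + \<xi>\<^sup>2) ^ k" by (intro power_mono) auto
    also have "\<dots> \<le> (1 + \<xi>\<^sup>2) ^ 2" using assms(2) by (intro power_increasing) auto
    finally have "(\<bar>\<xi>\<bar> ^ k)\<^sup>2 \<le> (1 + \<xi>\<^sup>2)\<^sup>2" by (simp add: power_mult[symmetric] mult.commute power_even_abs)
    then have "(\<bar>\<xi>\<bar> ^ k)\<^sup>2 * (cmod (g \<xi>))\<^sup>2 \<le> (1 + \<xi>\<^sup>2)\<^sup>2 * (cmod (g \<xi>))\<^sup>2" by (intro mult_right_mono) auto
    then show ?thesis using assms(3) by (simp add: norm_mult norm_power power_mult_distrib powr_numeral add_nonneg_nonneg)
  qed
  from weighted_L2_bound[OF _ assms(1) this]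
  show "(\<lambda>\<xi>. c * (of_real \<xi> ^ k * g \<xi>)) \<in> weighted_L2 0" "weighted_norm2 0 (\<lambda>\<xi>. c * (of_real \<xi> ^ k * g \<xi>)) \<le> weighted_norm2 2 g"
    by auto
qed

text \<open>The assumption \<open>i2\<close> makes \<open>invfour g\<close> twice continuously
  differentiable, so that the integrations by parts are classical. General densities are reached
  from here by truncation.\<close>

lemma fourier_refl_ext_H2_smooth:
  assumes a: "a > 0" and g: "g \<in> weighted_L2 2"
    and i2: "integrable lborel (\<lambda>\<xi>. of_real \<xi> ^ 2 * g \<xi>)"
  shows "fourier (refl_ext (tapered a (invfour g))) \<in> weighted_L2 2"
    "weighted_norm2 2 (fourier (refl_ext (tapered a (invfour g)))) \<le> H2_const a * weighted_norm2 2 g"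
proof -
  let ?\<Omega> = "{0<..<a}"
  define N where "N = weighted_norm2 2 g"
  have [measurable]: "g \<in> borel_measurable borel" using g by (simp add: weighted_L2_def)
  have i0: "integrable lborel g" using g weighted_L2_mono weighted_L2_integrable by (metis one_le_numeral)
  have i1: "integrable lborel (\<lambda>\<xi>. of_real \<xi> * g \<xi>)"
  proof (rule Bochner_Integration.integrable_bound[OF Bochner_Integration.integrable_add[OF integrable_norm[OF i0] integrable_norm[OF i2]]])
    have "\<bar>\<xi>\<bar> \<le> 1 + \<xi>\<^sup>2" for \<xi> :: real
      using sum_squares_bound[of 1 "\<bar>\<xi>\<bar>"] by simp
    from mult_right_mono[OF this norm_ge_zero]
    have "\<bar>\<xi>\<bar> * cmod (g \<xi>) \<le> cmod (g \<xi>) + \<xi>\<^sup>2 * cmod (g \<xi>)" for \<xi> by (simp add: distrib_right)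
    then show "AE \<xi> in lborel. norm (of_real \<xi> * g \<xi>) \<le> norm (norm (g \<xi>) + norm (of_real \<xi> ^ 2 * g \<xi>))"
      by (intro AE_I2) (simp add: norm_mult norm_power)
  qed simp
  define g1 g2 where "g1 = (\<lambda>\<xi>. \<i> * (of_real \<xi> * g \<xi>))" and "g2 = (\<lambda>\<xi>. - 1 * (of_real \<xi> ^ 2 * g \<xi>))"
  define u u1 u2 where "u = invfour g" and "u1 = invfour g1" and "u2 = invfour g2"
  have g1: "integrable lborel g1" and g2: "integrable lborel g2" using i1 i2 by (simp_all add: g1_def g2_def)
  have [measurable]: "u \<in> borel_measurable borel" "u1 \<in> borel_measurable borel" "u2 \<in> borel_measurable borel"
    by (simp_all add: u_def u1_def u2_def g1_def g2_def)
  have du: "(u has_vector_derivative u1 x) (at x)" for x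
    unfolding u_def u1_def g1_def by (rule invfour_has_vector_derivative[OF i0 i1])
  have eq2: "(\<lambda>\<xi>. \<i> * (of_real \<xi> * g1 \<xi>)) = g2" by (simp add: fun_eq_iff g1_def g2_def power2_eq_square mult_ac)
  have i1': "integrable lborel (\<lambda>\<xi>. of_real \<xi> * g1 \<xi>)"
    using integrable_mult_right[OF i2, of \<i>] by (simp add: g1_def power2_eq_square mult_ac)
  have du1: "(u1 has_vector_derivative u2 x) (at x)" for x
    using invfour_has_vector_derivative[OF g1 i1', of x] unfolding u1_def u2_def eq2 .
  have cu: "isCont u x" "isCont u1 x" "isCont u2 x" for x
    unfolding u_def u1_def u2_def using i0 g1 g2 by (simp_all add: invfour_isCont)
  have nrms: "integrable lborel (\<lambda>x. (cmod (u x))\<^sup>2)" "(LINT x|lborel. (cmod (u x))\<^sup>2) \<le> N"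
      "integrable lborel (\<lambda>x. (cmod (u1 x))\<^sup>2)" "(LINT x|lborel. (cmod (u1 x))\<^sup>2) \<le> N"
      "integrable lborel (\<lambda>x. (cmod (u2 x))\<^sup>2)" "(LINT x|lborel. (cmod (u2 x))\<^sup>2) \<le> N"
  proof -
    have p0: "g \<in> weighted_L2 0" "weighted_norm2 0 g \<le> N"
      using weighted_L2_poly[OF g, of 0 1] by (auto simp: N_def)
    have p1: "g1 \<in> weighted_L2 0" "weighted_norm2 0 g1 \<le> N"
      using weighted_L2_poly[OF g, of 1 \<i>] by (auto simp: N_def g1_def)
    have p2: "g2 \<in> weighted_L2 0" "weighted_norm2 0 g2 \<le> N"
      using weighted_L2_poly[OF g, of 2 "-1"] by (auto simp: N_def g2_def)
    note q0 = invfour_plancherel_le[OF i0 weighted_L2_0[THEN iffD1, THEN conjunct2, OF p0(1)]]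
    note q1 = invfour_plancherel_le[OF g1 weighted_L2_0[THEN iffD1, THEN conjunct2, OF p1(1)]]
    note q2 = invfour_plancherel_le[OF g2 weighted_L2_0[THEN iffD1, THEN conjunct2, OF p2(1)]]
    show "integrable lborel (\<lambda>x. (cmod (u x))\<^sup>2)" "integrable lborel (\<lambda>x. (cmod (u1 x))\<^sup>2)" "integrable lborel (\<lambda>x. (cmod (u2 x))\<^sup>2)"
      unfolding u_def u1_def u2_def by (rule q0 q1 q2)+
    show "(LINT x|lborel. (cmod (u x))\<^sup>2) \<le> N" "(LINT x|lborel. (cmod (u1 x))\<^sup>2) \<le> N" "(LINT x|lborel. (cmod (u2 x))\<^sup>2) \<le> N"
      using q0(2) q1(2) q2(2) p0(2) p1(2) p2(2) unfolding u_def u1_def u2_def weighted_norm2_0 by linarith+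
  qed
  have uL2: "u \<in> L2_functions ?\<Omega>"
    by (rule cut_continuous_L2) (use cu in \<open>auto intro: continuous_at_imp_continuous_on\<close>)
  note lu = tapered_L2[OF a uL2]
  define w w1 w2 where "w = (\<lambda>x. of_real (rho a x) * u x)"
    and "w1 = (\<lambda>x. of_real (rho a x) * u1 x + of_real (rho' a x) * u x)"
    and "w2 = (\<lambda>x. (of_real (rho a x) * u2 x + of_real (rho' a x) * u1 x) + (of_real (rho' a x) * u1 x + of_real (rho'' a x) * u x))"
  note r = has_vector_derivative_of_real[OF rho_derivs(1)[OF a]] has_vector_derivative_of_real[OF rho_derivs(2)[OF a]]
  have dw: "(w has_vector_derivative w1 x) (at x)" for x
    unfolding w_def w1_def by (rule has_vector_derivative_mult[OF r(1) du])
  have dw1: "(w1 has_vector_derivative w2 x) (at x)" for x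
    unfolding w1_def w2_def
    by (rule has_vector_derivative_add[OF has_vector_derivative_mult[OF r(1) du1] has_vector_derivative_mult[OF r(2) du]])
  have cont_rho: "isCont (rho a) x" "isCont (rho' a) x" "isCont (rho'' a) x" for x
  proof -
    show "isCont (rho a) x" "isCont (rho' a) x" by (rule DERIV_isCont[OF rho_derivs(1)[OF a]] DERIV_isCont[OF rho_derivs(2)[OF a]])+
    show "isCont (rho'' a) x" unfolding rho''_def[abs_def] by (intro continuous_intros) (use a in auto)
  qed
  have cw2: "isCont w2 x" for x
    unfolding w2_def by (intro continuous_intros cu cont_rho)
  have w2m [measurable]: "w2 \<in> borel_measurable borel"
    using cw2 by (intro borel_measurable_continuous_onI continuous_at_imp_continuous_on) auto
  have end0: "w a = 0" "w1 a = 0" using rho_end[OF a] by (simp_all add: w_def w1_def)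
  have locw: "tapered a u = cut ?\<Omega> w" by (simp add: tapered_def w_def)
  define W W2 where "W = fourier (tapered a u)" and "W2 = fourier (cut ?\<Omega> w2)"
  have key: "of_real (\<xi>\<^sup>2) * W \<xi> = - W2 \<xi> - of_real fourier_const * (w1 0 + \<i> * of_real \<xi> * w 0)" for \<xi>
    unfolding W_def W2_def locw by (rule fourier_cut_second_derivative[OF a dw dw1 cw2 end0])
  define D where "D = fourier (refl_ext (tapered a u))"
  have D: "D \<xi> = W \<xi> - 3 * W (- \<xi>) + 8 * W (- 2 * \<xi>)" for \<xi>
    unfolding D_def W_def by (rule fourier_refl_ext[OF lu(1)])
  \<comment> \<open>The boundary terms at 0 cancel: this is what the reflection coefficients are made for.\<close>
  have xiD: "of_real (\<xi>\<^sup>2) * D \<xi> = - 1 * (W2 \<xi> - 3 * W2 (- \<xi>) + 2 * W2 (- 2 * \<xi>))" for \<xi>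
  proof -
    \<comment> \<open>The dilation turns 8 xi^2 into 2 (2 xi)^2. In the boundary terms the slope at
      0 then gets the factor 1 - 3 + 2 = 0 and the value at 0 the factor xi (1 + 3 - 4) = 0.\<close>
    have "of_real (\<xi>\<^sup>2) * D \<xi> = of_real (\<xi>\<^sup>2) * W \<xi> - 3 * (of_real ((- \<xi>)\<^sup>2) * W (- \<xi>)) + 2 * (of_real ((- 2 * \<xi>)\<^sup>2) * W (- 2 * \<xi>))"
      by (simp add: D algebra_simps)
    also have "\<dots> = - 1 * (W2 \<xi> - 3 * W2 (- \<xi>) + 2 * W2 (- 2 * \<xi>))"
      unfolding key by (simp add: algebra_simps)
    finally show ?thesis .
  qed
  have D0: "D \<in> weighted_L2 0" "weighted_norm2 0 D \<le> 168 * N"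
  proof -
    have "(LINT x|lborel. (cmod (cut ?\<Omega> u x))\<^sup>2) \<le> N"
      using cut_square_le(2)[OF nrms(1), of u a] nrms(2) by simp
    then show "D \<in> weighted_L2 0" "weighted_norm2 0 D \<le> 168 * N"
      using fourier_refl_ext_L2[OF lu(1,2)] lu(3) unfolding D_def by auto
  qed
  have w2L2: "w2 \<in> L2_functions ?\<Omega>"
    by (rule cut_continuous_L2) (use cw2 in \<open>auto intro: continuous_at_imp_continuous_on\<close>)
  define C where "C = 3 * ((6 / a\<^sup>2)\<^sup>2 + (12 / a)\<^sup>2 + 1)"
  have w2_le: "(cmod (cut ?\<Omega> w2 x))\<^sup>2 \<le> 3 * ((6 / a\<^sup>2)\<^sup>2 * (cmod (u x))\<^sup>2 + (12 / a)\<^sup>2 * (cmod (u1 x))\<^sup>2 + (cmod (u2 x))\<^sup>2)" for x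
  proof (cases "x \<in> ?\<Omega>")
    case True
    note rb = rho_bounds[OF a True]
    have "cmod (w2 x) \<le> cmod (of_real (rho a x) * u2 x + of_real (rho' a x) * u1 x) + cmod (of_real (rho' a x) * u1 x + of_real (rho'' a x) * u x)"
      unfolding w2_def by (rule norm_triangle_ineq)
    also have "\<dots> \<le> (cmod (of_real (rho a x) * u2 x) + cmod (of_real (rho' a x) * u1 x)) + (cmod (of_real (rho' a x) * u1 x) + cmod (of_real (rho'' a x) * u x))"
      by (intro add_mono norm_triangle_ineq)
    also have "\<dots> \<le> (1 * cmod (u2 x) + 6 / a * cmod (u1 x)) + (6 / a * cmod (u1 x) + 6 / a\<^sup>2 * cmod (u x))"
      unfolding norm_mult norm_of_real by (intro add_mono mult_right_mono rb) auto
    also have "\<dots> = 6 / a\<^sup>2 * cmod (u x) + 12 / a * cmod (u1 x) + cmod (u2 x)" by (simp add: algebra_simps)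
    finally have "(cmod (w2 x))\<^sup>2 \<le> (6 / a\<^sup>2 * cmod (u x) + 12 / a * cmod (u1 x) + cmod (u2 x))\<^sup>2"
      by (intro power_mono) auto
    also have "\<dots> \<le> 3 * ((6 / a\<^sup>2 * cmod (u x))\<^sup>2 + (12 / a * cmod (u1 x))\<^sup>2 + (cmod (u2 x))\<^sup>2)"
    proof -
      have "(p + q + r)\<^sup>2 \<le> 3 * (p\<^sup>2 + q\<^sup>2 + r\<^sup>2)" for p q r :: real
        using sum_squares_bound[of p q] sum_squares_bound[of p r] sum_squares_bound[of q r]
        by (simp add: power2_eq_square algebra_simps)
      then show ?thesis .
    qed
    finally have "(cmod (w2 x))\<^sup>2 \<le> 3 * ((6 / a\<^sup>2)\<^sup>2 * (cmod (u x))\<^sup>2 + (12 / a)\<^sup>2 * (cmod (u1 x))\<^sup>2 + (cmod (u2 x))\<^sup>2)"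
      by (simp only: power_mult_distrib)
    moreover have "cut ?\<Omega> w2 x = w2 x" using True by (simp add: cut_def)
    ultimately show ?thesis by (simp only:)
  next
    case False
    then have "cut ?\<Omega> w2 x = 0" by (simp add: cut_def)
    then show ?thesis by (simp add: add_nonneg_nonneg)
  qed
  have w2_int: "(LINT x|lborel. (cmod (cut ?\<Omega> w2 x))\<^sup>2) \<le> C * N"
  proof -
    have "(LINT x|lborel. (cmod (cut ?\<Omega> w2 x))\<^sup>2) \<le> (LINT x|lborel. 3 * ((6 / a\<^sup>2)\<^sup>2 * (cmod (u x))\<^sup>2 + (12 / a)\<^sup>2 * (cmod (u1 x))\<^sup>2 + (cmod (u2 x))\<^sup>2))"
      by (rule integral_mono[OF _ _ w2_le]) (use w2L2 nrms in \<open>auto simp: L2_functions_cut\<close>)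
    also have "\<dots> = 3 * ((6 / a\<^sup>2)\<^sup>2 * (LINT x|lborel. (cmod (u x))\<^sup>2) + (12 / a)\<^sup>2 * (LINT x|lborel. (cmod (u1 x))\<^sup>2) + (LINT x|lborel. (cmod (u2 x))\<^sup>2))"
      using nrms by simp
    also have "\<dots> \<le> 3 * ((6 / a\<^sup>2)\<^sup>2 * N + (12 / a)\<^sup>2 * N + N)"
      by (intro mult_left_mono add_mono nrms) auto
    also have "\<dots> = C * N" unfolding C_def by (simp only: algebra_simps)
    finally show ?thesis .
  qed
  have W2: "W2 \<in> weighted_L2 0" "weighted_norm2 0 W2 \<le> C * N"
    using fourier_weighted_L2[OF L2_cut_integrable[OF w2L2]] w2L2 w2_int unfolding W2_def
    by (auto simp: L2_functions_cut)
  note rc = refl_comb[OF W2(1), of 2]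
  note m1 = weighted_L2_cmult[OF rc(1), of "-1"]
  have xiD2: "(\<lambda>\<xi>. of_real (\<xi>\<^sup>2) * D \<xi>) \<in> weighted_L2 0" "weighted_norm2 0 (\<lambda>\<xi>. of_real (\<xi>\<^sup>2) * D \<xi>) \<le> 48 * (C * N)"
    unfolding xiD using m1 rc(2) W2(2) by auto
  note fin = weighted_norm2_2_le[OF D0(1) xiD2(1)]
  show "fourier (refl_ext (tapered a (invfour g))) \<in> weighted_L2 2"
    using fin(1) by (simp add: D_def u_def)
  have "weighted_norm2 2 D \<le> 336 * N + 96 * (C * N)" using fin(2) D0(2) xiD2(2) by linarith
  also have "\<dots> = (336 + 96 * C) * N" by (simp add: algebra_simps)
  also have "336 + 96 * C = H2_const a" unfolding H2_const_def C_def ..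
  finally show "weighted_norm2 2 (fourier (refl_ext (tapered a (invfour g)))) \<le> H2_const a * weighted_norm2 2 g"
    by (simp add: D_def u_def N_def)
qed

text \<open>Truncating \<open>g\<close> to [-n, n] supplies the extra integrability without raising
  the norm. The transforms of the extensions converge pointwise and their bound does not depend on
  n, so Fatou applies.\<close>

lemma fourier_refl_ext_H2:
  assumes a: "a > 0" and g: "g \<in> weighted_L2 2"
  shows "fourier (refl_ext (tapered a (invfour g))) \<in> weighted_L2 2"
    "weighted_norm2 2 (fourier (refl_ext (tapered a (invfour g)))) \<le> H2_const a * weighted_norm2 2 g"
proof -
  let ?\<Omega> = "{0<..<a}"
  have [measurable]: "g \<in> borel_measurable borel" using g by (simp add: weighted_L2_def)
  have i0: "integrable lborel g" using g weighted_L2_mono weighted_L2_integrable by (metis one_le_numeral)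
  define G where "G n \<xi> = of_real (indicat_real {- real n..real n} \<xi>) * g \<xi>" for n \<xi>
  have Gm [measurable]: "G n \<in> borel_measurable borel" for n by (simp add: G_def[abs_def])
  have "(1 + \<xi>\<^sup>2) powr 2 * (cmod (G n \<xi>))\<^sup>2 \<le> 1 * ((1 + \<xi>\<^sup>2) powr 2 * (cmod (g \<xi>))\<^sup>2)" for n \<xi>
    by (auto simp: G_def indicator_def)
  note Gb = weighted_L2_bound[OF Gm g this]
  have Gle: "cmod (G n \<xi>) \<le> cmod (g \<xi>)" for n \<xi> by (simp add: G_def indicator_def)
  have Gi: "integrable lborel (G n)" for n
    by (rule Bochner_Integration.integrable_bound[OF i0]) (use Gle in auto)
  have Gi2: "integrable lborel (\<lambda>\<xi>. of_real \<xi> ^ 2 * G n \<xi>)" for n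
  proof (rule Bochner_Integration.integrable_bound[OF integrable_mult_right[OF i0, of "of_real ((real n)\<^sup>2)"]])
    have "cmod (of_real \<xi> ^ 2 * G n \<xi>) \<le> cmod (of_real ((real n)\<^sup>2) * g \<xi>)" for \<xi>
    proof (cases "\<xi> \<in> {- real n..real n}")
      case True
      then have "\<xi>\<^sup>2 \<le> (real n)\<^sup>2" by (simp add: abs_le_square_iff[symmetric] abs_le_iff)
      then show ?thesis using True by (simp add: G_def norm_mult norm_power mult_right_mono)
    qed (simp add: G_def)
    then show "AE \<xi> in lborel. norm (of_real \<xi> ^ 2 * G n \<xi>) \<le> norm (of_real ((real n)\<^sup>2) * g \<xi>)" by (intro AE_I2)
  qed simp
  have Glim: "(\<lambda>n. G n \<xi>) \<longlonglongrightarrow> g \<xi>" for \<xi>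
  proof (rule tendsto_eventually)
    obtain N where N: "\<bar>\<xi>\<bar> < real N" using reals_Archimedean2 by blast
    show "\<forall>\<^sub>F n in sequentially. G n \<xi> = g \<xi>"
      using eventually_ge_at_top[of N] by eventually_elim (use N in \<open>auto simp: G_def indicator_def\<close>)
  qed
  have invlim: "(\<lambda>n. invfour (G n) x) \<longlonglongrightarrow> invfour g x" for x
  proof -
    have "(\<lambda>n. LINT \<xi>|lborel. cis (- (- x * \<xi>)) * G n \<xi>) \<longlonglongrightarrow> (LINT \<xi>|lborel. cis (- (- x * \<xi>)) * g \<xi>)"
    proof (rule integral_dominated_convergence[where w="\<lambda>\<xi>. norm (g \<xi>)"])
      show "AE \<xi> in lborel. (\<lambda>n. cis (- (- x * \<xi>)) * G n \<xi>) \<longlonglongrightarrow> cis (- (- x * \<xi>)) * g \<xi>"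
        by (intro AE_I2 tendsto_mult_left Glim)
      show "AE \<xi> in lborel. norm (cis (- (- x * \<xi>)) * G n \<xi>) \<le> norm (g \<xi>)" for n
        using Gle by (intro AE_I2) (simp add: norm_mult)
    qed (use i0 in auto)
    then show ?thesis unfolding invfour_def fourier_cis by (intro tendsto_mult_left)
  qed
  \<comment> \<open>A bound for the inverse transforms that is uniform in n and x; times the
    indicator of the bounded interval it is an integrable majorant.\<close>
  define B where "B = fourier_const * (LINT \<xi>|lborel. cmod (g \<xi>))"
  have B: "cmod (invfour (G n) x) \<le> B" for n x
  proof -
    have "(LINT \<xi>|lborel. cmod (G n \<xi>)) \<le> (LINT \<xi>|lborel. cmod (g \<xi>))"
      by (rule integral_mono) (use Gi i0 Gle in auto)
    then have "fourier_const * (LINT \<xi>|lborel. cmod (G n \<xi>)) \<le> B" unfolding B_def using fourier_const_pos by simp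
    then show ?thesis using norm_fourier_le[OF Gi[of n], of "- x"] by (simp add: invfour_def)
  qed
  have L2n: "invfour (G n) \<in> L2_functions ?\<Omega>" for n
    by (rule cut_continuous_L2) (use invfour_isCont[OF Gi] in \<open>auto intro: continuous_at_imp_continuous_on\<close>)
  have L2g: "invfour g \<in> L2_functions ?\<Omega>"
    by (rule cut_continuous_L2) (use invfour_isCont[OF i0] in \<open>auto intro: continuous_at_imp_continuous_on\<close>)
  note ln = tapered_L2(1)[OF a L2n] and lg = tapered_L2(1)[OF a L2g]
  have flim: "(\<lambda>n. fourier (tapered a (invfour (G n))) \<xi>) \<longlonglongrightarrow> fourier (tapered a (invfour g)) \<xi>" for \<xi>
  proof -
    have "(\<lambda>n. LINT x|lborel. cis (- (\<xi> * x)) * tapered a (invfour (G n)) x) \<longlonglongrightarrow> (LINT x|lborel. cis (- (\<xi> * x)) * tapered a (invfour g) x)"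
    proof (rule integral_dominated_convergence[where w="\<lambda>x. B * indicat_real ?\<Omega> x"])
      show "AE x in lborel. (\<lambda>n. cis (- (\<xi> * x)) * tapered a (invfour (G n)) x) \<longlonglongrightarrow> cis (- (\<xi> * x)) * tapered a (invfour g) x"
        unfolding tapered_def cut_def by (intro AE_I2 tendsto_mult_left tendsto_scaleR tendsto_const invlim)
      have "cmod (tapered a (invfour (G n)) x) \<le> B * indicat_real ?\<Omega> x" for n x
        using order.trans[OF norm_tapered_le[OF a, of "invfour (G n)" x], of "B * indicat_real ?\<Omega> x"] B[of n x]
        by (auto simp: cut_def indicator_def)
      then show "AE x in lborel. norm (cis (- (\<xi> * x)) * tapered a (invfour (G n)) x) \<le> B * indicat_real ?\<Omega> x" for n
        by (intro AE_I2) (simp add: norm_mult)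
    qed (use a borel_measurable_integrable[OF lg] borel_measurable_integrable[OF ln] in auto)
    then show ?thesis unfolding fourier_cis by (intro tendsto_mult_left)
  qed
  have "(\<lambda>n. fourier (refl_ext (tapered a (invfour (G n)))) \<xi>) \<longlonglongrightarrow> fourier (refl_ext (tapered a (invfour g))) \<xi>" for \<xi>
    unfolding fourier_refl_ext[OF ln] fourier_refl_ext[OF lg] by (intro tendsto_intros flim)
  moreover have "weighted_norm2 2 (fourier (refl_ext (tapered a (invfour (G n))))) \<le> H2_const a * weighted_norm2 2 g" for n
  proof -
    have "H2_const a \<ge> 0" by (simp add: H2_const_def)
    then have "H2_const a * weighted_norm2 2 (G n) \<le> H2_const a * weighted_norm2 2 g"
      using Gb(2)[of n] by (intro mult_left_mono) auto
    then show ?thesis using fourier_refl_ext_H2_smooth(2)[OF a Gb(1) Gi2, of n] by linarith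
  qed
  ultimately show "fourier (refl_ext (tapered a (invfour g))) \<in> weighted_L2 2"
    and "weighted_norm2 2 (fourier (refl_ext (tapered a (invfour g)))) \<le> H2_const a * weighted_norm2 2 g"
    by (rule weighted_L2_fatou[OF fourier_refl_ext_H2_smooth(1)[OF a Gb(1) Gi2], rotated])+
qed

text \<open>The flipped function is the inverse transform of a modulated and reflected density of
  the same norm, so the estimate at 0 also serves at a. Adding the two ends gives the factor
  4.\<close>

lemma fourier_ext_H2:
  assumes a: "a > 0" and g: "g \<in> weighted_L2 2"
  shows "fourier (ext a (invfour g)) \<in> weighted_L2 2"
    "weighted_norm2 2 (fourier (ext a (invfour g))) \<le> 4 * H2_const a * weighted_norm2 2 g"
proof -
  have i0: "integrable lborel g" using g weighted_L2_mono weighted_L2_integrable by (metis one_le_numeral)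
  let ?g = "\<lambda>\<xi>. cis (- a * \<xi>) * g (- \<xi>)"
  have flip: "(\<lambda>y. invfour g (a - y)) = invfour ?g"
  proof
    fix y
    have "(LINT x|lborel. cis (- (- (a - y) * x)) * g x) = (LINT x|lborel. cis (- (- y * x)) * (cis (- a * x) * g (- x)))"
      by (subst lborel_integral_real_affine[where c="-1" and t=0])
         (simp_all add: mult.assoc[symmetric] cis_mult, simp add: algebra_simps)
    then show "invfour g (a - y) = invfour ?g y" unfolding invfour_def fourier_cis by simp
  qed
  note g' = weighted_L2_cis[OF g, of "- a"]
  note e1 = fourier_refl_ext_H2[OF a g] and e2 = fourier_refl_ext_H2[OF a g'(1)]
  note e3 = weighted_L2_cis[OF e2(1), of "- a"]
  note s = weighted_L2_add[OF e1(1) e3(1)]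
  have L: "invfour h \<in> L2_functions {0<..<a}" if "integrable lborel h" for h
    by (rule cut_continuous_L2) (use invfour_isCont[OF that] in \<open>auto intro: continuous_at_imp_continuous_on\<close>)
  have i1: "integrable lborel ?g" using g'(1) weighted_L2_mono weighted_L2_integrable by (metis one_le_numeral)
  have eq: "fourier (ext a (invfour g)) = (\<lambda>\<xi>. fourier (refl_ext (tapered a (invfour g))) \<xi> + cis (- a * \<xi>) * fourier (refl_ext (tapered a (invfour ?g))) (- \<xi>))"
    using fourier_ext[of a "invfour g"] tapered_L2(1)[OF a L[OF i0]] tapered_L2(1)[OF a L[OF i1]] unfolding flip fun_eq_iff by blast
  show "fourier (ext a (invfour g)) \<in> weighted_L2 2" unfolding eq by (rule s(1))
  have "weighted_norm2 2 (fourier (ext a (invfour g))) \<le> 2 * (H2_const a * weighted_norm2 2 g) + 2 * (H2_const a * weighted_norm2 2 g)"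
    unfolding eq using s(2) e1(2) e2(2) e3(2) g'(2) by simp
  then show "weighted_norm2 2 (fourier (ext a (invfour g))) \<le> 4 * H2_const a * weighted_norm2 2 g" by simp
qed

section \<open>The K-functional\<close>

text \<open>The squared K-functional of $(L^2, H^2)$ on the line is the quadratic form of this Fourier multiplier.\<close>

definition K_mult :: "real \<Rightarrow> real \<Rightarrow> real" where
  "K_mult t \<xi> = (t * (1 + \<xi>\<^sup>2))\<^sup>2 / (1 + (t * (1 + \<xi>\<^sup>2))\<^sup>2)"

definition K_form :: "real \<Rightarrow> (real \<Rightarrow> complex) \<Rightarrow> real" where
  "K_form t g = (LINT \<xi>|lborel. K_mult t \<xi> * (cmod (g \<xi>))\<^sup>2)"

lemma K_mult_bounds: "0 \<le> K_mult t \<xi>" "K_mult t \<xi> \<le> 1"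
proof -
  have "1 + (t * (1 + \<xi>\<^sup>2))\<^sup>2 > 0" by (simp add: add_pos_nonneg)
  then show "0 \<le> K_mult t \<xi>" "K_mult t \<xi> \<le> 1" by (simp_all add: K_mult_def divide_le_eq)
qed

lemma K_mult_measurable [measurable]: "K_mult t \<in> borel_measurable borel"
  unfolding K_mult_def[abs_def] by measurable

lemma K_form_integrable:
  assumes "g \<in> weighted_L2 0" shows "integrable lborel (\<lambda>\<xi>. K_mult t \<xi> * (cmod (g \<xi>))\<^sup>2)"
  by (rule Bochner_Integration.integrable_bound[where f="\<lambda>\<xi>. (cmod (g \<xi>))\<^sup>2"])
     (use assms K_mult_bounds in \<open>auto simp: weighted_L2_0 mult_left_le_one_le\<close>)

lemma powr_2_one_plus_square: "(1 + x\<^sup>2) powr 2 = (1 + x\<^sup>2)\<^sup>2" for x :: real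
  by (simp add: powr_numeral add_nonneg_nonneg)

section \<open>Upper and lower bounds for K on the interval\<close>

lemma K_fun_le:
  assumes "\<phi>0 \<in> carr H0" "\<phi>1 \<in> carr H1"
  shows "K_fun H0 H1 t (\<phi>0 + \<phi>1) \<le> sqrt ((nrm H0 \<phi>0)\<^sup>2 + t\<^sup>2 * (nrm H1 \<phi>1)\<^sup>2)"
  unfolding K_fun_def
proof (rule cInf_lower)
  show "bdd_below {sqrt ((nrm H0 \<phi>0')\<^sup>2 + t\<^sup>2 * (nrm H1 \<phi>1')\<^sup>2) | \<phi>0' \<phi>1'. \<phi>0' \<in> carr H0 \<and> \<phi>1' \<in> carr H1 \<and> \<phi>0' + \<phi>1' = \<phi>0 + \<phi>1}"
    by (rule bdd_belowI[of _ 0]) auto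
qed (use assms in blast)

text \<open>The splitting given in the first three assumptions makes the set nonempty, so that its
  \<open>Inf\<close> is a true infimum.\<close>

lemma K_fun_ge:
  assumes "\<phi>0 \<in> carr H0" "\<phi>1 \<in> carr H1" "\<phi>0 + \<phi>1 = \<phi>"
    and "\<And>\<phi>0 \<phi>1. \<phi>0 \<in> carr H0 \<Longrightarrow> \<phi>1 \<in> carr H1 \<Longrightarrow> \<phi>0 + \<phi>1 = \<phi> \<Longrightarrow> L \<le> sqrt ((nrm H0 \<phi>0)\<^sup>2 + t\<^sup>2 * (nrm H1 \<phi>1)\<^sup>2)"
  shows "L \<le> K_fun H0 H1 t \<phi>"
  unfolding K_fun_def by (rule cInf_greatest) (use assms in blast)+

lemma K_fun_nonneg:
  assumes "\<phi>0 \<in> carr H0" "\<phi>1 \<in> carr H1" shows "0 \<le> K_fun H0 H1 t (\<phi>0 + \<phi>1)"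
  by (rule K_fun_ge[OF assms refl]) simp

lemma restrict_fourier_distr_add:
  assumes "g \<in> weighted_L2 0" "h \<in> weighted_L2 0"
  shows "restrict_distr \<Omega> (fourier_distr g) + restrict_distr \<Omega> (fourier_distr h) = restrict_distr \<Omega> (fourier_distr (\<lambda>\<xi>. g \<xi> + h \<xi>))"
proof
  fix \<psi>
  show "(restrict_distr \<Omega> (fourier_distr g) + restrict_distr \<Omega> (fourier_distr h)) \<psi> = restrict_distr \<Omega> (fourier_distr (\<lambda>\<xi>. g \<xi> + h \<xi>)) \<psi>"
    using weighted_L2_mult_schwartz[OF assms(1) invfour_schwartz] weighted_L2_mult_schwartz[OF assms(2) invfour_schwartz]
    by (simp add: restrict_distr_def fourier_distr_def plus_fun_def distrib_right)
qed

lemma L2_space_carr: "carr (L2_space \<Omega>) = fun_distr \<Omega> ` L2_functions \<Omega>"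
  by (simp add: L2_space_def)

text \<open>Restriction contracts both end norms, so a splitting of the density bounds K with
  constant 1. With s = (t (1+xi^2))^2 the chosen parts minimise |g0|^2 + s |g1|^2 subject to g0 + g1
  = g.\<close>

lemma K_upper:
  assumes g: "g \<in> weighted_L2 0" and t: "t > 0"
  shows "(K_fun (L2_space {0<..<a}) (Sobolev {0<..<a} 2) t (restrict_distr {0<..<a} (fourier_distr g)))\<^sup>2 \<le> K_form t g"
    and "\<exists>\<phi>0\<in>carr (L2_space {0<..<a}). \<exists>\<phi>1\<in>carr (Sobolev {0<..<a} 2). \<phi>0 + \<phi>1 = restrict_distr {0<..<a} (fourier_distr g)"
proof -
  let ?\<Omega> = "{0<..<a}"
  have gm [measurable]: "g \<in> borel_measurable borel" using g by (simp add: weighted_L2_def)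
  let ?T = "\<lambda>\<xi>. t * (1 + \<xi>\<^sup>2)"
  have T: "1 + (?T \<xi>)\<^sup>2 > 0" for \<xi> by (simp add: add_pos_nonneg)
  define g0 where "g0 \<xi> = of_real (K_mult t \<xi>) * g \<xi>" for \<xi>
  define g1 where "g1 \<xi> = of_real (1 / (1 + (?T \<xi>)\<^sup>2)) * g \<xi>" for \<xi>
  have [measurable]: "g0 \<in> borel_measurable borel" "g1 \<in> borel_measurable borel"
    unfolding g0_def[abs_def] g1_def[abs_def] by measurable
  have one: "K_mult t \<xi> + 1 / (1 + (?T \<xi>)\<^sup>2) = 1" for \<xi>
    using T[of \<xi>] unfolding K_mult_def add_divide_distrib[symmetric] by simp
  have sum: "(\<lambda>\<xi>. g0 \<xi> + g1 \<xi>) = g"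
    unfolding g0_def g1_def distrib_right[symmetric] of_real_add[symmetric] one by simp
  have pt: "(cmod (g0 \<xi>))\<^sup>2 + t\<^sup>2 * ((1 + \<xi>\<^sup>2) powr 2 * (cmod (g1 \<xi>))\<^sup>2) = K_mult t \<xi> * (cmod (g \<xi>))\<^sup>2" for \<xi>
  proof -
    define s where "s = (?T \<xi>)\<^sup>2"
    have s: "1 + s > 0" using T by (simp add: s_def)
    have s_eq: "s = t\<^sup>2 * (1 + \<xi>\<^sup>2)\<^sup>2" by (simp add: s_def power_mult_distrib)
    have n1: "cmod (g1 \<xi>) = 1 / (1 + s) * cmod (g \<xi>)"
      unfolding g1_def norm_mult norm_of_real s_def[symmetric] using s by simp
    have n0: "cmod (g0 \<xi>) = s / (1 + s) * cmod (g \<xi>)"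
      unfolding g0_def norm_mult norm_of_real K_mult_def s_def[symmetric] using s by (simp add: s_eq)
    have "t\<^sup>2 * ((1 + \<xi>\<^sup>2) powr 2 * (cmod (g1 \<xi>))\<^sup>2) = (t\<^sup>2 * (1 + \<xi>\<^sup>2)\<^sup>2) * (1 / (1 + s))\<^sup>2 * (cmod (g \<xi>))\<^sup>2"
      unfolding n1 powr_2_one_plus_square power_mult_distrib by (simp only: mult.assoc)
    then have "t\<^sup>2 * ((1 + \<xi>\<^sup>2) powr 2 * (cmod (g1 \<xi>))\<^sup>2) = s * (1 / (1 + s))\<^sup>2 * (cmod (g \<xi>))\<^sup>2"
      unfolding s_eq[symmetric] .
    moreover have "(cmod (g0 \<xi>))\<^sup>2 = (s / (1 + s))\<^sup>2 * (cmod (g \<xi>))\<^sup>2"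
      unfolding n0 power_mult_distrib ..
    moreover have "(s / (1 + s))\<^sup>2 + s * (1 / (1 + s))\<^sup>2 = s / (1 + s)"
    proof -
      have "(s / (1 + s))\<^sup>2 + s * (1 / (1 + s))\<^sup>2 = s * (1 + s) / ((1 + s) * (1 + s))"
        by (simp add: power2_eq_square add_divide_distrib distrib_left)
      then show ?thesis using s by simp
    qed
    ultimately show ?thesis by (simp add: K_mult_def s_def[symmetric] distrib_right[symmetric])
  qed
  have le0: "(1 + \<xi>\<^sup>2) powr 0 * (cmod (g0 \<xi>))\<^sup>2 \<le> 1 * ((1 + \<xi>\<^sup>2) powr 0 * (cmod (g \<xi>))\<^sup>2)" for \<xi>
    using power_mono[of "cmod (g0 \<xi>)" "cmod (g \<xi>)" 2] K_mult_bounds[of t \<xi>]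
    by (simp add: g0_def norm_mult mult_left_le_one_le)
  \<comment> \<open>The multiplier of \<open>g1\<close> decays like xi^(-4), which lifts an L^2
    density to H^2 at the price 1/t^2.\<close>
  have le1: "(1 + \<xi>\<^sup>2) powr 2 * (cmod (g1 \<xi>))\<^sup>2 \<le> 1 / t\<^sup>2 * ((1 + \<xi>\<^sup>2) powr 0 * (cmod (g \<xi>))\<^sup>2)" for \<xi>
  proof -
    have "t\<^sup>2 * ((1 + \<xi>\<^sup>2) powr 2 * (cmod (g1 \<xi>))\<^sup>2) \<le> K_mult t \<xi> * (cmod (g \<xi>))\<^sup>2"
      using pt[of \<xi>] zero_le_power2[of "cmod (g0 \<xi>)"] by linarith
    also have "\<dots> \<le> 1 * (cmod (g \<xi>))\<^sup>2" by (intro mult_right_mono K_mult_bounds) simp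
    finally show ?thesis using t by (simp add: pos_le_divide_eq mult.commute)
  qed
  have g0: "g0 \<in> weighted_L2 0" by (rule weighted_L2_bound(1)[OF _ g le0]) simp
  have g1: "g1 \<in> weighted_L2 2" by (rule weighted_L2_bound(1)[OF _ g le1]) simp
  have g1': "g1 \<in> weighted_L2 0" using weighted_L2_mono[OF g1] by simp
  obtain f0 where f0: "f0 \<in> L2_functions ?\<Omega>" "restrict_distr ?\<Omega> (fourier_distr g0) = fun_distr ?\<Omega> f0"
    "(LINT x|lborel. (cmod (cut ?\<Omega> f0 x))\<^sup>2) \<le> weighted_norm2 0 g0"
    using L2_representation[OF g0] .
  have fourier_const: "restrict_distr ?\<Omega> (fourier_distr g0) \<in> carr (L2_space ?\<Omega>)" using f0 by (simp add: L2_space_carr)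
  have c1: "restrict_distr ?\<Omega> (fourier_distr g1) \<in> carr (Sobolev ?\<Omega> 2)" by (rule Sobolev_carrI[OF g1]) simp
  have add: "restrict_distr ?\<Omega> (fourier_distr g0) + restrict_distr ?\<Omega> (fourier_distr g1) = restrict_distr ?\<Omega> (fourier_distr g)"
    unfolding restrict_fourier_distr_add[OF g0 g1'] sum ..
  then show "\<exists>\<phi>0\<in>carr (L2_space ?\<Omega>). \<exists>\<phi>1\<in>carr (Sobolev ?\<Omega> 2). \<phi>0 + \<phi>1 = restrict_distr ?\<Omega> (fourier_distr g)"
    using fourier_const c1 by blast
  let ?K = "K_fun (L2_space ?\<Omega>) (Sobolev ?\<Omega> 2) t (restrict_distr ?\<Omega> (fourier_distr g))"
  let ?n0 = "nrm (L2_space ?\<Omega>) (restrict_distr ?\<Omega> (fourier_distr g0))" and ?n1 = "nrm (Sobolev ?\<Omega> 2) (restrict_distr ?\<Omega> (fourier_distr g1))"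
  have "0 \<le> ?K" using K_fun_nonneg[OF fourier_const c1] unfolding add .
  moreover have "?K \<le> sqrt (?n0\<^sup>2 + t\<^sup>2 * ?n1\<^sup>2)" using K_fun_le[OF fourier_const c1] unfolding add .
  ultimately have "?K\<^sup>2 \<le> (sqrt (?n0\<^sup>2 + t\<^sup>2 * ?n1\<^sup>2))\<^sup>2" by (intro power_mono)
  also have "\<dots> = ?n0\<^sup>2 + t\<^sup>2 * ?n1\<^sup>2" by simp
  also have "\<dots> \<le> weighted_norm2 0 g0 + t\<^sup>2 * weighted_norm2 2 g1"
  proof (intro add_mono mult_left_mono)
    show "?n0\<^sup>2 \<le> weighted_norm2 0 g0" using f0(3) unfolding f0(2) L2_space_nrm[OF f0(1)] by simp
    have "0 \<le> ?n1" by (rule Sobolev_nrm_ge[OF c1]) (simp_all add: weighted_norm2_nonneg)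
    moreover have "?n1 \<le> sqrt (weighted_norm2 2 g1)" by (rule Sobolev_nrm_le[OF g1]) simp
    ultimately have "?n1\<^sup>2 \<le> (sqrt (weighted_norm2 2 g1))\<^sup>2" by (intro power_mono)
    then show "?n1\<^sup>2 \<le> weighted_norm2 2 g1" by (simp add: weighted_norm2_nonneg)
  qed simp
  also have "\<dots> = (LINT \<xi>|lborel. (cmod (g0 \<xi>))\<^sup>2 + t\<^sup>2 * ((1 + \<xi>\<^sup>2) powr 2 * (cmod (g1 \<xi>))\<^sup>2))"
    using g0 g1 by (simp add: weighted_L2_0 weighted_norm2_0) (simp add: weighted_L2_def weighted_norm2_def)
  also have "\<dots> = K_form t g" unfolding pt K_form_def ..
  finally show "?K\<^sup>2 \<le> K_form t g" .
qed

lemma fourier_cong_AE: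
  assumes "f \<in> borel_measurable borel" "h \<in> borel_measurable borel" "AE x in lborel. f x = h x"
  shows "fourier f \<xi> = fourier h \<xi>"
proof -
  have "(LINT x|lborel. cis (- (\<xi> * x)) * f x) = (LINT x|lborel. cis (- (\<xi> * x)) * h x)"
    by (rule integral_cong_AE) (use assms in auto)
  then show ?thesis by (simp add: fourier_cis)
qed

text \<open>A splitting is an equation between distributions and fixes functions almost everywhere
  only; the transform of the extension must not see the difference.\<close>

lemma fourier_ext_cong:
  assumes a: "a > 0" and f: "f \<in> L2_functions {0<..<a}" and h: "h \<in> L2_functions {0<..<a}"
    and ae: "AE x in lborel. cut {0<..<a} f x = cut {0<..<a} h x"
  shows "fourier (ext a f) = fourier (ext a h)"
proof
  fix \<xi>
  have [measurable]: "cut {0<..<a} f \<in> borel_measurable borel" "cut {0<..<a} h \<in> borel_measurable borel"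
    using f h by (auto simp: L2_functions_cut)
  have ae': "AE x in lborel. cut {0<..<a} f (a - x) = cut {0<..<a} h (a - x)"
    using AE_borel_affine[of "-1" "\<lambda>x. cut {0<..<a} f x = cut {0<..<a} h x" a] ae by simp
  have 1: "fourier (tapered a f) \<eta> = fourier (tapered a h) \<eta>" for \<eta>
  proof (rule fourier_cong_AE)
    show "AE x in lborel. tapered a f x = tapered a h x" using ae by eventually_elim (simp add: tapered_cut)
  qed (simp_all add: tapered_cut[abs_def])
  have 2: "fourier (tapered a (\<lambda>y. f (a - y))) \<eta> = fourier (tapered a (\<lambda>y. h (a - y))) \<eta>" for \<eta>
  proof (rule fourier_cong_AE)
    show "AE x in lborel. tapered a (\<lambda>y. f (a - y)) x = tapered a (\<lambda>y. h (a - y)) x"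
      using ae' by eventually_elim (simp add: tapered_cut cut_flip)
  qed (simp_all add: tapered_cut[abs_def] cut_flip)
  note lf = tapered_L2(1)[OF a f] tapered_L2(1)[OF a L2_functions_flip(1)[OF f]]
  note lh = tapered_L2(1)[OF a h] tapered_L2(1)[OF a L2_functions_flip(1)[OF h]]
  show "fourier (ext a f) \<xi> = fourier (ext a h) \<xi>"
    unfolding fourier_ext[OF lf] fourier_ext[OF lh] fourier_refl_ext[OF lf(1)] fourier_refl_ext[OF lf(2)]
      fourier_refl_ext[OF lh(1)] fourier_refl_ext[OF lh(2)] 1 2 ..
qed

lemma ext_add: "ext a (\<lambda>x. f x + h x) x = ext a f x + ext a h x"
  by (simp add: ext_def refl_ext_def tapered_def cut_def algebra_simps)

lemma L2_functions_add:
  assumes "f \<in> L2_functions {0<..<a}" "h \<in> L2_functions {0<..<a}"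
  shows "(\<lambda>x. f x + h x) \<in> L2_functions {0<..<a}"
    and "fun_distr {0<..<a} f + fun_distr {0<..<a} h = fun_distr {0<..<a} (\<lambda>x. f x + h x)"
proof -
  have c: "cut {0<..<a} (\<lambda>x. f x + h x) x = cut {0<..<a} f x + cut {0<..<a} h x" for x
    by (simp add: cut_def algebra_simps)
  have "cut {0<..<a} f \<in> weighted_L2 0" "cut {0<..<a} h \<in> weighted_L2 0"
    using assms by (auto simp: L2_functions_cut weighted_L2_0)
  from weighted_L2_add(1)[OF this] show "(\<lambda>x. f x + h x) \<in> L2_functions {0<..<a}"
    unfolding L2_functions_cut c[abs_def] weighted_L2_0 .
  show "fun_distr {0<..<a} f + fun_distr {0<..<a} h = fun_distr {0<..<a} (\<lambda>x. f x + h x)"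
  proof
    fix \<phi>
    show "(fun_distr {0<..<a} f + fun_distr {0<..<a} h) \<phi> = fun_distr {0<..<a} (\<lambda>x. f x + h x) \<phi>"
    proof (cases "\<phi> \<in> test_functions {0<..<a}")
      case True
      then have s: "\<phi> \<in> schwartz" using test_functions_schwartz by blast
      show ?thesis
        using integrable_mult_schwartz[OF L2_cut_integrable[OF assms(1)] s] integrable_mult_schwartz[OF L2_cut_integrable[OF assms(2)] s]
        by (simp add: plus_fun_def fun_distr_cut[OF True] c distrib_right)
    qed (simp add: plus_fun_def fun_distr_def)
  qed
qed

text \<open>Converse of the pointwise splitting: with s = t (1+xi^2), p = |A| and q = |B|, the
  inequality at one frequency comes down to (p - s^2 q)^2 >= 0 after the triangle
  inequality.\<close>

lemma K_form_split:
  assumes A: "A \<in> weighted_L2 0" and B: "B \<in> weighted_L2 2"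
  shows "K_form t (\<lambda>\<xi>. A \<xi> + B \<xi>) \<le> weighted_norm2 0 A + t\<^sup>2 * weighted_norm2 2 B"
proof -
  have B0: "B \<in> weighted_L2 0" using weighted_L2_mono[OF B] by simp
  have pt: "K_mult t \<xi> * (cmod (A \<xi> + B \<xi>))\<^sup>2 \<le> (cmod (A \<xi>))\<^sup>2 + t\<^sup>2 * ((1 + \<xi>\<^sup>2) powr 2 * (cmod (B \<xi>))\<^sup>2)" for \<xi>
  proof -
    define s where "s = t * (1 + \<xi>\<^sup>2)"
    define p q where "p = cmod (A \<xi>)" and "q = cmod (B \<xi>)"
    have pos: "1 + s\<^sup>2 > 0" by (simp add: add_pos_nonneg)
    have "s\<^sup>2 * (p + q)\<^sup>2 \<le> (1 + s\<^sup>2) * (p\<^sup>2 + s\<^sup>2 * q\<^sup>2)"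
      using zero_le_power2[of "p - s\<^sup>2 * q"] by (simp add: power2_eq_square algebra_simps)
    then have "s\<^sup>2 / (1 + s\<^sup>2) * (p + q)\<^sup>2 \<le> p\<^sup>2 + s\<^sup>2 * q\<^sup>2"
      using pos by (simp add: pos_divide_le_eq mult.commute)
    moreover have "K_mult t \<xi> * (cmod (A \<xi> + B \<xi>))\<^sup>2 \<le> K_mult t \<xi> * (p + q)\<^sup>2"
      unfolding p_def q_def by (intro mult_left_mono power_mono norm_triangle_ineq K_mult_bounds) simp
    ultimately have "K_mult t \<xi> * (cmod (A \<xi> + B \<xi>))\<^sup>2 \<le> p\<^sup>2 + s\<^sup>2 * q\<^sup>2"
      by (simp add: K_mult_def s_def)
    then show ?thesis unfolding powr_2_one_plus_square by (simp add: s_def p_def q_def power_mult_distrib mult.assoc)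
  qed
  have iA: "integrable lborel (\<lambda>\<xi>. (cmod (A \<xi>))\<^sup>2)" using A by (simp add: weighted_L2_0)
  have iB: "integrable lborel (\<lambda>\<xi>. t\<^sup>2 * ((1 + \<xi>\<^sup>2) powr 2 * (cmod (B \<xi>))\<^sup>2))" using B by (simp add: weighted_L2_def)
  have "K_form t (\<lambda>\<xi>. A \<xi> + B \<xi>) \<le> (LINT \<xi>|lborel. (cmod (A \<xi>))\<^sup>2 + t\<^sup>2 * ((1 + \<xi>\<^sup>2) powr 2 * (cmod (B \<xi>))\<^sup>2))"
    unfolding K_form_def
    by (rule integral_mono[OF K_form_integrable[OF weighted_L2_add(1)[OF A B0]] Bochner_Integration.integrable_add[OF iA iB] pt])
  also have "\<dots> = weighted_norm2 0 A + t\<^sup>2 * weighted_norm2 2 B"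
    unfolding weighted_norm2_0 weighted_norm2_def by (subst Bochner_Integration.integral_add[OF iA iB]) simp
  finally show ?thesis .
qed

text \<open>A common bound for the extension on L^2 and on H^2, each of which is one of the
  summands.\<close>

definition ext_const :: "real \<Rightarrow> real" where "ext_const a = 672 + 4 * H2_const a"

lemma ext_const_pos: "ext_const a > 0"
  by (simp add: ext_const_def H2_const_def add_pos_nonneg)

text \<open>The linear map \<open>ext\<close> carries any splitting on the interval to a splitting
  on the line, where \<open>K_form_split\<close> applies to the two extended parts.\<close>

lemma K_lower:
  assumes a: "a > 0" and f: "f \<in> L2_functions {0<..<a}" and t: "t > 0"
    and "\<phi>0 \<in> carr (L2_space {0<..<a})" "\<phi>1 \<in> carr (Sobolev {0<..<a} 2)" "\<phi>0 + \<phi>1 = fun_distr {0<..<a} f"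
  shows "K_form t (fourier (ext a f)) \<le> ext_const a * (K_fun (L2_space {0<..<a}) (Sobolev {0<..<a} 2) t (fun_distr {0<..<a} f))\<^sup>2"
proof -
  let ?\<Omega> = "{0<..<a}" and ?C = "ext_const a"
  define Q where "Q = K_form t (fourier (ext a f))"
  have Q0: "0 \<le> Q" unfolding Q_def K_form_def
    by (intro Bochner_Integration.integral_nonneg mult_nonneg_nonneg K_mult_bounds) simp
  note C = ext_const_pos[of a]
  have main: "Q / ?C \<le> (nrm (L2_space ?\<Omega>) \<phi>0)\<^sup>2 + t\<^sup>2 * (nrm (Sobolev ?\<Omega> 2) \<phi>1)\<^sup>2"
    if \<phi>0: "\<phi>0 \<in> carr (L2_space ?\<Omega>)" and \<phi>1: "\<phi>1 \<in> carr (Sobolev ?\<Omega> 2)" and sum: "\<phi>0 + \<phi>1 = fun_distr ?\<Omega> f" for \<phi>0 \<phi>1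
  proof -
    obtain f0 where f0: "f0 \<in> L2_functions ?\<Omega>" "\<phi>0 = fun_distr ?\<Omega> f0" using \<phi>0 by (auto simp: L2_space_carr)
    define n0 where "n0 = nrm (L2_space ?\<Omega>) \<phi>0"
    have n0: "n0\<^sup>2 = (LINT x|lborel. (cmod (cut ?\<Omega> f0 x))\<^sup>2)"
      unfolding n0_def f0(2) L2_space_nrm[OF f0(1)] by simp
    \<comment> \<open>The H^2 norm of \<open>\<phi>1\<close> is an infimum, so the estimate is first
      proved for each single density of \<open>\<phi>1\<close>.\<close>
    have step: "Q / ?C \<le> n0\<^sup>2 + t\<^sup>2 * weighted_norm2 2 g" if g: "g \<in> weighted_L2 2" "\<phi>1 = restrict_distr ?\<Omega> (fourier_distr g)" for g
    proof -
      have ig: "integrable lborel g" using g weighted_L2_mono weighted_L2_integrable by (metis one_le_numeral)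
      have f1: "invfour g \<in> L2_functions ?\<Omega>"
        by (rule cut_continuous_L2) (use invfour_isCont[OF ig] in \<open>auto intro: continuous_at_imp_continuous_on\<close>)
      have "\<phi>1 = fun_distr ?\<Omega> (invfour g)" unfolding g(2) by (rule restrict_fourier_distr_L1[OF ig])
      then have eq: "fun_distr ?\<Omega> f = fun_distr ?\<Omega> (\<lambda>x. f0 x + invfour g x)"
        using sum f0(2) L2_functions_add(2)[OF f0(1) f1] by simp
      note fs = L2_functions_add(1)[OF f0(1) f1]
      have "fourier (ext a f) = fourier (ext a (\<lambda>x. f0 x + invfour g x))"
        by (rule fourier_ext_cong[OF a f fs fun_distr_unique[OF L2_cut_integrable[OF f] L2_cut_integrable[OF fs] eq]])
      also have "\<dots> = (\<lambda>\<xi>. fourier (ext a f0) \<xi> + fourier (ext a (invfour g)) \<xi>)"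
        unfolding ext_add[abs_def] using fourier_add[OF ext_integrable[OF a f0(1)] ext_integrable[OF a f1]] by (simp add: fun_eq_iff)
      finally have "Q = K_form t (\<lambda>\<xi>. fourier (ext a f0) \<xi> + fourier (ext a (invfour g)) \<xi>)" by (simp add: Q_def)
      also have "\<dots> \<le> weighted_norm2 0 (fourier (ext a f0)) + t\<^sup>2 * weighted_norm2 2 (fourier (ext a (invfour g)))"
        by (rule K_form_split[OF fourier_ext_L2(1)[OF a f0(1)] fourier_ext_H2(1)[OF a g(1)]])
      also have "\<dots> \<le> ?C * n0\<^sup>2 + t\<^sup>2 * (?C * weighted_norm2 2 g)"
      proof (intro add_mono mult_left_mono)
        have H: "H2_const a \<ge> 0" by (simp add: H2_const_def)
        have "672 * n0\<^sup>2 \<le> ?C * n0\<^sup>2" using H by (intro mult_right_mono) (auto simp: ext_const_def)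
        then show "weighted_norm2 0 (fourier (ext a f0)) \<le> ?C * n0\<^sup>2"
          using fourier_ext_L2(2)[OF a f0(1)] n0 by linarith
        have "4 * H2_const a * weighted_norm2 2 g \<le> ?C * weighted_norm2 2 g"
          by (intro mult_right_mono weighted_norm2_nonneg) (simp add: ext_const_def)
        then show "weighted_norm2 2 (fourier (ext a (invfour g))) \<le> ?C * weighted_norm2 2 g"
          using fourier_ext_H2(2)[OF a g(1)] by linarith
      qed simp
      also have "\<dots> = ?C * (n0\<^sup>2 + t\<^sup>2 * weighted_norm2 2 g)" by (simp add: algebra_simps)
      finally show ?thesis using C by (simp add: pos_divide_le_eq mult.commute)
    qed
    \<comment> \<open>Solves \<open>step\<close> for the norm of the density, giving a bound that
      passes to the infimum; \<open>max 0\<close> covers the case that the L^2 part alone already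
      suffices.\<close>
    define L where "L = sqrt (max 0 (Q / ?C - n0\<^sup>2)) / t"
    have "L \<le> nrm (Sobolev ?\<Omega> 2) \<phi>1"
    proof (rule Sobolev_nrm_ge[OF \<phi>1])
      fix g assume g: "g \<in> weighted_L2 2" "\<phi>1 = restrict_distr ?\<Omega> (fourier_distr g)"
      have "max 0 (Q / ?C - n0\<^sup>2) \<le> t\<^sup>2 * weighted_norm2 2 g"
        using step[OF g] mult_nonneg_nonneg[OF zero_le_power2[of t] weighted_norm2_nonneg[of 2 g]] by simp
      then have "sqrt (max 0 (Q / ?C - n0\<^sup>2)) \<le> sqrt (t\<^sup>2 * weighted_norm2 2 g)" by (rule real_sqrt_le_mono)
      then show "L \<le> sqrt (weighted_norm2 2 g)"
        using t by (simp add: L_def real_sqrt_mult pos_divide_le_eq mult.commute)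
    qed simp
    moreover have "0 \<le> L" using t by (simp add: L_def)
    ultimately have "L\<^sup>2 \<le> (nrm (Sobolev ?\<Omega> 2) \<phi>1)\<^sup>2" by (intro power_mono)
    then have "t\<^sup>2 * L\<^sup>2 \<le> t\<^sup>2 * (nrm (Sobolev ?\<Omega> 2) \<phi>1)\<^sup>2" by (intro mult_left_mono) auto
    moreover have "t\<^sup>2 * L\<^sup>2 = max 0 (Q / ?C - n0\<^sup>2)" using t by (simp add: L_def power_divide)
    ultimately show ?thesis unfolding n0_def by linarith
  qed
  have "sqrt (Q / ?C) \<le> K_fun (L2_space ?\<Omega>) (Sobolev ?\<Omega> 2) t (fun_distr ?\<Omega> f)"
    by (rule K_fun_ge[OF assms(4-6)]) (intro real_sqrt_le_mono main)
  then have "(sqrt (Q / ?C))\<^sup>2 \<le> (K_fun (L2_space ?\<Omega>) (Sobolev ?\<Omega> 2) t (fun_distr ?\<Omega> f))\<^sup>2"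
    by (intro power_mono) (use Q0 C in auto)
  then have "Q / ?C \<le> (K_fun (L2_space ?\<Omega>) (Sobolev ?\<Omega> 2) t (fun_distr ?\<Omega> f))\<^sup>2" using Q0 C by simp
  then show ?thesis using C by (simp add: Q_def pos_divide_le_eq mult.commute)
qed

text \<open>The K-integral of a single frequency of weight 1, which \<open>theta_scale\<close>
  factors out for any other weight. What enters the norm estimates is that it is finite and
  positive.\<close>

definition theta_const :: "real \<Rightarrow> ennreal" where
  "theta_const \<theta> = (\<integral>\<^sup>+t. ennreal (t powr (-2 * \<theta> - 1) * (t\<^sup>2 / (1 + t\<^sup>2))) * indicator {0<..} t \<partial>lborel)"

text \<open>The integrand is at most t^(1 - 2 theta) up to 1 and t^(-2 theta - 1) beyond; the first
  is integrable at 0 because theta < 1, the second at infinity because theta > 0.\<close>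

lemma theta_const_bounds:
  assumes \<theta>: "0 < \<theta>" "\<theta> < 1"
  shows "theta_const \<theta> < \<infinity>" "theta_const \<theta> > 0"
proof -
  have 1: "(\<integral>\<^sup>+t. ennreal (t powr (1 - 2 * \<theta>)) * indicator {0..1} t \<partial>lborel) = ennreal (1 powr ((1 - 2 * \<theta>) + 1) / ((1 - 2 * \<theta>) + 1))"
    by (rule nn_integral_has_integral_lebesgue'[OF _ has_integral_powr_from_0]) (use \<theta> in auto)
  have 2: "(\<integral>\<^sup>+t. ennreal (t powr (-2 * \<theta> - 1)) * indicator {1..} t \<partial>lborel) = ennreal (- (1 powr ((-2 * \<theta> - 1) + 1)) / ((-2 * \<theta> - 1) + 1))"
    by (rule nn_integral_has_integral_lebesgue'[OF _ has_integral_powr_to_inf]) (use \<theta> in auto)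
  have "theta_const \<theta> \<le> (\<integral>\<^sup>+t. ennreal (t powr (1 - 2 * \<theta>)) * indicator {0..1} t + ennreal (t powr (-2 * \<theta> - 1)) * indicator {1..} t \<partial>lborel)"
    unfolding theta_const_def
  proof (rule nn_integral_mono)
    fix t :: real
    have pos: "1 + t\<^sup>2 > 0" by (simp add: add_pos_nonneg)
    show "ennreal (t powr (-2 * \<theta> - 1) * (t\<^sup>2 / (1 + t\<^sup>2))) * indicator {0<..} t
      \<le> ennreal (t powr (1 - 2 * \<theta>)) * indicator {0..1} t + ennreal (t powr (-2 * \<theta> - 1)) * indicator {1..} t"
    proof (cases "t > 0")
      case True
      have le1: "t\<^sup>2 / (1 + t\<^sup>2) \<le> 1" and le2: "t\<^sup>2 / (1 + t\<^sup>2) \<le> t\<^sup>2"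
        using pos by (simp_all add: pos_divide_le_eq distrib_left)
      show ?thesis
      proof (cases "t \<le> 1")
        case t1: True
        have "t powr (-2 * \<theta> - 1) * (t\<^sup>2 / (1 + t\<^sup>2)) \<le> t powr (-2 * \<theta> - 1) * t\<^sup>2"
          by (intro mult_left_mono le2) simp
        also have "\<dots> = t powr (-2 * \<theta> - 1) * t powr 2" using True by (simp add: powr_numeral)
        also have "\<dots> = t powr (1 - 2 * \<theta>)" by (simp add: powr_add[symmetric] algebra_simps)
        finally show ?thesis using True t1 by (simp add: ennreal_leI add_increasing2)
      next
        case False
        have "t powr (-2 * \<theta> - 1) * (t\<^sup>2 / (1 + t\<^sup>2)) \<le> t powr (-2 * \<theta> - 1) * 1"
          by (intro mult_left_mono le1) simp
        then show ?thesis using True False by (simp add: ennreal_leI)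
      qed
    qed simp
  qed
  also have "\<dots> < \<infinity>" by (subst nn_integral_add) (auto simp: 1[simplified] 2[simplified])
  finally show "theta_const \<theta> < \<infinity>" .
  have "theta_const \<theta> \<noteq> 0"
  proof
    assume "theta_const \<theta> = 0"
    then have "AE t in lborel. ennreal (t powr (-2 * \<theta> - 1) * (t\<^sup>2 / (1 + t\<^sup>2))) * indicator {0<..} t = 0"
      unfolding theta_const_def by (subst (asm) nn_integral_0_iff_AE) auto
    then have "AE t in lborel. t \<notin> {0<..<(1::real)}"
    proof eventually_elim
      case (elim t)
      show ?case
      proof
        assume "t \<in> {0<..<1}"
        then have "t powr (-2 * \<theta> - 1) * (t\<^sup>2 / (1 + t\<^sup>2)) > 0" by (intro mult_pos_pos divide_pos_pos add_pos_nonneg) auto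
        then show False using elim \<open>t \<in> {0<..<1}\<close> by (auto simp: ennreal_eq_0_iff)
      qed
    qed
    moreover have "{x \<in> space lborel. \<not> x \<notin> {0<..<(1::real)}} = {0<..<1}" by auto
    ultimately have "emeasure lborel {0<..<(1::real)} = 0"
      using AE_iff_measurable[of "{0<..<1}" lborel "\<lambda>t. t \<notin> {0<..<(1::real)}"] by auto
    then show False by simp
  qed
  then show "theta_const \<theta> > 0" by (simp add: zero_less_iff_neq_zero)
qed

text \<open>Substitution of t w for t: the measure dt/t is invariant, and t^(-2 theta) releases the
  power of w.\<close>

lemma theta_scale:
  assumes w: "w > 0"
  shows "(\<integral>\<^sup>+t. ennreal (t powr (-2 * \<theta> - 1) * ((t * w)\<^sup>2 / (1 + (t * w)\<^sup>2))) * indicator {0<..} t \<partial>lborel) = ennreal (w powr (2 * \<theta>)) * theta_const \<theta>"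
proof -
  let ?h = "\<lambda>t. ennreal (t powr (-2 * \<theta> - 1) * (t\<^sup>2 / (1 + t\<^sup>2))) * indicator {0<..} t"
  have "theta_const \<theta> = ennreal \<bar>w\<bar> * (\<integral>\<^sup>+t. ?h (0 + w * t) \<partial>lborel)"
    unfolding theta_const_def by (rule nn_integral_real_affine) (use w in auto)
  then have "ennreal (w powr (2 * \<theta>)) * theta_const \<theta> = ennreal (w powr (2 * \<theta>)) * (ennreal w * (\<integral>\<^sup>+t. ?h (w * t) \<partial>lborel))"
    using w by simp
  also have "\<dots> = (\<integral>\<^sup>+t. ennreal (w powr (2 * \<theta>)) * (ennreal w * ?h (w * t)) \<partial>lborel)"
    by (simp add: nn_integral_cmult)
  also have "\<dots> = (\<integral>\<^sup>+t. ennreal (t powr (-2 * \<theta> - 1) * ((t * w)\<^sup>2 / (1 + (t * w)\<^sup>2))) * indicator {0<..} t \<partial>lborel)"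
  proof (rule nn_integral_cong)
    fix t :: real
    show "ennreal (w powr (2 * \<theta>)) * (ennreal w * ?h (w * t)) = ennreal (t powr (-2 * \<theta> - 1) * ((t * w)\<^sup>2 / (1 + (t * w)\<^sup>2))) * indicator {0<..} t"
    proof (cases "t > 0")
      case True
      have "w powr (2 * \<theta>) * (w * (w * t) powr (-2 * \<theta> - 1)) = (w powr (2 * \<theta>) * w powr 1 * w powr (-2 * \<theta> - 1)) * t powr (-2 * \<theta> - 1)"
        using w True by (simp add: powr_mult)
      also have "w powr (2 * \<theta>) * w powr 1 * w powr (-2 * \<theta> - 1) = 1"
        unfolding powr_add[symmetric] using w by simp
      finally have e: "w powr (2 * \<theta>) * (w * (w * t) powr (-2 * \<theta> - 1)) = t powr (-2 * \<theta> - 1)" by simp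
      have "w powr (2 * \<theta>) * (w * ((w * t) powr (-2 * \<theta> - 1) * ((w * t)\<^sup>2 / (1 + (w * t)\<^sup>2)))) = t powr (-2 * \<theta> - 1) * ((t * w)\<^sup>2 / (1 + (t * w)\<^sup>2))"
        unfolding e[symmetric] by (simp only: mult.commute[of t w] mult.assoc)
      moreover have "w * t > 0" using w True by simp
      ultimately show ?thesis using w True by (simp add: ennreal_mult'[symmetric])
    next
      case False
      then have "\<not> w * t > 0" using w by (simp add: zero_less_mult_iff)
      then show ?thesis using False by simp
    qed
  qed
  finally show ?thesis ..
qed

text \<open>Fubini and \<open>theta_scale\<close> with w = 1 + xi^2. The identity is stated in
  \<open>ennreal\<close> because finiteness of the left side has to yield membership of a density in
  the weighted space.\<close>

lemma K_form_nn_integral: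
  assumes g: "g \<in> weighted_L2 0"
  shows "(\<integral>\<^sup>+t. ennreal (t powr (-2 * \<theta> - 1) * K_form t g) * indicator {0<..} t \<partial>lborel)
    = theta_const \<theta> * (\<integral>\<^sup>+\<xi>. ennreal ((1 + \<xi>\<^sup>2) powr (2 * \<theta>) * (cmod (g \<xi>))\<^sup>2) \<partial>lborel)"
proof -
  have [measurable]: "g \<in> borel_measurable borel" using g by (simp add: weighted_L2_def)
  have "ennreal (t powr (-2 * \<theta> - 1) * K_form t g) * indicator {0<..} t
      = (\<integral>\<^sup>+\<xi>. ennreal ((cmod (g \<xi>))\<^sup>2) * (ennreal (t powr (-2 * \<theta> - 1) * K_mult t \<xi>) * indicator {0<..} t) \<partial>lborel)" for t
  proof -
    have "ennreal (K_form t g) = (\<integral>\<^sup>+\<xi>. ennreal (K_mult t \<xi> * (cmod (g \<xi>))\<^sup>2) \<partial>lborel)"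
      unfolding K_form_def by (rule nn_integral_eq_integral[symmetric, OF K_form_integrable[OF g]]) (auto simp: K_mult_bounds)
    then have "ennreal (t powr (-2 * \<theta> - 1) * K_form t g) * indicator {0<..} t
       = (\<integral>\<^sup>+\<xi>. ennreal (K_mult t \<xi> * (cmod (g \<xi>))\<^sup>2) \<partial>lborel) * (ennreal (t powr (-2 * \<theta> - 1)) * indicator {0<..} t)"
      by (subst ennreal_mult') (simp_all add: mult_ac)
    also have "\<dots> = (\<integral>\<^sup>+\<xi>. ennreal (K_mult t \<xi> * (cmod (g \<xi>))\<^sup>2) * (ennreal (t powr (-2 * \<theta> - 1)) * indicator {0<..} t) \<partial>lborel)"
      by (rule nn_integral_multc[symmetric]) simp
    also have "\<dots> = (\<integral>\<^sup>+\<xi>. ennreal ((cmod (g \<xi>))\<^sup>2) * (ennreal (t powr (-2 * \<theta> - 1) * K_mult t \<xi>) * indicator {0<..} t) \<partial>lborel)"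
      by (intro nn_integral_cong) (simp add: ennreal_mult' K_mult_bounds mult_ac)
    finally show ?thesis .
  qed
  then have "(\<integral>\<^sup>+t. ennreal (t powr (-2 * \<theta> - 1) * K_form t g) * indicator {0<..} t \<partial>lborel)
    = (\<integral>\<^sup>+t. (\<integral>\<^sup>+\<xi>. ennreal ((cmod (g \<xi>))\<^sup>2) * (ennreal (t powr (-2 * \<theta> - 1) * K_mult t \<xi>) * indicator {0<..} t) \<partial>lborel) \<partial>lborel)"
    by simp
  also have "\<dots> = (\<integral>\<^sup>+\<xi>. (\<integral>\<^sup>+t. ennreal ((cmod (g \<xi>))\<^sup>2) * (ennreal (t powr (-2 * \<theta> - 1) * K_mult t \<xi>) * indicator {0<..} t) \<partial>lborel) \<partial>lborel)"
    by (rule lborel_pair.Fubini') (simp add: K_mult_def)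
  also have "\<dots> = (\<integral>\<^sup>+\<xi>. ennreal ((cmod (g \<xi>))\<^sup>2) * (ennreal ((1 + \<xi>\<^sup>2) powr (2 * \<theta>)) * theta_const \<theta>) \<partial>lborel)"
  proof (rule nn_integral_cong)
    fix \<xi> :: real
    have "1 + \<xi>\<^sup>2 > 0" by (simp add: add_pos_nonneg)
    from theta_scale[OF this, of \<theta>]
    show "(\<integral>\<^sup>+t. ennreal ((cmod (g \<xi>))\<^sup>2) * (ennreal (t powr (-2 * \<theta> - 1) * K_mult t \<xi>) * indicator {0<..} t) \<partial>lborel)
       = ennreal ((cmod (g \<xi>))\<^sup>2) * (ennreal ((1 + \<xi>\<^sup>2) powr (2 * \<theta>)) * theta_const \<theta>)"
      unfolding K_mult_def by (subst nn_integral_cmult) auto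
  qed
  also have "\<dots> = (\<integral>\<^sup>+\<xi>. theta_const \<theta> * ennreal ((1 + \<xi>\<^sup>2) powr (2 * \<theta>) * (cmod (g \<xi>))\<^sup>2) \<partial>lborel)"
    by (intro nn_integral_cong) (simp add: ennreal_mult' mult_ac)
  also have "\<dots> = theta_const \<theta> * (\<integral>\<^sup>+\<xi>. ennreal ((1 + \<xi>\<^sup>2) powr (2 * \<theta>) * (cmod (g \<xi>))\<^sup>2) \<partial>lborel)"
    by (rule nn_integral_cmult) simp
  finally show ?thesis .
qed

lemma interp_integrand:
  fixes t \<theta> k :: real
  assumes "t > 0" shows "\<bar>t powr (-\<theta>) * k\<bar>\<^sup>2 / t = t powr (-2 * \<theta> - 1) * k\<^sup>2"
proof -
  have inv: "inverse t = t powr (-1)" using assms by (simp add: powr_minus)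
  have e: "-2 * \<theta> - 1 = -\<theta> + -\<theta> + -1" by simp
  have "\<bar>t powr (-\<theta>) * k\<bar>\<^sup>2 / t = (t powr (-\<theta>) * t powr (-\<theta>) * inverse t) * k\<^sup>2"
    by (simp add: power2_eq_square divide_inverse mult_ac)
  then show ?thesis unfolding inv e by (simp only: powr_add)
qed

lemma interp_const_pos: "0 < \<theta> \<Longrightarrow> \<theta> < 1 \<Longrightarrow> interp_const \<theta> > 0"
  unfolding interp_const_def by (simp add: sin_gt_zero)

text \<open>A density of order 2 theta bounds the K-integral by splitting it; conversely the
  extension of an interpolation element supplies a density whose norm the K-integral bounds. Both
  inclusions carry a norm estimate, hence equivalence.\<close>

theorem interp_L2_H2:
  assumes a: "a > 0" and \<theta>: "0 < \<theta>" "\<theta> < 1"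
  shows "eq_space (interp (L2_space {0<..<a}) (Sobolev {0<..<a} 2) \<theta>) (Sobolev {0<..<a} (2 * \<theta>))"
proof -
  let ?\<Omega> = "{0<..<a}"
  let ?X = "interp (L2_space ?\<Omega>) (Sobolev ?\<Omega> 2) \<theta>" and ?Y = "Sobolev ?\<Omega> (2 * \<theta>)"
  let ?I = "interp_integral (L2_space ?\<Omega>) (Sobolev ?\<Omega> 2) \<theta>"
  let ?K = "K_fun (L2_space ?\<Omega>) (Sobolev ?\<Omega> 2)"
  let ?C = "ext_const a"
  obtain c where c: "c > 0" "theta_const \<theta> = ennreal c"
    using theta_const_bounds[OF \<theta>] by (cases "theta_const \<theta>" rule: ennreal_cases) auto
  define k where "k = interp_const \<theta>"
  have k: "k > 0" using interp_const_pos[OF \<theta>] by (simp add: k_def)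
  have nn: "(\<integral>\<^sup>+\<xi>. ennreal ((1 + \<xi>\<^sup>2) powr s * (cmod (g \<xi>))\<^sup>2) \<partial>lborel) = ennreal (weighted_norm2 s g)" if "g \<in> weighted_L2 s" for s g
    unfolding weighted_norm2_def by (rule nn_integral_eq_integral) (use that in \<open>auto simp: weighted_L2_def\<close>)
  have I_eq: "?I u = (\<integral>\<^sup>+t. ennreal (t powr (-2 * \<theta> - 1) * (?K t u)\<^sup>2) * indicator {0<..} t \<partial>lborel)" for u
    unfolding interp_integral_def
  proof (rule nn_integral_cong)
    fix t :: real
    show "ennreal (\<bar>t powr (-\<theta>) * ?K t u\<bar>\<^sup>2 / t) * indicator {0<..} t = ennreal (t powr (-2 * \<theta> - 1) * (?K t u)\<^sup>2) * indicator {0<..} t"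
    proof (cases "t > 0")
      case True
      show ?thesis unfolding interp_integrand[OF True] ..
    qed simp
  qed
  have upper: "restrict_distr ?\<Omega> (fourier_distr g) \<in> carr ?X \<and> nrm ?X (restrict_distr ?\<Omega> (fourier_distr g)) \<le> k * sqrt c * sqrt (weighted_norm2 (2 * \<theta>) g)"
    if g: "g \<in> weighted_L2 (2 * \<theta>)" for g
  proof -
    have g0: "g \<in> weighted_L2 0" using weighted_L2_mono[OF g] \<theta> by simp
    have "?I (restrict_distr ?\<Omega> (fourier_distr g)) \<le> (\<integral>\<^sup>+t. ennreal (t powr (-2 * \<theta> - 1) * K_form t g) * indicator {0<..} t \<partial>lborel)"
      unfolding I_eq
      by (intro nn_integral_mono) (auto simp: indicator_def intro!: ennreal_leI mult_left_mono K_upper(1)[OF g0])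
    also have "\<dots> = ennreal (c * weighted_norm2 (2 * \<theta>) g)"
      unfolding K_form_nn_integral[OF g0] nn[OF g] c(2) using c(1) by (simp add: ennreal_mult')
    finally have I: "?I (restrict_distr ?\<Omega> (fourier_distr g)) \<le> ennreal (c * weighted_norm2 (2 * \<theta>) g)" .
    have "enn2real (?I (restrict_distr ?\<Omega> (fourier_distr g))) \<le> c * weighted_norm2 (2 * \<theta>) g"
      using enn2real_mono[OF I] c(1) weighted_norm2_nonneg[of "2 * \<theta>" g] by simp
    then have "sqrt (enn2real (?I (restrict_distr ?\<Omega> (fourier_distr g)))) \<le> sqrt c * sqrt (weighted_norm2 (2 * \<theta>) g)"
      using real_sqrt_le_mono by (fastforce simp: real_sqrt_mult)
    then have "nrm ?X (restrict_distr ?\<Omega> (fourier_distr g)) \<le> k * sqrt c * sqrt (weighted_norm2 (2 * \<theta>) g)"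
      using k by (simp add: interp_def k_def[symmetric] mult.assoc)
    moreover have "?I (restrict_distr ?\<Omega> (fourier_distr g)) < \<infinity>" using I by (auto intro: le_less_trans)
    ultimately show ?thesis using K_upper(2)[OF g0, of 1 a] by (simp add: interp_def)
  qed
  have lower: "u \<in> carr ?Y \<and> nrm ?Y u \<le> sqrt (?C / c) / k * nrm ?X u" if u: "u \<in> carr ?X" for u
  proof -
    obtain \<phi>0 \<phi>1 where \<phi>: "\<phi>0 \<in> carr (L2_space ?\<Omega>)" "\<phi>1 \<in> carr (Sobolev ?\<Omega> 2)" "\<phi>0 + \<phi>1 = u" and fin: "?I u < \<infinity>"
      using u by (auto simp: interp_def)
    obtain f0 where f0: "f0 \<in> L2_functions ?\<Omega>" "\<phi>0 = fun_distr ?\<Omega> f0" using \<phi>(1) by (auto simp: L2_space_carr)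
    obtain g where g: "g \<in> weighted_L2 2" "\<phi>1 = restrict_distr ?\<Omega> (fourier_distr g)" using Sobolev_carrE[OF \<phi>(2)] .
    have "g \<in> weighted_L2 0" using weighted_L2_mono[OF g(1)] by simp
    from L2_representation[OF this] obtain f1 where f1: "f1 \<in> L2_functions ?\<Omega>" "\<phi>1 = fun_distr ?\<Omega> f1"
      using g(2) by metis
    define f where "f = (\<lambda>x. f0 x + f1 x)"
    have f: "f \<in> L2_functions ?\<Omega>" "u = fun_distr ?\<Omega> f"
      using L2_functions_add[OF f0(1) f1(1)] \<phi>(3) f0(2) f1(2) by (simp_all add: f_def)
    define V where "V = fourier (ext a f)"
    have V0: "V \<in> weighted_L2 0" unfolding V_def by (rule fourier_ext_L2(1)[OF a f(1)])
    define q where "q = sqrt ?C"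
    have q: "q > 0" "q\<^sup>2 = ?C" using ext_const_pos[of a] by (simp_all add: q_def)
    \<comment> \<open>Dividing by the square root of \<open>ext_const a\<close> absorbs the
      extension constant, so that the K-integral of \<open>u\<close> dominates that of
      \<open>W\<close> with constant 1.\<close>
    define W where "W \<xi> = of_real (1 / q) * V \<xi>" for \<xi>
    have W0: "W \<in> weighted_L2 0" unfolding W_def[abs_def] by (rule weighted_L2_cmult(1)[OF V0])
    have [measurable]: "W \<in> borel_measurable borel" using W0 by (simp add: weighted_L2_def)
    have KW: "K_form t W = K_form t V / ?C" for t
    proof -
      have "K_mult t \<xi> * (cmod (W \<xi>))\<^sup>2 = K_mult t \<xi> * (cmod (V \<xi>))\<^sup>2 / ?C" for \<xi>
        using q by (simp add: W_def norm_mult power_mult_distrib norm_divide power_divide)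
      then show ?thesis unfolding K_form_def by simp
    qed
    define r where "r = enn2real (?I u)"
    have r: "?I u = ennreal r" "r \<ge> 0" using fin by (simp_all add: r_def)
    have "theta_const \<theta> * (\<integral>\<^sup>+\<xi>. ennreal ((1 + \<xi>\<^sup>2) powr (2 * \<theta>) * (cmod (W \<xi>))\<^sup>2) \<partial>lborel)
      = (\<integral>\<^sup>+t. ennreal (t powr (-2 * \<theta> - 1) * K_form t W) * indicator {0<..} t \<partial>lborel)"
      by (rule K_form_nn_integral[OF W0, symmetric])
    also have "\<dots> \<le> ?I u"
      unfolding I_eq
    proof (rule nn_integral_mono)
      fix t :: real
      show "ennreal (t powr (-2 * \<theta> - 1) * K_form t W) * indicator {0<..} t \<le> ennreal (t powr (-2 * \<theta> - 1) * (?K t u)\<^sup>2) * indicator {0<..} t"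
      proof (cases "t > 0")
        case True
        have "K_form t V \<le> ?C * (?K t u)\<^sup>2"
          unfolding V_def f(2) by (rule K_lower[OF a f(1) True \<phi>(1,2)]) (use \<phi>(3) f(2) in simp)
        then have "K_form t W \<le> (?K t u)\<^sup>2"
          unfolding KW using ext_const_pos[of a] by (simp add: pos_divide_le_eq mult.commute)
        then have "t powr (-2 * \<theta> - 1) * K_form t W \<le> t powr (-2 * \<theta> - 1) * (?K t u)\<^sup>2"
          by (intro mult_left_mono) auto
        then show ?thesis using True by (simp add: ennreal_leI)
      qed simp
    qed
    finally have le: "ennreal c * (\<integral>\<^sup>+\<xi>. ennreal ((1 + \<xi>\<^sup>2) powr (2 * \<theta>) * (cmod (W \<xi>))\<^sup>2) \<partial>lborel) \<le> ennreal r"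
      by (simp add: c(2) r(1))
    \<comment> \<open>Since c > 0, an infinite value would contradict the finite K-integral. This is
      where membership in H^(2 theta) comes from.\<close>
    have "(\<integral>\<^sup>+\<xi>. ennreal ((1 + \<xi>\<^sup>2) powr (2 * \<theta>) * (cmod (W \<xi>))\<^sup>2) \<partial>lborel) < \<infinity>"
    proof (rule ccontr)
      assume "\<not> ?thesis"
      then have "(\<integral>\<^sup>+\<xi>. ennreal ((1 + \<xi>\<^sup>2) powr (2 * \<theta>) * (cmod (W \<xi>))\<^sup>2) \<partial>lborel) = \<top>" by (simp add: less_top[symmetric])
      with le show False using c(1) by (simp add: ennreal_mult_top top_unique)
    qed
    then have "integrable lborel (\<lambda>\<xi>. (1 + \<xi>\<^sup>2) powr (2 * \<theta>) * (cmod (W \<xi>))\<^sup>2)"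
      by (intro integrableI_nonneg) auto
    then have W: "W \<in> weighted_L2 (2 * \<theta>)" by (simp add: weighted_L2_def)
    have "ennreal (c * weighted_norm2 (2 * \<theta>) W) \<le> ennreal r"
      using le c(1) unfolding nn[OF W] by (simp add: ennreal_mult')
    then have NW: "c * weighted_norm2 (2 * \<theta>) W \<le> r" using r(2) by simp
    have VW: "V = (\<lambda>\<xi>. of_real q * W \<xi>)" using q(1) by (simp add: W_def fun_eq_iff)
    have V: "V \<in> weighted_L2 (2 * \<theta>)" unfolding VW by (rule weighted_L2_cmult(1)[OF W])
    have "weighted_norm2 (2 * \<theta>) V = ?C * weighted_norm2 (2 * \<theta>) W"
      unfolding VW weighted_L2_cmult(2)[OF W] using q by simp
    also have "\<dots> \<le> ?C * (r / c)"
      using NW c(1) ext_const_pos[of a] by (intro mult_left_mono) (auto simp: pos_le_divide_eq mult.commute)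
    finally have N: "weighted_norm2 (2 * \<theta>) V \<le> ?C / c * r" by simp
    have uV: "u = restrict_distr ?\<Omega> (fourier_distr V)"
    proof -
      have "restrict_distr ?\<Omega> (fourier_distr V) = fun_distr ?\<Omega> (ext a f)"
        unfolding V_def by (rule restrict_fourier_distr_fourier[OF ext_integrable[OF a f(1)]])
      also have "\<dots> = fun_distr ?\<Omega> f" by (rule fun_distr_cong_cut[OF ext_restrict[OF a]])
      finally show ?thesis using f(2) by simp
    qed
    have "u \<in> carr ?Y" unfolding uV by (rule Sobolev_carrI[OF V]) (use \<theta> in simp)
    moreover have "nrm ?Y u \<le> sqrt (?C / c) / k * nrm ?X u"
    proof -
      have "nrm ?Y u \<le> sqrt (weighted_norm2 (2 * \<theta>) V)" unfolding uV by (rule Sobolev_nrm_le[OF V]) (use \<theta> in simp)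
      also have "\<dots> \<le> sqrt (?C / c * r)" by (rule real_sqrt_le_mono[OF N])
      also have "\<dots> = sqrt (?C / c) / k * nrm ?X u"
        unfolding real_sqrt_mult[of "?C / c" r] using k by (simp add: interp_def k_def[symmetric] r_def)
      finally show ?thesis .
    qed
    ultimately show ?thesis ..
  qed
  have carr: "carr ?X = carr ?Y"
  proof (intro equalityI subsetI)
    fix u assume "u \<in> carr ?Y"
    then obtain g where "g \<in> weighted_L2 (2 * \<theta>)" "u = restrict_distr ?\<Omega> (fourier_distr g)" by (rule Sobolev_carrE)
    then show "u \<in> carr ?X" using upper by blast
  qed (use lower in blast)
  have kc: "k * sqrt c > 0" using k c(1) by simp
  \<comment> \<open>\<open>upper\<close> holds for every density of \<open>u\<close>, so it passes
    to the infimum that defines the Sobolev norm.\<close>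
  have "1 / (k * sqrt c) * nrm ?X u \<le> nrm ?Y u" if u: "u \<in> carr ?X" for u
  proof (rule Sobolev_nrm_ge)
    show "u \<in> carr ?Y" using u carr by simp
    fix g assume "g \<in> weighted_L2 (2 * \<theta>)" "u = restrict_distr ?\<Omega> (fourier_distr g)"
    then have "nrm ?X u \<le> k * sqrt c * sqrt (weighted_norm2 (2 * \<theta>) g)" using upper by blast
    then show "1 / (k * sqrt c) * nrm ?X u \<le> sqrt (weighted_norm2 (2 * \<theta>) g)"
      using kc by (simp add: pos_divide_le_eq mult.commute)
  qed (use \<theta> in simp)
  moreover have "1 / (k * sqrt c) > 0" using kc by simp
  moreover have "sqrt (?C / c) / k > 0" using k c(1) ext_const_pos[of a] by simp
  ultimately show ?thesis unfolding eq_space_def using carr lower by blast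
qed

section \<open>The constant function\<close>

text \<open>Stated for arbitrary spaces and an additive curve \<open>e\<close>, since it is applied
  to the pair starting with \<open>L2_space\<close> and to the one starting with
  \<open>Sobolev \<Omega> 0\<close>. Splittings along the curve already give an upper bound for
  K.\<close>

lemma interp_half_segment:
  fixes H0 H1 :: "'v::ab_group_add normed_subspace" and e :: "real \<Rightarrow> 'v"
  assumes A: "A > 0" and B: "B > 0"
    and H0: "\<And>c. c \<in> {0..1} \<Longrightarrow> e c \<in> carr H0" "\<And>c. c \<in> {0..1} \<Longrightarrow> (nrm H0 (e c))\<^sup>2 \<le> c\<^sup>2 * A"
    and H1: "\<And>c. c \<in> {0..1} \<Longrightarrow> e c \<in> carr H1" "\<And>c. c \<in> {0..1} \<Longrightarrow> (nrm H1 (e c))\<^sup>2 \<le> c\<^sup>2 * B"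
    and add: "\<And>c d. e c + e d = e (c + d)"
  shows "e 1 \<in> carr (interp H0 H1 (1/2))" "nrm (interp H0 H1 (1/2)) (e 1) \<le> sqrt (sqrt (A * B))"
proof -
  let ?K = "K_fun H0 H1"
  have K: "0 \<le> ?K t (e 1) \<and> (?K t (e 1))\<^sup>2 \<le> A * B * t\<^sup>2 / (A + t\<^sup>2 * B)" if t: "t > 0" for t
  proof -
    define D where "D = A + t\<^sup>2 * B"
    have D: "D > 0" using A B t by (simp add: D_def add_pos_pos)
    \<comment> \<open>These coefficients minimise c^2 A + t^2 (1-c)^2 B, the first being c and the
      second 1-c.\<close>
    have r: "t\<^sup>2 * B / D \<in> {0..1}" "A / D \<in> {0..1}"
      using A B t D by (auto simp: D_def divide_le_eq)
    have s: "t\<^sup>2 * B / D + A / D = 1" using D unfolding add_divide_distrib[symmetric] by (simp add: D_def)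
    have "?K t (e (t\<^sup>2 * B / D) + e (A / D)) \<le> sqrt ((nrm H0 (e (t\<^sup>2 * B / D)))\<^sup>2 + t\<^sup>2 * (nrm H1 (e (A / D)))\<^sup>2)"
      by (rule K_fun_le[OF H0(1)[OF r(1)] H1(1)[OF r(2)]])
    also have "\<dots> \<le> sqrt ((t\<^sup>2 * B / D)\<^sup>2 * A + t\<^sup>2 * ((A / D)\<^sup>2 * B))"
      by (intro real_sqrt_le_mono add_mono mult_left_mono H0(2) H1(2) r) simp
    also have "(t\<^sup>2 * B / D)\<^sup>2 * A + t\<^sup>2 * ((A / D)\<^sup>2 * B) = A * B * t\<^sup>2 * (A + t\<^sup>2 * B) / (D * D)"
    proof -
      have "(x * B / D)\<^sup>2 * A + x * ((A / D)\<^sup>2 * B) = A * B * x * (A + x * B) / (D * D)" for x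
      proof -
        have 1: "(x * B / D)\<^sup>2 * A = (x * B * (x * B) * A) / (D * D)" by (simp add: power2_eq_square)
        have 2: "x * ((A / D)\<^sup>2 * B) = (x * (A * A) * B) / (D * D)" by (simp add: power2_eq_square)
        have 3: "x * B * (x * B) * A + x * (A * A) * B = A * B * x * (A + x * B)" by (simp add: algebra_simps)
        show ?thesis unfolding 1 2 add_divide_distrib[symmetric] 3 ..
      qed
      then show ?thesis .
    qed
    also have "\<dots> = A * B * t\<^sup>2 / D" using D unfolding D_def[symmetric] by simp
    finally have le: "?K t (e 1) \<le> sqrt (A * B * t\<^sup>2 / D)" unfolding add s .
    have nn: "0 \<le> ?K t (e 1)" using K_fun_nonneg[OF H0(1)[OF r(1)] H1(1)[OF r(2)], of t] unfolding add s .
    have "(?K t (e 1))\<^sup>2 \<le> (sqrt (A * B * t\<^sup>2 / D))\<^sup>2" by (intro power_mono le nn)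
    also have "\<dots> = A * B * t\<^sup>2 / D" using A B D by simp
    finally show ?thesis using nn by (simp add: D_def)
  qed
  have pos: "A + t\<^sup>2 * B > 0" for t using A B by (intro add_pos_nonneg) auto
  \<comment> \<open>At theta = 1/2 the weight in the interpolation integral is t^(-2), which cancels
    the t^2 of the bound for K and leaves an arctangent integral.\<close>
  have FTC: "(\<integral>\<^sup>+t. ennreal (A * B / (A + t\<^sup>2 * B)) * indicator {0..} t \<partial>lborel) = ennreal (sqrt (A * B) * (pi / 2) - sqrt (A * B) * arctan (sqrt (B / A) * 0))"
  proof (rule nn_integral_FTC_atLeast)
    fix t :: real
    have "sqrt (A * B) * sqrt (B / A) = B"
      using A B by (simp add: real_sqrt_mult real_sqrt_divide)
    then have "A * B / (A + t\<^sup>2 * B) = sqrt (A * B) * (sqrt (B / A) * (1 / (1 + (sqrt (B / A) * t)\<^sup>2)))"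
    proof -
      have "(sqrt (B / A) * t)\<^sup>2 = B / A * t\<^sup>2" using A B by (simp add: power_mult_distrib)
      then have "1 + (sqrt (B / A) * t)\<^sup>2 = (A + t\<^sup>2 * B) / A" using A by (simp add: add_divide_distrib mult.commute)
      then show ?thesis unfolding mult.assoc[symmetric] \<open>sqrt (A * B) * sqrt (B / A) = B\<close> by (simp add: mult.commute)
    qed
    then show "((\<lambda>t. sqrt (A * B) * arctan (sqrt (B / A) * t)) has_real_derivative A * B / (A + t\<^sup>2 * B)) (at t)"
      by (auto intro!: derivative_eq_intros simp: inverse_eq_divide mult_ac)
    show "0 \<le> A * B / (A + t\<^sup>2 * B)" using A B pos[of t] by simp
  next
    have "filterlim (\<lambda>t. sqrt (B / A) * t) at_top at_top"
      by (rule filterlim_tendsto_pos_mult_at_top[OF tendsto_const _ filterlim_ident]) (use A B in simp)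
    then have "((\<lambda>t. arctan (sqrt (B / A) * t)) \<longlongrightarrow> pi / 2) at_top"
      by (rule filterlim_compose[OF tendsto_arctan_at_top])
    then show "((\<lambda>t. sqrt (A * B) * arctan (sqrt (B / A) * t)) \<longlongrightarrow> sqrt (A * B) * (pi / 2)) at_top"
      by (intro tendsto_mult_left)
  qed simp
  have "interp_integral H0 H1 (1/2) (e 1) \<le> (\<integral>\<^sup>+t. ennreal (A * B / (A + t\<^sup>2 * B)) * indicator {0..} t \<partial>lborel)"
    unfolding interp_integral_def
  proof (rule nn_integral_mono)
    fix t :: real
    show "ennreal (\<bar>t powr (-(1/2)) * ?K t (e 1)\<bar>\<^sup>2 / t) * indicator {0<..} t \<le> ennreal (A * B / (A + t\<^sup>2 * B)) * indicator {0..} t"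
    proof (cases "t > 0")
      case True
      have "t powr (-2 * (1/2) - 1) = 1 / t\<^sup>2"
        using True by (simp add: powr_minus_divide powr_numeral)
      then have "\<bar>t powr (-(1/2)) * ?K t (e 1)\<bar>\<^sup>2 / t = 1 / t\<^sup>2 * (?K t (e 1))\<^sup>2"
        using interp_integrand[OF True, of "1/2" "?K t (e 1)"] by simp
      also have "\<dots> \<le> 1 / t\<^sup>2 * (A * B * t\<^sup>2 / (A + t\<^sup>2 * B))"
        by (intro mult_left_mono) (use K[OF True] in auto)
      also have "\<dots> = A * B / (A + t\<^sup>2 * B)" using True by simp
      finally show ?thesis using True by (simp add: ennreal_leI)
    qed simp
  qed
  then have I: "interp_integral H0 H1 (1/2) (e 1) \<le> ennreal (sqrt (A * B) * (pi / 2))"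
    unfolding FTC by simp
  have "e 0 + e 1 = e 1" unfolding add by simp
  moreover have "e 0 \<in> carr H0" "e 1 \<in> carr H1" by (rule H0(1) H1(1), simp)+
  ultimately have "\<exists>\<phi>0\<in>carr H0. \<exists>\<phi>1\<in>carr H1. \<phi>0 + \<phi>1 = e 1" by blast
  moreover have "interp_integral H0 H1 (1/2) (e 1) < \<infinity>" using I by (auto intro: le_less_trans)
  ultimately show "e 1 \<in> carr (interp H0 H1 (1/2))" by (simp add: interp_def)
  have "enn2real (interp_integral H0 H1 (1/2) (e 1)) \<le> sqrt (A * B) * (pi / 2)"
    using enn2real_mono[OF I] A B by simp
  \<comment> \<open>The normalisation sqrt((2/pi) sin(pi/2)) = sqrt(2/pi) cancels the factor pi/2 of
    the arctangent.\<close>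
  then have "nrm (interp H0 H1 (1/2)) (e 1) \<le> sqrt (2 / pi) * sqrt (sqrt (A * B) * (pi / 2))"
    by (simp add: interp_def interp_const_def mult_left_mono)
  also have "\<dots> = sqrt (sqrt (A * B))" unfolding real_sqrt_mult[symmetric] by simp
  finally show "nrm (interp H0 H1 (1/2)) (e 1) \<le> sqrt (sqrt (A * B))" .
qed

section \<open>Exponential continuations of the constant function\<close>

abbreviation half_line :: "(real \<Rightarrow> complex) \<Rightarrow> real \<Rightarrow> complex" where
  "half_line \<equiv> cut {0..}"

lemma integral_half_line_FTC:
  assumes F: "\<And>x. (F has_vector_derivative F' x) (at x)" "\<And>x. isCont F' x"
    and i: "integrable lborel (half_line F')" and lim: "(F \<longlongrightarrow> 0) at_top"
  shows "(LINT x|lborel. half_line F' x) = - F 0"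
proof -
  have [measurable]: "F' \<in> borel_measurable borel"
    using F(2) by (intro borel_measurable_continuous_onI continuous_at_imp_continuous_on) auto
  have ae: "AE x in lborel. half_line F' x = indicat_real {0<..} x *\<^sub>R F' x"
    using AE_lborel_singleton[of 0] by eventually_elim (auto simp: cut_def indicator_def)
  have eq: "(LINT x|lborel. half_line F' x) = (LINT x|lborel. indicat_real {0<..} x *\<^sub>R F' x)"
    by (rule integral_cong_AE[OF _ _ ae]) (auto simp: cut_def[abs_def])
  have i': "integrable lborel (\<lambda>x. indicat_real {0<..} x *\<^sub>R F' x)"
    by (rule iffD1[OF integrable_cong_AE[OF _ _ ae] i]) (auto simp: cut_def[abs_def])
  have "(LBINT x=ereal 0..\<infinity>. F' x) = 0 - F 0"
  proof (rule interval_integral_FTC_integrable[where F=F])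
    show "set_integrable lborel (einterval (ereal 0) \<infinity>) F'"
      using i' by (simp add: set_integrable_def)
    have "isCont F 0" using F(1) has_vector_derivative_continuous by blast
    then show "((F \<circ> real_of_ereal) \<longlongrightarrow> F 0) (at_right (ereal 0))"
      unfolding ereal_tendsto_simps1 isCont_def by (rule tendsto_within_subset) simp
    show "((F \<circ> real_of_ereal) \<longlongrightarrow> 0) (at_left \<infinity>)" using lim by (simp add: ereal_tendsto_simps1)
  qed (use F in auto)
  then show ?thesis unfolding eq
    by (simp add: interval_lebesgue_integral_def set_lebesgue_integral_def)
qed

text \<open>Half-line counterpart of \<open>fourier_cut_second_derivative\<close>: decay of the
  function and its derivative at infinity replaces the double zero at a.\<close>

lemma fourier_half_line_second_derivative:
  assumes p: "\<And>x. (p has_vector_derivative p1 x) (at x)" and p1: "\<And>x. (p1 has_vector_derivative p2 x) (at x)"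
    and p2: "\<And>x. isCont p2 x" and i: "integrable lborel (half_line p2)" "integrable lborel (half_line p)"
    and lim: "(p \<longlongrightarrow> 0) at_top" "(p1 \<longlongrightarrow> 0) at_top"
  shows "of_real (\<xi>\<^sup>2) * fourier (half_line p) \<xi> = - fourier (half_line p2) \<xi> - of_real fourier_const * (p1 0 + \<i> * of_real \<xi> * p 0)"
proof (rule fourier_second_derivative[OF p p1 p2 i])
  fix F' assume F': "\<And>x. ((\<lambda>x. cis (- \<xi> * x) * (p1 x + \<i> * of_real \<xi> * p x)) has_vector_derivative F' x) (at x)"
    "\<And>x. isCont F' x" "integrable lborel (half_line F')"
  have "((\<lambda>x. p1 x + \<i> * of_real \<xi> * p x) \<longlongrightarrow> 0 + \<i> * of_real \<xi> * 0) at_top"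
    by (intro tendsto_intros lim)
  then have "((\<lambda>x. cis (- \<xi> * x) * (p1 x + \<i> * of_real \<xi> * p x)) \<longlongrightarrow> 0) at_top"
    by (intro tendsto_0_cis_mult) simp
  from integral_half_line_FTC[OF F' this] show "(LINT x|lborel. half_line F' x) = - (p1 0 + \<i> * of_real \<xi> * p 0)" by simp
qed

text \<open>Decaying profiles for the outside of the interval, both with value 1 at 0. The first
  solves p'' = p and continues the constant 1 continuously; the second has slope 0 at 0, so it
  continues 1 as a C^1 function, and it satisfies p - p'' = 2 e^(-x).\<close>

definition exp_neg :: "real \<Rightarrow> complex" where "exp_neg x = of_real (exp (- x))"
definition exp_neg2 :: "real \<Rightarrow> complex" where "exp_neg2 x = of_real ((1 + x) * exp (- x))"

lemma integrable_half_line_exp: "integrable lborel (half_line (\<lambda>x. of_real (x ^ k * exp (- x))))"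
proof -
  have "integrable lborel (\<lambda>x. complex_of_real (x ^ k * exp (- x) * indicator {0..} x))"
    by (intro integrable_of_real integrable.intros[OF has_bochner_integral_I0i_power_exp_m'])
  then show ?thesis by (simp add: cut_def[abs_def] scaleR_conv_of_real mult_ac)
qed

text \<open>Because p'' = p, the second-derivative identity leaves only boundary terms for (1+xi^2)
  times the transform.\<close>

lemma fourier_half_line_exp_neg: "of_real (1 + \<xi>\<^sup>2) * fourier (half_line exp_neg) \<xi> = of_real fourier_const * (1 - \<i> * of_real \<xi>)"
proof -
  have i: "integrable lborel (half_line exp_neg)" using integrable_half_line_exp[of 0] by (simp add: exp_neg_def[abs_def])
  have d: "(exp_neg has_vector_derivative - exp_neg x) (at x)" for x
  proof -
    have "((\<lambda>x. exp (- x)) has_real_derivative - exp (- x)) (at x)" by (auto intro!: derivative_eq_intros)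
    from has_vector_derivative_of_real[OF this] show ?thesis by (simp add: exp_neg_def[abs_def])
  qed
  have d2: "((\<lambda>x. - exp_neg x) has_vector_derivative exp_neg x) (at x)" for x
    using has_vector_derivative_minus[OF d[of x]] by simp
  have c: "isCont exp_neg x" for x using d has_vector_derivative_continuous by blast
  have "((\<lambda>x::real. exp (- x)) \<longlongrightarrow> 0) at_top" by real_asymp
  from tendsto_of_real[OF this] have l: "(exp_neg \<longlongrightarrow> 0) at_top" by (simp add: exp_neg_def[abs_def])
  have l2: "((\<lambda>x. - exp_neg x) \<longlongrightarrow> 0) at_top" using tendsto_minus[OF l] by simp
  have "of_real (\<xi>\<^sup>2) * fourier (half_line exp_neg) \<xi> = - fourier (half_line exp_neg) \<xi> - of_real fourier_const * (- exp_neg 0 + \<i> * of_real \<xi> * exp_neg 0)"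
    by (rule fourier_half_line_second_derivative[OF d d2 c i i l l2])
  then show ?thesis by (simp add: exp_neg_def algebra_simps)
qed

text \<open>Here p - p'' = 2 e^(-x), and of the boundary terms only the value at 0 remains since the
  slope there is 0.\<close>

lemma fourier_half_line_exp_neg2:
  "of_real (1 + \<xi>\<^sup>2) * fourier (half_line exp_neg2) \<xi> = 2 * fourier (half_line exp_neg) \<xi> - of_real fourier_const * (\<i> * of_real \<xi>)"
proof -
  let ?p1 = "\<lambda>x. complex_of_real (- x * exp (- x))" and ?p2 = "\<lambda>x. complex_of_real ((x - 1) * exp (- x))"
  have i0: "integrable lborel (half_line exp_neg)" using integrable_half_line_exp[of 0] by (simp add: exp_neg_def[abs_def])
  have i1: "integrable lborel (half_line (\<lambda>x. of_real (x * exp (- x))))" using integrable_half_line_exp[of 1] by simp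
  have e: "half_line exp_neg2 = (\<lambda>x. half_line exp_neg x + half_line (\<lambda>x. of_real (x * exp (- x))) x)"
    by (simp add: fun_eq_iff cut_def exp_neg2_def exp_neg_def algebra_simps)
  have e2: "half_line ?p2 = (\<lambda>x. half_line (\<lambda>x. of_real (x * exp (- x))) x - half_line exp_neg x)"
    by (simp add: fun_eq_iff cut_def exp_neg_def algebra_simps)
  have i: "integrable lborel (half_line exp_neg2)" "integrable lborel (half_line ?p2)" unfolding e e2 using i0 i1 by auto
  have "((\<lambda>x. (1 + x) * exp (- x)) has_real_derivative - x * exp (- x)) (at x)" for x :: real
    by (auto intro!: derivative_eq_intros simp: algebra_simps)
  from has_vector_derivative_of_real[OF this] have d: "(exp_neg2 has_vector_derivative ?p1 x) (at x)" for x
    unfolding exp_neg2_def[abs_def] .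
  have "((\<lambda>x. - x * exp (- x)) has_real_derivative (x - 1) * exp (- x)) (at x)" for x :: real
    by (auto intro!: derivative_eq_intros simp: algebra_simps)
  from has_vector_derivative_of_real[OF this] have d2: "(?p1 has_vector_derivative ?p2 x) (at x)" for x .
  have c: "isCont ?p2 x" for x by (intro continuous_intros)
  have "((\<lambda>x::real. (1 + x) * exp (- x)) \<longlongrightarrow> 0) at_top" by real_asymp
  from tendsto_of_real[OF this] have l: "(exp_neg2 \<longlongrightarrow> 0) at_top" by (simp add: exp_neg2_def[abs_def])
  have "((\<lambda>x::real. - x * exp (- x)) \<longlongrightarrow> 0) at_top" by real_asymp
  from tendsto_of_real[OF this] have l2: "(?p1 \<longlongrightarrow> 0) at_top" by simp
  have "of_real (\<xi>\<^sup>2) * fourier (half_line exp_neg2) \<xi> = - fourier (half_line ?p2) \<xi> - of_real fourier_const * (?p1 0 + \<i> * of_real \<xi> * exp_neg2 0)"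
    by (rule fourier_half_line_second_derivative[OF d d2 c i(2,1) l l2])
  then have 1: "of_real (\<xi>\<^sup>2) * fourier (half_line exp_neg2) \<xi> = - fourier (half_line ?p2) \<xi> - of_real fourier_const * (\<i> * of_real \<xi>)"
    by (simp add: exp_neg2_def)
  have "fourier (half_line exp_neg2) \<xi> - fourier (half_line ?p2) \<xi> = 2 * fourier (half_line exp_neg) \<xi>"
    unfolding e e2 fourier_add[OF i0 i1] fourier_diff[OF i1 i0] by simp
  moreover have "of_real (1 + \<xi>\<^sup>2) * fourier (half_line exp_neg2) \<xi> = fourier (half_line exp_neg2) \<xi> + of_real (\<xi>\<^sup>2) * fourier (half_line exp_neg2) \<xi>"
    by (simp add: distrib_right)
  ultimately show ?thesis unfolding 1 by simp
qed

text \<open>The constant 1 continued on both sides by \<open>p\<close> of the distance to the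
  interval. For a > 0 the open interval and the two closed half-lines cover each point exactly
  once.\<close>

definition glue :: "real \<Rightarrow> (real \<Rightarrow> complex) \<Rightarrow> real \<Rightarrow> complex" where
  "glue a p x = cut {0<..<a} (\<lambda>_. 1) x + half_line p (x - a) + half_line p (- x)"

lemma const_L2: "(\<lambda>_. c) \<in> L2_functions {0<..<a}"
  by (rule cut_continuous_L2) simp

lemma integrable_shift: "integrable lborel (p :: real \<Rightarrow> complex) \<Longrightarrow> integrable lborel (\<lambda>x. p (x - a))"
  using lborel_integrable_real_affine[of p 1 "- a"] by simp

lemma glue_integrable: "integrable lborel (half_line p) \<Longrightarrow> integrable lborel (glue a p)"
  unfolding glue_def[abs_def]
  using L2_cut_integrable[OF const_L2[of 1 a]] integrable_shift[of "half_line p" a] integrable_scaled(1)[of "half_line p"] by simp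

lemma fourier_glue:
  assumes "integrable lborel (half_line p)"
  shows "fourier (glue a p) \<xi> = fourier (cut {0<..<a} (\<lambda>_. 1)) \<xi> + cis (- (a * \<xi>)) * fourier (half_line p) \<xi> + fourier (half_line p) (- \<xi>)"
proof -
  note i = L2_cut_integrable[OF const_L2[of 1 a]] integrable_shift[OF assms, of a] integrable_scaled(1)[OF assms]
  have "fourier (\<lambda>x. half_line p (x - a)) \<xi> = cis (- (a * \<xi>)) * fourier (half_line p) \<xi>"
    using fourier_shift[of "\<lambda>x. half_line p (- x)" a \<xi>] by (simp add: fourier_reflect)
  then show ?thesis
    unfolding glue_def[abs_def] fourier_add[OF Bochner_Integration.integrable_add[OF i(1,2)] i(3)] fourier_add[OF i(1,2)]
    by (simp add: fourier_reflect)
qed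

lemma glue_cut: assumes "a > 0" shows "cut {0<..<a} (glue a p) = cut {0<..<a} (\<lambda>_. 1)"
  using assms by (auto simp: fun_eq_iff glue_def cut_def indicator_def)

text \<open>The factor xi^2 avoids a division at xi = 0 and gives the boundary terms the form in
  which they cancel against those of the half-lines.\<close>

lemma fourier_cut_1:
  assumes "a > 0"
  shows "of_real (\<xi>\<^sup>2) * fourier (cut {0<..<a} (\<lambda>_. 1)) \<xi> = of_real fourier_const * (\<i> * of_real \<xi> * (cis (- (a * \<xi>)) - 1))"
proof -
  let ?F = "\<lambda>x. \<i> * of_real \<xi> * cis (- \<xi> * x)" and ?F' = "\<lambda>x. of_real (\<xi>\<^sup>2) * cis (- \<xi> * x)"
  have F: "(?F has_vector_derivative ?F' x) (at x)" for x
    using has_vector_derivative_mult_right[OF cis_has_vderiv[of "- \<xi>" x], of "\<i> * of_real \<xi>"]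
    by (simp add: power2_eq_square mult.assoc[symmetric])
       (simp add: algebra_simps)
  have "isCont (\<lambda>x. cis (- \<xi> * x)) x" for x using cis_has_vderiv has_vector_derivative_continuous by blast
  then have "isCont ?F' x" for x by (intro continuous_intros)
  from integral_cut_FTC[OF assms F this]
  have "(LINT x|lborel. cut {0<..<a} ?F' x) = \<i> * of_real \<xi> * (cis (- (a * \<xi>)) - 1)"
    by (simp add: algebra_simps)
  moreover have "cut {0<..<a} ?F' x = of_real (\<xi>\<^sup>2) * (cis (- (\<xi> * x)) * cut {0<..<a} (\<lambda>_. 1) x)" for x
    by (simp add: cut_def)
  ultimately have "of_real (\<xi>\<^sup>2) * (LINT x|lborel. cis (- (\<xi> * x)) * cut {0<..<a} (\<lambda>_. 1) x) = \<i> * of_real \<xi> * (cis (- (a * \<xi>)) - 1)"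
    by simp
  then show ?thesis unfolding fourier_cis by (simp add: mult.left_commute[of _ "of_real fourier_const"])
qed

lemma integral_square_cut_const:
  assumes "a > 0" shows "(LINT x|lborel. (cmod (cut {0<..<a} (\<lambda>_. c) x))\<^sup>2) = (cmod c)\<^sup>2 * a"
proof -
  have "(\<lambda>x. (cmod (cut {0<..<a} (\<lambda>_. c) x))\<^sup>2) = (\<lambda>x. (cmod c)\<^sup>2 * indicat_real {0<..<a} x)"
    by (auto simp: fun_eq_iff cut_def indicator_def)
  then show ?thesis using assms by simp
qed

text \<open>For U = \<open>glue a exp_neg2\<close> the function U - U'' is 1 inside and 2 e^(-d)
  outside, without point masses since U is C^1. Its squared L^2 norm is a + 4, each side
  contributing 4 times 1/2.\<close>

lemma H2_norm_one_le:
  assumes a: "a > 0"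
  obtains g where "g \<in> weighted_L2 2" "restrict_distr {0<..<a} (fourier_distr g) = fun_distr {0<..<a} (\<lambda>_. 1)" "weighted_norm2 2 g \<le> a + 4"
proof -
  let ?\<Omega> = "{0<..<a}" and ?q = "\<lambda>x. 2 * exp_neg x"
  have i0: "integrable lborel (half_line exp_neg)" using integrable_half_line_exp[of 0] by (simp add: exp_neg_def[abs_def])
  have i1: "integrable lborel (half_line (\<lambda>x. of_real (x * exp (- x))))" using integrable_half_line_exp[of 1] by simp
  have "half_line exp_neg2 = (\<lambda>x. half_line exp_neg x + half_line (\<lambda>x. of_real (x * exp (- x))) x)"
    by (simp add: fun_eq_iff cut_def exp_neg2_def exp_neg_def algebra_simps)
  then have i2: "integrable lborel (half_line exp_neg2)" using i0 i1 by simp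
  have hq: "half_line ?q = (\<lambda>x. 2 * half_line exp_neg x)" by (simp add: fun_eq_iff cut_def)
  have iq: "integrable lborel (half_line ?q)" unfolding hq using i0 by simp
  define g where "g = fourier (glue a exp_neg2)"
  define F where "F = glue a ?q"
  have key: "of_real (1 + \<xi>\<^sup>2) * g \<xi> = fourier F \<xi>" for \<xi>
  proof -
    let ?M = "fourier (cut ?\<Omega> (\<lambda>_. 1)) \<xi>" and ?c = "cis (- (a * \<xi>))"
    have "of_real (1 + \<xi>\<^sup>2) * g \<xi> = ?M + of_real (\<xi>\<^sup>2) * ?M + ?c * (of_real (1 + \<xi>\<^sup>2) * fourier (half_line exp_neg2) \<xi>) + of_real (1 + (- \<xi>)\<^sup>2) * fourier (half_line exp_neg2) (- \<xi>)"
      unfolding g_def fourier_glue[OF i2] by (simp add: algebra_simps)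
    \<comment> \<open>The boundary terms of the indicator cancel those of the two half-lines here,
      because U is continuous at 0 and at a.\<close>
    also have "\<dots> = ?M + ?c * (2 * fourier (half_line exp_neg) \<xi>) + 2 * fourier (half_line exp_neg) (- \<xi>)"
      unfolding fourier_cut_1[OF a] fourier_half_line_exp_neg2 by (simp add: algebra_simps)
    also have "\<dots> = fourier F \<xi>"
      unfolding F_def fourier_glue[OF iq] hq fourier_cmult by simp
    finally show ?thesis .
  qed
  define E where "E = (\<lambda>x. indicat_real {0..} x * exp (- (2 * x)))"
  have E: "has_bochner_integral lborel E (1 / 2)"
  proof -
    have 1: "has_bochner_integral lborel (\<lambda>x. exp (- x) * indicat_real {0..} x) 1"
      using has_bochner_integral_I0i_power_exp_m'[of 0] by simp
    have "has_bochner_integral lborel (\<lambda>x. exp (- (0 + 2 * x)) * indicat_real {0..} (0 + 2 * x)) (1 /\<^sub>R \<bar>2\<bar>)"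
      by (subst lborel_has_bochner_integral_real_affine_iff[symmetric]) (use 1 in auto)
    also have "(\<lambda>x. exp (- (0 + 2 * x)) * indicat_real {0..} (0 + 2 * x)) = E"
      by (auto simp: E_def fun_eq_iff indicator_def)
    finally show ?thesis by (simp add: inverse_eq_divide)
  qed
  have E1: "integrable lborel E" "(LINT x|lborel. E x) = 1 / 2"
    using E by (auto simp: has_bochner_integral_iff)
  have E2: "integrable lborel (\<lambda>x. E (x - a))" "(LINT x|lborel. E (x - a)) = 1 / 2"
    using lborel_integrable_real_affine[OF E1(1), of 1 "- a"] lborel_integral_real_affine[of 1 E "- a"] E1(2) by simp_all
  have E3: "integrable lborel (\<lambda>x. E (- x))" "(LINT x|lborel. E (- x)) = 1 / 2"
    using lborel_integrable_real_affine[OF E1(1), of "-1" 0] lborel_integral_real_affine[of "-1" E 0] E1(2) by simp_all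
  have sq: "(cmod (F x))\<^sup>2 = (indicat_real ?\<Omega> x + 4 * E (x - a)) + 4 * E (- x)" for x
  proof -
    have e: "(exp (- y))\<^sup>2 = exp (- (2 * y))" for y :: real
      by (simp add: power2_eq_square exp_add[symmetric])
    consider "x \<in> ?\<Omega>" | "x \<ge> a" | "x \<le> 0" by fastforce
    then show ?thesis
      using a by cases (auto simp: F_def glue_def cut_def E_def indicator_def exp_neg_def norm_mult power_mult_distrib e e[of "- x", simplified] e[of "x - a", simplified])
  qed
  have iF: "integrable lborel F" unfolding F_def by (rule glue_integrable[OF iq])
  have ind: "integrable lborel (indicat_real ?\<Omega>)" "(LINT x|lborel. indicat_real ?\<Omega> x) = a" using a by simp_all
  have F2: "integrable lborel (\<lambda>x. (cmod (F x))\<^sup>2)" "(LINT x|lborel. (cmod (F x))\<^sup>2) = a + 4"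
    unfolding sq using ind E2 E3 by simp_all
  note P = fourier_weighted_L2[OF iF F2(1)]
  have gm: "g \<in> borel_measurable borel"
    unfolding g_def using borel_measurable_integrable[OF glue_integrable[OF i2]] by simp
  have "(1 + \<xi>\<^sup>2) powr 2 * (cmod (g \<xi>))\<^sup>2 \<le> 1 * ((1 + \<xi>\<^sup>2) powr 0 * (cmod (fourier F \<xi>))\<^sup>2)" for \<xi>
  proof -
    have "cmod (fourier F \<xi>) = \<bar>1 + \<xi>\<^sup>2\<bar> * cmod (g \<xi>)" unfolding key[symmetric] norm_mult norm_of_real ..
    then show ?thesis by (simp add: power_mult_distrib powr_2_one_plus_square)
  qed
  note B = weighted_L2_bound[OF gm P(1) this]
  show ?thesis
  proof (rule that[of g])
    show "g \<in> weighted_L2 2" by (rule B(1))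
    show "weighted_norm2 2 g \<le> a + 4" using B(2) P(2) F2(2) by simp
    show "restrict_distr ?\<Omega> (fourier_distr g) = fun_distr ?\<Omega> (\<lambda>_. 1)"
      unfolding g_def restrict_fourier_distr_fourier[OF glue_integrable[OF i2]]
      by (rule fun_distr_cong_cut[OF glue_cut[OF a]])
  qed
qed

text \<open>The Fourier transform of Lebesgue measure on $(0,a)$ plus unit masses at both endpoints.\<close>

definition H1_rep :: "real \<Rightarrow> real \<Rightarrow> complex" where
  "H1_rep a \<xi> = fourier (cut {0<..<a} (\<lambda>_. 1)) \<xi> + of_real fourier_const + of_real fourier_const * cis (- (a * \<xi>))"

lemma integral_invfour_mult:
  assumes g: "integrable lborel g" and h: "integrable lborel h"
  shows "(LINT x|lborel. invfour g x * h x) = (LINT \<xi>|lborel. g \<xi> * fourier h (- \<xi>))"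
proof -
  have "(LINT \<xi>|lborel. g \<xi> * fourier h (- \<xi>)) = (LINT \<xi>|lborel. g \<xi> * fourier (\<lambda>x. h (- x)) \<xi>)"
    by (simp add: fourier_reflect)
  also have "\<dots> = (LINT x|lborel. fourier g x * h (- x))"
    by (rule fourier_mult_formula[OF g integrable_scaled(1)[OF h], symmetric])
  also have "\<dots> = (LINT x|lborel. invfour g x * h x)"
    by (subst lborel_integral_real_affine[where c="-1" and t=0]) (auto simp: invfour_def)
  finally show ?thesis ..
qed

text \<open>The pairing is bilinear, without conjugation, hence the argument -xi. An integrable
  density has a continuous inverse transform, so the point values at 0 and a make sense.\<close>

lemma H1_rep_pairing:
  assumes g: "integrable lborel g"
  shows "(LINT \<xi>|lborel. g \<xi> * H1_rep a (- \<xi>)) = (LINT x|lborel. cut {0<..<a} (invfour g) x) + invfour g 0 + invfour g a"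
proof -
  let ?\<chi> = "cut {0<..<a} (\<lambda>_. 1)"
  have \<chi>: "integrable lborel ?\<chi>" by (rule L2_cut_integrable[OF const_L2])
  note [measurable] = borel_measurable_integrable[OF \<chi>]
  have [measurable]: "fourier ?\<chi> \<in> borel_measurable borel" by (rule fourier_measurable) simp
  have i1: "integrable lborel (\<lambda>\<xi>. g \<xi> * fourier ?\<chi> (- \<xi>))"
    by (rule integrable_mult_bounded[OF g _ norm_fourier_le[OF \<chi>]]) simp
  have i2: "integrable lborel (\<lambda>\<xi>. of_real fourier_const * g \<xi>)" using g by simp
  have i3: "integrable lborel (\<lambda>\<xi>. of_real fourier_const * (cis (- (- a * \<xi>)) * g \<xi>))"
    by (intro integrable_mult_right integrable_cis_mult g) simp
  have "g \<xi> * H1_rep a (- \<xi>) = (g \<xi> * fourier ?\<chi> (- \<xi>) + of_real fourier_const * g \<xi>) + of_real fourier_const * (cis (- (- a * \<xi>)) * g \<xi>)" for \<xi>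
    by (simp add: H1_rep_def algebra_simps)
  then have "(LINT \<xi>|lborel. g \<xi> * H1_rep a (- \<xi>)) = (LINT \<xi>|lborel. g \<xi> * fourier ?\<chi> (- \<xi>)) + (LINT \<xi>|lborel. of_real fourier_const * g \<xi>) + (LINT \<xi>|lborel. of_real fourier_const * (cis (- (- a * \<xi>)) * g \<xi>))"
    using i1 i2 i3 by simp
  moreover have "(LINT \<xi>|lborel. of_real fourier_const * g \<xi>) = invfour g 0" by (simp add: invfour_def fourier_cis)
  moreover have "(LINT \<xi>|lborel. of_real fourier_const * (cis (- (- a * \<xi>)) * g \<xi>)) = invfour g a" by (simp add: invfour_def fourier_cis)
  moreover have "(LINT \<xi>|lborel. g \<xi> * fourier ?\<chi> (- \<xi>)) = (LINT x|lborel. cut {0<..<a} (invfour g) x)"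
    unfolding integral_invfour_mult[OF g \<chi>, symmetric]
    by (intro Bochner_Integration.integral_cong) (auto simp: cut_def)
  ultimately show ?thesis by simp
qed

definition H1_min :: "real \<Rightarrow> real \<Rightarrow> complex" where "H1_min a = glue a exp_neg"

text \<open>The closed form shows that the function is continuous, real and bounded by 1, as the
  inversion formula and the symmetry of its transform require.\<close>

lemma H1_min_eq:
  assumes "a > 0" shows "H1_min a x = of_real (exp (- max 0 (max (- x) (x - a))))"
proof -
  consider "x \<in> {0<..<a}" | "x \<ge> a" | "x \<le> 0" by fastforce
  then show ?thesis
    using assms by cases (auto simp: H1_min_def glue_def cut_def indicator_def exp_neg_def max_def)
qed

lemma integrable_half_line_exp_neg: "integrable lborel (half_line exp_neg)"
  using integrable_half_line_exp[of 0] by (simp add: exp_neg_def[abs_def])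

text \<open>The function minus its second derivative is 1 on the interval plus a unit mass at each
  endpoint, where the slope of e^(-d) jumps by -1.\<close>

lemma fourier_H1_min:
  assumes a: "a > 0" shows "of_real (1 + \<xi>\<^sup>2) * fourier (H1_min a) \<xi> = H1_rep a \<xi>"
proof -
  let ?M = "fourier (cut {0<..<a} (\<lambda>_. 1)) \<xi>" and ?c = "cis (- (a * \<xi>))"
  have "of_real (1 + \<xi>\<^sup>2) * fourier (H1_min a) \<xi> = ?M + of_real (\<xi>\<^sup>2) * ?M + ?c * (of_real (1 + \<xi>\<^sup>2) * fourier (half_line exp_neg) \<xi>) + of_real (1 + (- \<xi>)\<^sup>2) * fourier (half_line exp_neg) (- \<xi>)"
    unfolding H1_min_def fourier_glue[OF integrable_half_line_exp_neg] by (simp add: algebra_simps)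
  also have "\<dots> = H1_rep a \<xi>"
    unfolding fourier_cut_1[OF a] fourier_half_line_exp_neg H1_rep_def by (simp add: algebra_simps)
  finally show ?thesis .
qed

text \<open>The squared norm is the functional applied to its own representer, a + 1 + 1. Since
  \<open>H1_rep a\<close> is bounded, the transform decays like 1/(1+xi^2); it is therefore
  integrable and inversion recovers the point values.\<close>

lemma H1_min_norm:
  assumes a: "a > 0"
  shows "fourier (H1_min a) \<in> weighted_L2 1" "weighted_norm2 1 (fourier (H1_min a)) = a + 2"
proof -
  let ?w = "H1_min a" and ?f = "fourier (H1_min a)"
  have iw: "integrable lborel ?w" unfolding H1_min_def by (rule glue_integrable[OF integrable_half_line_exp_neg])
  note [measurable] = borel_measurable_integrable[OF iw]
  have fm [measurable]: "?f \<in> borel_measurable borel" by (rule fourier_measurable) simp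
  define B where "B = fourier_const * (LINT x|lborel. cmod (cut {0<..<a} (\<lambda>_. 1) x)) + 2 * fourier_const"
  have B: "cmod (H1_rep a \<xi>) \<le> B" for \<xi>
  proof -
    have "cmod (H1_rep a \<xi>) \<le> cmod (fourier (cut {0<..<a} (\<lambda>_. 1)) \<xi>) + cmod (of_real fourier_const) + cmod (of_real fourier_const * cis (- (a * \<xi>)))"
      unfolding H1_rep_def by (intro order.trans[OF norm_triangle_ineq] add_mono norm_triangle_ineq order_refl)
    also have "\<dots> \<le> B"
      using norm_fourier_le[OF L2_cut_integrable[OF const_L2[of 1 a]], of \<xi>] fourier_const_pos by (simp add: B_def norm_mult)
    finally show ?thesis .
  qed
  have sq: "(1 + \<xi>\<^sup>2) powr 1 * (cmod (?f \<xi>))\<^sup>2 \<le> B\<^sup>2 * (1 / (1 + \<xi>\<^sup>2))" for \<xi>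
  proof -
    have pos: "1 + \<xi>\<^sup>2 > 0" by (simp add: add_pos_nonneg)
    have "cmod (H1_rep a \<xi>) = (1 + \<xi>\<^sup>2) * cmod (?f \<xi>)"
      unfolding fourier_H1_min[OF a, symmetric] norm_mult norm_of_real using pos by simp
    then have "((1 + \<xi>\<^sup>2) * cmod (?f \<xi>))\<^sup>2 \<le> B\<^sup>2" using B[of \<xi>] power_mono[OF B norm_ge_zero, of \<xi> 2] by simp
    moreover have "((1 + \<xi>\<^sup>2) * cmod (?f \<xi>))\<^sup>2 = ((1 + \<xi>\<^sup>2) powr 1 * (cmod (?f \<xi>))\<^sup>2) * (1 + \<xi>\<^sup>2)"
      using pos by (simp add: power2_eq_square)
    ultimately show ?thesis using pos by (simp add: pos_le_divide_eq)
  qed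
  have "integrable lborel (\<lambda>\<xi>. (1 + \<xi>\<^sup>2) powr 1 * (cmod (?f \<xi>))\<^sup>2)"
    by (rule Bochner_Integration.integrable_bound[OF integrable_mult_right[OF integrable_inverse_1_plus_square, of "B\<^sup>2"]])
       (use sq in \<open>auto simp: abs_of_nonneg\<close>)
  then show w1: "?f \<in> weighted_L2 1" by (simp add: weighted_L2_def)
  have ifh: "integrable lborel ?f" by (rule weighted_L2_integrable[OF w1])
  have inv: "invfour ?f x = ?w x" for x
    unfolding invfour_def
  proof (rule fourier_inversion[OF iw ifh])
    have "continuous_on UNIV (\<lambda>x. complex_of_real (exp (- max 0 (max (- x) (x - a)))))"
      by (intro continuous_intros)
    moreover have "?w = (\<lambda>x. complex_of_real (exp (- max 0 (max (- x) (x - a)))))"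
      using H1_min_eq[OF a] by (rule ext)
    ultimately show "isCont ?w x" by (simp only: continuous_on_eq_continuous_at[OF open_UNIV]) blast
    show "cmod (?w y) \<le> 1" for y by (simp add: H1_min_eq[OF a])
  qed
  \<comment> \<open>The function is real, so conjugating its transform reflects it; this turns the
    bilinear pairing into a squared modulus.\<close>
  have rl: "cnj (?f \<xi>) = ?f (- \<xi>)" for \<xi>
    unfolding cnj_fourier by (simp add: fourier_cis H1_min_eq[OF a])
  have "of_real ((1 + \<xi>\<^sup>2) powr 1 * (cmod (?f \<xi>))\<^sup>2) = ?f \<xi> * H1_rep a (- \<xi>)" for \<xi>
  proof -
    have pos: "1 + \<xi>\<^sup>2 > 0" by (simp add: add_pos_nonneg)
    have "H1_rep a (- \<xi>) = of_real (1 + \<xi>\<^sup>2) * cnj (?f \<xi>)"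
      unfolding rl fourier_H1_min[OF a, symmetric] by simp
    moreover have "complex_of_real ((1 + \<xi>\<^sup>2) powr 1 * (cmod (?f \<xi>))\<^sup>2) = of_real (1 + \<xi>\<^sup>2) * of_real ((cmod (?f \<xi>))\<^sup>2)"
      using pos by (simp only: of_real_mult[symmetric] powr_one)
    ultimately show ?thesis by (simp only: complex_norm_square mult.left_commute)
  qed
  then have "of_real (weighted_norm2 1 ?f) = (LINT \<xi>|lborel. ?f \<xi> * H1_rep a (- \<xi>))"
    unfolding weighted_norm2_def integral_complex_of_real[symmetric] by simp
  also have "\<dots> = (LINT x|lborel. cut {0<..<a} ?w x) + ?w 0 + ?w a"
    unfolding H1_rep_pairing[OF ifh] inv[abs_def] inv ..
  also have "\<dots> = of_real (a + 2)"
  proof -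
    have "cut {0<..<a} ?w = (\<lambda>x. of_real (indicat_real {0<..<a} x))"
      unfolding H1_min_def glue_cut[OF a] by (simp add: fun_eq_iff cut_def scaleR_conv_of_real)
    then have "(LINT x|lborel. cut {0<..<a} ?w x) = of_real a" using a by simp
    then show ?thesis using a by (simp add: H1_min_eq[OF a])
  qed
  finally show "weighted_norm2 1 ?f = a + 2" by (simp only: of_real_eq_iff)
qed

text \<open>Otherwise the continuous \<open>U\<close> would differ from 1 on a whole neighbourhood
  of b, and its part inside (0, a) has positive measure even when b is an endpoint.\<close>

lemma AE_one_imp_limit_one:
  fixes U :: "real \<Rightarrow> complex"
  assumes ae: "AE x in lborel. x \<in> {0<..<a} \<longrightarrow> U x = 1" and cont: "\<And>x. isCont U x" and b: "b \<in> {0..a}" and a: "a > 0"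
  shows "U b = 1"
proof (rule ccontr)
  assume "U b \<noteq> 1"
  moreover have "(U \<longlongrightarrow> U b) (at b)" using cont[of b] by (simp add: isCont_def)
  ultimately have "\<forall>\<^sub>F x in at b. U x \<noteq> 1" by (rule tendsto_imp_eventually_ne[rotated])
  then obtain d where d: "d > 0" "\<And>x. x \<noteq> b \<Longrightarrow> dist x b < d \<Longrightarrow> U x \<noteq> 1"
    by (auto simp: eventually_at)
  define l r where "l = max 0 (b - d)" and "r = min a (b + d)"
  have lr: "l < r" using b a d(1) by (auto simp: l_def r_def)
  have "AE x in lborel. x \<notin> {l<..<r}"
    using ae AE_lborel_singleton[of b]
  proof eventually_elim
    case (elim x)
    show ?case
    proof
      assume x: "x \<in> {l<..<r}"
      then have "x \<in> {0<..<a}" "dist x b < d" by (auto simp: l_def r_def dist_real_def)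
      then show False using elim d(2) by blast
    qed
  qed
  moreover have "{x \<in> space lborel. \<not> x \<notin> {l<..<r}} = {l<..<r}" by auto
  ultimately have "emeasure lborel {l<..<r} = 0"
    using AE_iff_measurable[of "{l<..<r}" lborel "\<lambda>x. x \<notin> {l<..<r}"] by auto
  then show False using lr by simp
qed

text \<open>Every H^1 extension of 1 gives the functional the value a + 2, the endpoint values being
  1 by continuity. Cauchy-Schwarz against the representer, whose squared norm is also a + 2, leaves
  the claim.\<close>

lemma H1_norm_one_ge:
  assumes a: "a > 0" and g: "g \<in> weighted_L2 1" and eq: "fun_distr {0<..<a} (\<lambda>_. 1) = restrict_distr {0<..<a} (fourier_distr g)"
  shows "sqrt (a + 2) \<le> sqrt (weighted_norm2 1 g)"
proof -
  let ?\<Omega> = "{0<..<a}" and ?f = "fourier (H1_min a)"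
  have ig: "integrable lborel g" by (rule weighted_L2_integrable[OF g])
  have [measurable]: "g \<in> borel_measurable borel" using g by (simp add: weighted_L2_def)
  note w = H1_min_norm[OF a]
  have w': "(\<lambda>\<xi>. ?f (- \<xi>)) \<in> weighted_L2 1" "weighted_norm2 1 (\<lambda>\<xi>. ?f (- \<xi>)) = a + 2"
    using weighted_L2_cis[OF w(1), of 0] w(2) by simp_all
  have [measurable]: "(\<lambda>\<xi>. ?f (- \<xi>)) \<in> borel_measurable borel" using w' by (simp add: weighted_L2_def)
  have cont: "isCont (invfour g) x" for x by (rule invfour_isCont[OF ig])
  have UL: "invfour g \<in> L2_functions ?\<Omega>"
    by (rule cut_continuous_L2) (use cont in \<open>auto intro: continuous_at_imp_continuous_on\<close>)
  have "fun_distr ?\<Omega> (invfour g) = fun_distr ?\<Omega> (\<lambda>_. 1)"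
    using eq restrict_fourier_distr_L1[OF ig, of ?\<Omega>] by simp
  from fun_distr_unique[OF L2_cut_integrable[OF UL] L2_cut_integrable[OF const_L2] this]
  have ae: "AE x in lborel. cut ?\<Omega> (invfour g) x = cut ?\<Omega> (\<lambda>_. 1) x" .
  then have ae': "AE x in lborel. x \<in> ?\<Omega> \<longrightarrow> invfour g x = 1"
    by eventually_elim (auto simp: cut_def)
  have ends: "invfour g 0 = 1" "invfour g a = 1"
    using AE_one_imp_limit_one[OF ae' cont _ a] a by auto
  have "(LINT x|lborel. cut ?\<Omega> (invfour g) x) = (LINT x|lborel. cut ?\<Omega> (\<lambda>_. 1) x)"
    by (rule integral_cong_AE) (use ae UL const_L2[of 1 a] in \<open>auto simp: L2_functions_cut\<close>)
  also have "(\<lambda>x. cut ?\<Omega> (\<lambda>_. 1) x) = (\<lambda>x. of_real (indicat_real ?\<Omega> x))"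
    by (simp add: fun_eq_iff cut_def scaleR_conv_of_real)
  also have "(LINT x|lborel. complex_of_real (indicat_real ?\<Omega> x)) = of_real a" using a by simp
  finally have pair: "(LINT \<xi>|lborel. g \<xi> * H1_rep a (- \<xi>)) = of_real (a + 2)"
    unfolding H1_rep_pairing[OF ig] using ends by simp
  \<comment> \<open>The weight 1 + xi^2 is shared evenly between the two factors, so that
    Cauchy-Schwarz produces two H^1 norms.\<close>
  let ?q = "\<lambda>\<xi>::real. sqrt (1 + \<xi>\<^sup>2)"
  have q: "(?q \<xi>)\<^sup>2 = 1 + \<xi>\<^sup>2" "?q \<xi> * ?q \<xi> = 1 + \<xi>\<^sup>2" for \<xi> by simp_all
  have prod: "g \<xi> * H1_rep a (- \<xi>) = (of_real (?q \<xi>) * g \<xi>) * (of_real (?q \<xi>) * ?f (- \<xi>))" for \<xi>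
  proof -
    have "H1_rep a (- \<xi>) = of_real (?q \<xi> * ?q \<xi>) * ?f (- \<xi>)"
      unfolding q(2) fourier_H1_min[OF a, symmetric] by simp
    then show ?thesis by (simp only: of_real_mult mult_ac)
  qed
  have s: "(cmod (of_real (?q \<xi>) * h))\<^sup>2 = (1 + \<xi>\<^sup>2) powr 1 * (cmod h)\<^sup>2" for \<xi> h
    by (simp add: norm_mult power_mult_distrib)
  have "cmod (LINT \<xi>|lborel. (of_real (?q \<xi>) * g \<xi>) * (of_real (?q \<xi>) * ?f (- \<xi>)))
    \<le> sqrt (LINT \<xi>|lborel. (cmod (of_real (?q \<xi>) * g \<xi>))\<^sup>2) * sqrt (LINT \<xi>|lborel. (cmod (of_real (?q \<xi>) * ?f (- \<xi>)))\<^sup>2)"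
    by (rule square_integrable_mult(3)) (use g w' in \<open>simp_all only: s weighted_L2_def mem_Collect_eq, simp_all\<close>)
  then have "cmod (of_real (a + 2)) \<le> sqrt (weighted_norm2 1 g) * sqrt (a + 2)"
    unfolding prod[symmetric] pair s weighted_norm2_def[symmetric] w'(2) .
  then have "sqrt (a + 2) * sqrt (a + 2) \<le> sqrt (weighted_norm2 1 g) * sqrt (a + 2)" using a by simp
  then show ?thesis by (rule mult_right_le_imp_le) (use a in simp)
qed

theorem lemma4p13:
  fixes a :: real and \<Omega> :: "real set"
  assumes "a > 0" and "\<Omega> = {0<..<a}"
  shows "\<not> exact_interpolation_scale {0..2} (Sobolev \<Omega>) \<and>
    (\<forall>\<theta>. 0 < \<theta> \<and> \<theta> < 1 \<longrightarrow>
       eq_space (interp (L2_space \<Omega>) (Sobolev \<Omega> 2) \<theta>) (Sobolev \<Omega> (2 * \<theta>))) \<and>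
    nrm (interp (L2_space \<Omega>) (Sobolev \<Omega> 2) (1/2)) (fun_distr \<Omega> (\<lambda>_. 1))
      \<noteq> nrm (Sobolev \<Omega> 1) (fun_distr \<Omega> (\<lambda>_. 1)) \<and>
    nrm (interp (L2_space \<Omega>) (Sobolev \<Omega> 2) (1/2)) (fun_distr \<Omega> (\<lambda>_. 1))
        / nrm (Sobolev \<Omega> 1) (fun_distr \<Omega> (\<lambda>_. 1))
      \<le> ((a\<^sup>2 + 4 * a) / (a\<^sup>2 + 4 * a + 4)) powr (1/4) \<and>
    ((a\<^sup>2 + 4 * a) / (a\<^sup>2 + 4 * a + 4)) powr (1/4) < min (a powr (1/4)) 1"
proof -
  note a = assms(1)
  define e where "e c = fun_distr \<Omega> (\<lambda>_. complex_of_real c)" for c :: real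
  have e1: "e 1 = fun_distr \<Omega> (\<lambda>_. 1)" by (simp add: e_def)
  have add: "e c + e d = e (c + d)" for c d
    unfolding e_def assms(2) L2_functions_add(2)[OF const_L2 const_L2] by simp
  have const: "integrable lborel (cut \<Omega> (\<lambda>_. complex_of_real c))"
    and const2: "integrable lborel (\<lambda>x. (cmod (cut \<Omega> (\<lambda>_. complex_of_real c) x))\<^sup>2)"
    and cint: "(LINT x|lborel. (cmod (cut \<Omega> (\<lambda>_. complex_of_real c) x))\<^sup>2) = c\<^sup>2 * a" for c
    using L2_cut_integrable[OF const_L2] const_L2[of "of_real c" a] integral_square_cut_const[OF a, of "of_real c"]
    by (auto simp: assms(2) L2_functions_cut)
  have L2: "e c \<in> carr (L2_space \<Omega>)" "(nrm (L2_space \<Omega>) (e c))\<^sup>2 \<le> c\<^sup>2 * a" for c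
  proof -
    show "e c \<in> carr (L2_space \<Omega>)" by (simp add: e_def L2_space_carr assms(2) const_L2)
    have "nrm (L2_space \<Omega>) (e c) = sqrt (c\<^sup>2 * a)"
      unfolding e_def cint[symmetric] unfolding assms(2) by (rule L2_space_nrm[OF const_L2])
    then show "(nrm (L2_space \<Omega>) (e c))\<^sup>2 \<le> c\<^sup>2 * a" using a by simp
  qed
  have Sob: "e c \<in> carr (Sobolev \<Omega> s) \<and> (nrm (Sobolev \<Omega> s) (e c))\<^sup>2 \<le> weighted_norm2 s g"
    if g: "g \<in> weighted_L2 s" "e c = restrict_distr \<Omega> (fourier_distr g)" "0 \<le> s" for c s g
  proof -
    have m: "e c \<in> carr (Sobolev \<Omega> s)" unfolding g(2) assms(2) by (rule Sobolev_carrI[OF g(1,3)])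
    have "0 \<le> nrm (Sobolev \<Omega> s) (e c)"
      by (rule Sobolev_nrm_ge[OF m g(3)]) (simp add: weighted_norm2_nonneg)
    moreover have "nrm (Sobolev \<Omega> s) (e c) \<le> sqrt (weighted_norm2 s g)"
      unfolding g(2) by (rule Sobolev_nrm_le[OF g(1,3)])
    ultimately have "(nrm (Sobolev \<Omega> s) (e c))\<^sup>2 \<le> (sqrt (weighted_norm2 s g))\<^sup>2" by (intro power_mono)
    then show ?thesis using m by (simp add: weighted_norm2_nonneg)
  qed
  \<comment> \<open>The scale starts at \<open>Sobolev \<Omega> 0\<close>, the other claims at
    \<open>L2_space \<Omega>\<close>. The same upper bound for both norms lets one segment estimate
    serve both pairs.\<close>
  have H0: "e c \<in> carr (Sobolev \<Omega> 0)" "(nrm (Sobolev \<Omega> 0) (e c))\<^sup>2 \<le> c\<^sup>2 * a" for c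
  proof -
    note F = fourier_weighted_L2[OF const const2, of c]
    have "e c = restrict_distr \<Omega> (fourier_distr (fourier (cut \<Omega> (\<lambda>_. complex_of_real c))))"
      unfolding restrict_fourier_distr_fourier[OF const] by (simp add: e_def)
    from Sob[OF F(1) this] show "e c \<in> carr (Sobolev \<Omega> 0)" "(nrm (Sobolev \<Omega> 0) (e c))\<^sup>2 \<le> c\<^sup>2 * a"
      using F(2) unfolding cint by auto
  qed
  obtain g where g: "g \<in> weighted_L2 2" "restrict_distr \<Omega> (fourier_distr g) = e 1" "weighted_norm2 2 g \<le> a + 4"
    using H2_norm_one_le[OF a] unfolding assms(2) e1 by metis
  have H2: "e c \<in> carr (Sobolev \<Omega> 2)" "(nrm (Sobolev \<Omega> 2) (e c))\<^sup>2 \<le> c\<^sup>2 * (a + 4)" for c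
  proof -
    note cg = weighted_L2_cmult[OF g(1), of "of_real c"]
    have "restrict_distr \<Omega> (fourier_distr (\<lambda>\<xi>. of_real c * g \<xi>)) \<phi> = of_real c * restrict_distr \<Omega> (fourier_distr g) \<phi>" for \<phi>
      by (simp add: restrict_distr_def fourier_distr_def mult.assoc)
    moreover have "e c \<phi> = of_real c * e 1 \<phi>" for \<phi>
      by (simp add: e_def fun_distr_def mult.assoc set_lebesgue_integral_def scaleR_conv_of_real mult.left_commute[of _ "of_real c"])
    ultimately have "e c = restrict_distr \<Omega> (fourier_distr (\<lambda>\<xi>. of_real c * g \<xi>))" by (simp add: fun_eq_iff g(2))
    from Sob[OF cg(1) this] have "e c \<in> carr (Sobolev \<Omega> 2)" "(nrm (Sobolev \<Omega> 2) (e c))\<^sup>2 \<le> c\<^sup>2 * weighted_norm2 2 g"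
      unfolding cg(2) by auto
    moreover have "c\<^sup>2 * weighted_norm2 2 g \<le> c\<^sup>2 * (a + 4)" by (intro mult_left_mono g(3)) simp
    ultimately show "e c \<in> carr (Sobolev \<Omega> 2)" "(nrm (Sobolev \<Omega> 2) (e c))\<^sup>2 \<le> c\<^sup>2 * (a + 4)" by auto
  qed
  have H1: "sqrt (a + 2) \<le> nrm (Sobolev \<Omega> 1) (e 1)"
  proof (rule Sobolev_nrm_ge)
    show "e 1 \<in> carr (Sobolev \<Omega> 1)"
      using Sob[OF weighted_L2_mono[OF g(1)] g(2)[symmetric]] by simp
  qed (use H1_norm_one_ge[OF a] in \<open>simp_all add: e1 assms(2)\<close>)
  have a4: "a + 4 > 0" using a by simp
  define N where "N = sqrt (sqrt (a * (a + 4)))"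
  have iL: "nrm (interp (L2_space \<Omega>) (Sobolev \<Omega> 2) (1/2)) (e 1) \<le> N"
    unfolding N_def by (rule interp_half_segment(2)[where e=e, OF a a4 L2 H2 add])
  have iH: "nrm (interp (Sobolev \<Omega> 0) (Sobolev \<Omega> 2) (1/2)) (e 1) \<le> N" "e 1 \<in> carr (interp (Sobolev \<Omega> 0) (Sobolev \<Omega> 2) (1/2))"
    unfolding N_def by (rule interp_half_segment[where e=e, OF a a4 H0 H2 add])+
  define R where "R = (a\<^sup>2 + 4 * a) / (a\<^sup>2 + 4 * a + 4)"
  have "a\<^sup>2 > 0" using a by simp
  then have den: "a\<^sup>2 + 4 * a + 4 > 0" "a\<^sup>2 + 4 * a > 0" using a by linarith+
  have R: "0 < R" "R < 1" "R < a"
  proof -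
    show "0 < R" "R < 1" using den by (simp_all add: R_def)
    have "a\<^sup>2 + 4 * a < a * (a\<^sup>2 + 4 * a + 4)"
    proof -
      have "a * (a\<^sup>2 + 4 * a + 4) - (a\<^sup>2 + 4 * a) = a * (a\<^sup>2 + 3 * a)" by (simp add: algebra_simps power2_eq_square)
      moreover have "a * (a\<^sup>2 + 3 * a) > 0" using a by (intro mult_pos_pos add_pos_pos) auto
      ultimately show ?thesis by linarith
    qed
    then show "R < a" using den by (simp add: R_def pos_divide_less_eq)
  qed
  have R4: "R powr (1/4) < min (a powr (1/4)) 1"
    using R powr_less_mono2[of "1/4" R a] powr_less_mono2[of "1/4" R 1] by simp
  \<comment> \<open>N^4 = a(a+4) and a^2 + 4a + 4 = (a+2)^2, so \<open>R\<close> is the fourth power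
    of N / sqrt(a + 2).\<close>
  have NR: "N / sqrt (a + 2) = R powr (1/4)"
  proof -
    have "(a + 2)\<^sup>2 = a\<^sup>2 + 4 * a + 4" by (simp add: power2_sum)
    then have "R = a * (a + 4) / (a + 2)\<^sup>2" by (simp add: R_def power2_eq_square algebra_simps)
    then have "sqrt (sqrt R) = N / sqrt (a + 2)" using a by (simp add: N_def real_sqrt_divide)
    moreover have "sqrt (sqrt R) = R powr (1/4)" using R(1) by (simp add: powr_half_sqrt[symmetric] powr_powr)
    ultimately show ?thesis by simp
  qed
  have s2: "sqrt (a + 2) > 0" using a by simp
  have "R powr (1/4) < 1" using R4 by simp
  then have "N / sqrt (a + 2) < 1" unfolding NR .
  \<comment> \<open>The bound for the interpolation norm lies strictly below the bound for the H^1
    norm; both the failure of exactness and the inequality of norms rest on this gap.\<close>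
  then have Nlt: "N < sqrt (a + 2)" using iffD1[OF pos_divide_less_eq[OF s2]] by fastforce
  have N0: "N \<ge> 0" using a by (simp add: N_def)
  have ratio: "nrm (interp (L2_space \<Omega>) (Sobolev \<Omega> 2) (1/2)) (e 1) / nrm (Sobolev \<Omega> 1) (e 1) \<le> R powr (1/4)"
    unfolding NR[symmetric] by (rule frac_le[OF N0 iL s2 H1])
  have "\<not> exact_interpolation_scale {0..2} (Sobolev \<Omega>)"
  proof
    assume "exact_interpolation_scale {0..2} (Sobolev \<Omega>)"
    then have *: "\<And>s t \<eta>. s \<in> {0..2} \<Longrightarrow> t \<in> {0..2} \<Longrightarrow> 0 < \<eta> \<Longrightarrow> \<eta> < 1 \<Longrightarrow>
        eq_space_isometric (interp (Sobolev \<Omega> s) (Sobolev \<Omega> t) \<eta>) (Sobolev \<Omega> ((1 - \<eta>) * s + \<eta> * t))"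
      unfolding exact_interpolation_scale_def by blast
    \<comment> \<open>Orders 0 and 2 with eta = 1/2 give order 1. Equality of norms is asserted on
      the carrier, which is why \<open>iH\<close> also records the membership of
      \<open>e 1\<close>.\<close>
    have "eq_space_isometric (interp (Sobolev \<Omega> 0) (Sobolev \<Omega> 2) (1/2)) (Sobolev \<Omega> 1)"
      using *[of 0 2 "1/2"] by simp
    then have "nrm (interp (Sobolev \<Omega> 0) (Sobolev \<Omega> 2) (1/2)) (e 1) = nrm (Sobolev \<Omega> 1) (e 1)"
      using iH(2) unfolding eq_space_isometric_def by blast
    then show False using iH(1) H1 Nlt by linarith
  qed
  moreover have "eq_space (interp (L2_space \<Omega>) (Sobolev \<Omega> 2) \<theta>) (Sobolev \<Omega> (2 * \<theta>))" if "0 < \<theta>" "\<theta> < 1" for \<theta>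
    unfolding assms(2) by (rule interp_L2_H2[OF a that])
  moreover have "nrm (interp (L2_space \<Omega>) (Sobolev \<Omega> 2) (1/2)) (e 1) \<noteq> nrm (Sobolev \<Omega> 1) (e 1)"
    using iL H1 Nlt by linarith
  ultimately show ?thesis using ratio R4 unfolding e1 R_def by blast
qed

end
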